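(* Suppose that $\Theta=(\theta_m)_{m\in\mathbb{N}}$ satisfies the standing assumptions (A) stated in the context (with $k\ge1$ and $P$ as there), and that in addition, for all $j\ge1$, $$g_\Theta^{(j)}(e^{-w})=(j-1)!\left(\frac{e^{w}}{w}\right)^{j}(-\log w)^k+O\left(\left(\frac{e^{w}}{w}\right)^{j}(-\log w)^{k-1}\right)\qquad\text{as } w\to0,\ \mathrm{Re}(w)\ge0,$$ where $g_\Theta^{(j)}$ is the $j$-th derivative of $g_\Theta$. Let $r=r_n$ be the solution of $P'(r)=ne^{-r}$. If $\mathfrak{S}_n$ is endowed with $\mathbb{P}_\Theta$, then for each $b\in\mathbb{N}$, as $n\to\infty$, $$\left(\frac{L_1\cdot r^k}{n},\frac{L_2\cdot r^k}{n},\ldots,\frac{L_b\cdot r^k}{n}\right)\stackrel{d}{\longrightarrow}(E_1,E_2,\ldots,E_b),$$ where $E_1,\dots,E_b$ are i.i.d. exponentially distributed random variables with parameter $1$.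
   Context: $\mathfrak{S}_n$ is the symmetric group on $\{1,\dots,n\}$, and for $\sigma\in\mathfrak{S}_n$, $C_m=C_m(\sigma)$ is the number of cycles of length $m$ in the cycle decomposition of $\sigma$. For $\Theta=(\theta_m)_{m\ge1}$ with $\theta_m\ge 0$, the probability measure $\mathbb{P}_\Theta$ on $\mathfrak{S}_n$ is $\mathbb{P}_\Theta[\sigma]=\frac{1}{h_n n!}\prod_{m=1}^n\theta_m^{C_m(\sigma)}$, with $h_n=h_n(\Theta)$ the normalization constant and $h_0:=1$. Put $g_\Theta(t)=\sum_{m\ge1}\frac{\theta_m}{m}t^m$. Standing assumptions (A): $\theta_m\ge0$ for all $m\ge 1$; $g_\Theta$ is holomorphic for $|t|<1$; $g_\Theta$ is continuous (extends continuously) in the punctured disc $\{|t|\le1,\ t\ne1\}$; and there exist an integer $k\ge1$ and a polynomial $P(r)=\frac{r^{k+1}}{k+1}+\sum_{j=0}^k c_jr^j$ with real $c_j$ such that $g_\Theta(e^{-w})=P(-\log w)+O(w)$ as $w\to0$, $\mathrm{Re}(w)\ge0$ (principal branch of $\log$). The equation $P'(r)=ne^{-r}$ has a real solution for all sufficiently large $n$. In the additional assumption, the values of $g_\Theta^{(j)}$ on the boundary $|t|=1$, $t\ne 1$ near $1$, are understood as those of a continuous extension. Lexicographic ordering of cycles: for $\sigma\in\mathfrak{S}_n$, $L_1=L_1(\sigma)$ is the length of the cycle containing the element $1$, $L_2=L_2(\sigma)$ is the length of the cycle containing the smallest element not in the previous cycle, and so on ($L_j(\sigma)=0$ if $\sigma$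 has fewer than $j$ cycles). *)

theory Defs
  imports
    "HOL-Probability.Probability"
    "HOL-Complex_Analysis.Complex_Analysis"
    "HOL-Combinatorics.Combinatorics"
    "HOL-Library.Landau_Symbols"
begin

text \<open>The supports of the cycles of a permutation \<^term>\<open>\<sigma>\<close> of \<open>{1..n}\<close> (fixed points included) are the
  sets \<^term>\<open>orbit \<sigma> i\<close>.\<close>

definition cycle_count :: "nat \<Rightarrow> nat \<Rightarrow> (nat \<Rightarrow> nat) \<Rightarrow> nat" where
  "cycle_count n m \<sigma> = card {C \<in> orbit \<sigma> ` {1..n}. card C = m}"

definition cycle_weight :: "(nat \<Rightarrow> real) \<Rightarrow> nat \<Rightarrow> (nat \<Rightarrow> nat) \<Rightarrow> real" where
  "cycle_weight \<theta> n \<sigma> = (\<Prod>m = 1..n. \<theta> m ^ cycle_count n m \<sigma>)"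

definition h_norm :: "(nat \<Rightarrow> real) \<Rightarrow> nat \<Rightarrow> real" where
  "h_norm \<theta> n = (\<Sum>\<sigma> | \<sigma> permutes {1..n}. cycle_weight \<theta> n \<sigma>) / fact n"

text \<open>If \<^term>\<open>h_norm \<theta> n = 0\<close>, as may happen for small \<open>n\<close> when some of the \<open>\<theta> m\<close> vanish, this is
  the zero measure. Convergence in distribution (below) to a probability measure then forces total
  mass \<open>1\<close> in the limit.\<close>

definition P_Theta :: "(nat \<Rightarrow> real) \<Rightarrow> nat \<Rightarrow> (nat \<Rightarrow> nat) measure" where
  "P_Theta \<theta> n = point_measure {\<sigma>. \<sigma> permutes {1..n}}
     (\<lambda>\<sigma>. ennreal (cycle_weight \<theta> n \<sigma> / (h_norm \<theta> n * fact n)))"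

text \<open>The elements of \<open>{1..n}\<close> outside the first \<open>j\<close> cycles in the lexicographic ordering.\<close>

primrec lex_remaining :: "nat \<Rightarrow> (nat \<Rightarrow> nat) \<Rightarrow> nat \<Rightarrow> nat set" where
  "lex_remaining n \<sigma> 0 = {1..n}"
| "lex_remaining n \<sigma> (Suc j) =
     lex_remaining n \<sigma> j - orbit \<sigma> (Min (lex_remaining n \<sigma> j))"

text \<open>Indexed from \<open>j = 1\<close>.\<close>

definition cycle_length :: "nat \<Rightarrow> nat \<Rightarrow> (nat \<Rightarrow> nat) \<Rightarrow> nat" where
  "cycle_length n j \<sigma> =
     (let R = lex_remaining n \<sigma> (j - 1) in if R = {} then 0 else card (orbit \<sigma> (Min R)))"

text \<open>The summand for \<open>m = 0\<close> is zero, since division by zero yields zero.\<close>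

definition g_Theta :: "(nat \<Rightarrow> real) \<Rightarrow> complex \<Rightarrow> complex" where
  "g_Theta \<theta> t = (\<Sum>m. of_real (\<theta> m / real m) * t ^ m)"

definition P_poly :: "nat \<Rightarrow> (nat \<Rightarrow> real) \<Rightarrow> real poly" where
  "P_poly k c = monom (1 / real (k + 1)) (k + 1) + (\<Sum>j = 0..k. monom (c j) j)"

text \<open>\<open>G\<close> is a continuous extension of \<open>f\<close> from the part of \<open>S\<close> inside the open unit disc to
  \<open>S\<close>. Where \<open>S\<close> is contained in the closure of that part, \<open>G\<close> is unique on \<open>S\<close>.\<close>

definition disc_extension :: "(complex \<Rightarrow> complex) \<Rightarrow> (complex \<Rightarrow> complex) \<Rightarrow> complex set \<Rightarrow> bool" where
  "disc_extension G f S \<longleftrightarrow> continuous_on S G \<and> (\<forall>t \<in> S \<inter> ball 0 1. G t = f t)"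

text \<open>The filter of the limit \<open>w \<rightarrow> 0\<close>, \<open>Re w \<ge> 0\<close>; it excludes \<open>w = 0\<close>.\<close>

abbreviation at_zero_right_half :: "complex filter" where
  "at_zero_right_half \<equiv> at 0 within {w. 0 \<le> Re w}"

definition standing_assumptions :: "(nat \<Rightarrow> real) \<Rightarrow> nat \<Rightarrow> (nat \<Rightarrow> real) \<Rightarrow> bool" where
  "standing_assumptions \<theta> k c \<longleftrightarrow>
     (\<forall>m\<ge>1. 0 \<le> \<theta> m) \<and>
     (\<forall>t. norm t < 1 \<longrightarrow> summable (\<lambda>m. of_real (\<theta> m / real m) * t ^ m :: complex)) \<and>
     g_Theta \<theta> holomorphic_on ball 0 1 \<and>
     1 \<le> k \<and>
     (\<exists>G. disc_extension G (g_Theta \<theta>) (cball 0 1 - {1}) \<and>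
        (\<lambda>w. G (exp (- w)) - poly (map_poly of_real (P_poly k c)) (- Ln w))
          \<in> O[at_zero_right_half](\<lambda>w. w))"

text \<open>The neighbourhood of \<open>1\<close> on which the boundary values exist may depend on \<open>j\<close>.\<close>

definition derivative_assumption :: "(nat \<Rightarrow> real) \<Rightarrow> nat \<Rightarrow> bool" where
  "derivative_assumption \<theta> k \<longleftrightarrow>
     (\<forall>j\<ge>1. \<exists>G. \<exists>\<delta>>0.
        disc_extension G ((deriv ^^ j) (g_Theta \<theta>)) ((cball 0 1 - {1}) \<inter> ball 1 \<delta>) \<and>
        (\<lambda>w. G (exp (- w)) - fact (j - 1) * (exp w / w) ^ j * (- Ln w) ^ k)
          \<in> O[at_zero_right_half](\<lambda>w. (exp w / w) ^ j * (- Ln w) ^ (k - 1)))"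

text \<open>Convergence in distribution of random variables with values in the topological space \<open>T\<close>,
  the \<open>n\<close>-th one defined on its own space \<^term>\<open>M n\<close>, by testing against bounded continuous
  functions.\<close>

definition converges_in_distribution ::
  "'c topology \<Rightarrow> (nat \<Rightarrow> 'a measure) \<Rightarrow> (nat \<Rightarrow> 'a \<Rightarrow> 'c) \<Rightarrow> 'b measure \<Rightarrow> ('b \<Rightarrow> 'c) \<Rightarrow> bool" where
  "converges_in_distribution T M X N Y \<longleftrightarrow>
     (\<forall>f. continuous_map T euclideanreal f \<and> bounded (f ` topspace T) \<longrightarrow>
        (\<lambda>n. \<integral>\<omega>. f (X n \<omega>) \<partial>M n) \<longlonglongrightarrow> (\<integral>\<omega>. f (Y \<omega>) \<partial>N))"

end

theory Submission
  imports Defs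
begin

text \<open>Multiplying the law of \<open>(L\<^sub>1, \<dots>, L\<^sub>b)\<close> out, one sees that it dominates the measure with weights
  \<open>\<theta>\<^bsub>l\<^sub>1\<^esub> \<cdots> \<theta>\<^bsub>l\<^sub>b\<^esub> h\<^bsub>n - l\<^sub>1 - \<dots> - l\<^sub>b\<^esub> / (n ^ b h\<^sub>n)\<close>. The Laplace transform of this measure is
  a quotient of coefficients of power series, the numerator being the coefficient of \<open>t ^ n\<close> in
  \<open>\<Prod>\<^sub>i (t\<^sub>i g'(t\<^sub>i)) exp (g t)\<close> with \<open>t\<^sub>i = exp (- s\<^sub>i r ^ k / n) t\<close>. On the circle \<open>|t| = exp (- w)\<close> through
  the saddle point \<open>w = exp (- r)\<close> the factor \<open>exp (g t)\<close> concentrates in relative width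
  \<open>r ^ (- k / 2)\<close>, where \<open>t\<^sub>i g'(t\<^sub>i) / n\<close> is close to \<open>1 / (1 + s\<^sub>i)\<close>. So the Laplace transform tends to
  that of independent exponential variables. In particular the dominated measure has total mass
  tending to \<open>1\<close>, and the law itself has the same limit.\<close>

subsection \<open>Weights and the lexicographic cycle lengths\<close>

text \<open>The exact law carries the factors \<open>1 / (n * (n - l_1) * ...)\<close>, which do not
  fit a product of generating functions. Replacing each by \<open>1 / n\<close> turns the sums into
  Cauchy products and costs only an inequality. That suffices because the exact law has mass one:
  lower bounds for the integrals of \<open>F\<close> and of \<open>1 - F\<close> enclose it, so no
  separate tail estimate for long cycles enters. Up to \<open>n ^ b\<close> the prefactor of the
  saddle point asymptotics is the same for every number \<open>b\<close> of factors; the case of no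
  factors is \<open>h_n\<close> itself, so the prefactor never has to be evaluated. The Gaussian
  width comes from the curvature of \<open>- log w\<close> multiplied by \<open>P' r\<close>, the
  \<open>P''\<close> term being smaller by a factor \<open>1 / r\<close>. The expansion of
  \<open>g'\<close> holds only near 1, but its coefficients are nonnegative, so its modulus on a
  circle is largest at the positive real point. Laplace transforms are used only at integer
  arguments: with \<open>y = exp (- x)\<close> these are moments of a law on a cube, where
  polynomials are dense.\<close>

lemma cycle_weight_altdef:
  assumes "\<sigma> permutes {1..n}"
  shows "cycle_weight \<theta> n \<sigma> = (\<Prod>C\<in>orbit \<sigma> ` {1..n}. \<theta> (card C))"
proof -
  have sub: "card ` (orbit \<sigma> ` {1..n}) \<subseteq> {1..n}"
  proof safe
    fix i assume i: "i \<in> {1..n}"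
    have "orbit \<sigma> i \<subseteq> {1..n}" using permutes_orbit_subset[OF assms i] .
    then have "finite (orbit \<sigma> i)" "card (orbit \<sigma> i) \<le> n"
      using finite_subset card_mono[of "{1..n}" "orbit \<sigma> i"] by auto
    moreover have "0 < card (orbit \<sigma> i)"
      using \<open>finite (orbit \<sigma> i)\<close> orbit_nonempty[of \<sigma> i] by (simp add: card_gt_0_iff)
    ultimately show "card (orbit \<sigma> i) \<in> {1..n}" by (simp add: Suc_le_eq)
  qed
  have "(\<Prod>C\<in>orbit \<sigma> ` {1..n}. \<theta> (card C)) =
        (\<Prod>m = 1..n. \<Prod>C\<in>{C \<in> orbit \<sigma> ` {1..n}. card C = m}. \<theta> (card C))"
    by (rule prod.group[symmetric]) (use sub in auto)
  also have "\<dots> = (\<Prod>m = 1..n. \<theta> m ^ cycle_count n m \<sigma>)"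
    by (intro prod.cong refl) (simp add: cycle_count_def)
  finally show ?thesis by (simp add: cycle_weight_def)
qed

section \<open>Splitting a permutation at the cycle of one point\<close>

definition cyclic_perms :: "'a set \<Rightarrow> 'a \<Rightarrow> ('a \<Rightarrow> 'a) set" where
  "cyclic_perms C a = {\<tau>. \<tau> permutes C \<and> orbit \<tau> a = C}"

lemma orbit_comp_left:
  assumes "\<tau> permutes C" "\<rho> permutes B" "B \<inter> C = {}" "x \<in> C"
  shows "orbit (\<tau> \<circ> \<rho>) x = orbit \<tau> x"
  by (rule orbit_cong0[symmetric, OF assms(4)])
     (use assms in \<open>auto simp: permutes_in_image permutes_def disjoint_iff\<close>)

lemma orbit_comp_right:
  assumes "\<tau> permutes C" "\<rho> permutes B" "B \<inter> C = {}" "x \<in> B"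
  shows "orbit (\<tau> \<circ> \<rho>) x = orbit \<rho> x"
  by (rule orbit_cong0[symmetric, OF assms(4)])
     (use assms in \<open>auto simp: permutes_in_image disjoint_iff permutes_not_in\<close>)

text \<open>Both \<open>C\<close> and \<open>A - C\<close> are invariant under a permutation whose
  orbit of \<open>a\<close> is \<open>C\<close>, so restricting it to the two blocks undoes the
  composition.\<close>

lemma bij_betw_cyclic_perms:
  assumes "finite A" "C \<subseteq> A" "a \<in> C"
  shows "bij_betw (\<lambda>(\<tau>, \<rho>). \<tau> \<circ> \<rho>) (cyclic_perms C a \<times> {\<rho>. \<rho> permutes A - C})
           {\<sigma>. \<sigma> permutes A \<and> orbit \<sigma> a = C}"
proof (rule bij_betw_byWitness[where f' = "\<lambda>\<sigma>. (perm_restrict \<sigma> C, perm_restrict \<sigma> (A - C))"])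
  show "\<forall>x\<in>cyclic_perms C a \<times> {\<rho>. \<rho> permutes A - C}.
       (perm_restrict (case x of (\<tau>, \<rho>) \<Rightarrow> \<tau> \<circ> \<rho>) C, perm_restrict (case x of (\<tau>, \<rho>) \<Rightarrow> \<tau> \<circ> \<rho>) (A - C)) = x"
  proof
    fix x assume "x \<in> cyclic_perms C a \<times> {\<rho>. \<rho> permutes A - C}"
    then obtain \<tau> \<rho> where x: "x = (\<tau>, \<rho>)" and t: "\<tau> permutes C" and r: "\<rho> permutes A - C"
      by (auto simp: cyclic_perms_def)
    have "perm_restrict (\<tau> \<circ> \<rho>) C = \<tau>"
      using t r by (auto simp: fun_eq_iff perm_restrict_def permutes_not_in)
    moreover have "perm_restrict (\<tau> \<circ> \<rho>) (A - C) = \<rho>"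
    proof
      fix x show "perm_restrict (\<tau> \<circ> \<rho>) (A - C) x = \<rho> x"
        using t r permutes_in_image[OF r, of x]
        by (auto simp: perm_restrict_def permutes_not_in)
    qed
    ultimately show "(perm_restrict (case x of (\<tau>, \<rho>) \<Rightarrow> \<tau> \<circ> \<rho>) C,
        perm_restrict (case x of (\<tau>, \<rho>) \<Rightarrow> \<tau> \<circ> \<rho>) (A - C)) = x" by (simp add: x)
  qed
next
  show "\<forall>\<sigma>\<in>{\<sigma>. \<sigma> permutes A \<and> orbit \<sigma> a = C}.
     (case (perm_restrict \<sigma> C, perm_restrict \<sigma> (A - C)) of (\<tau>, \<rho>) \<Rightarrow> \<tau> \<circ> \<rho>) = \<sigma>"
  proof safe
    fix \<sigma> assume s: "\<sigma> permutes A" and C: "C = orbit \<sigma> a"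
    have cyc: "cyclic_on \<sigma> C" unfolding C using s assms(1) by (rule cyclic_on_orbit)
    have 1: "perm_restrict \<sigma> (A - C) permutes A - C"
      using perm_restrict_diff_cyclic[OF s cyc] .
    have "(perm_restrict \<sigma> C \<circ> perm_restrict \<sigma> (A - C)) x = \<sigma> x" for x
    proof (cases "x \<in> A - C")
      case True
      then have "\<sigma> x \<in> A - C" using permutes_in_image[OF 1, of x] by (simp add: perm_restrict_def)
      then show ?thesis using True by (simp add: perm_restrict_def)
    next
      case False
      then show ?thesis using s assms(2) by (auto simp: perm_restrict_def permutes_not_in)
    qed
    then show "perm_restrict \<sigma> (orbit \<sigma> a) \<circ> perm_restrict \<sigma> (A - orbit \<sigma> a) = \<sigma>"
      by (auto simp: C)
  qed
next
  show "(\<lambda>(\<tau>, \<rho>). \<tau> \<circ> \<rho>) ` (cyclic_perms C a \<times> {\<rho>. \<rho> permutes A - C}) \<subseteq> {\<sigma>. \<sigma> permutes A \<and> orbit \<sigma> a = C}"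
  proof clarify
    fix \<tau> \<rho> assume "\<tau> \<in> cyclic_perms C a" and r: "\<rho> permutes A - C"
    then have t: "\<tau> permutes C" and o: "orbit \<tau> a = C" by (simp_all add: cyclic_perms_def)
    have "\<tau> \<circ> \<rho> permutes A"
      using permutes_compose[OF permutes_subset[OF r, of A] permutes_subset[OF t, of A]] assms by auto
    moreover have "orbit (\<tau> \<circ> \<rho>) a = C"
      using orbit_comp_left[OF t r _ assms(3)] o by auto
    ultimately show "\<tau> \<circ> \<rho> permutes A \<and> orbit (\<tau> \<circ> \<rho>) a = C" ..
  qed
next
  show "(\<lambda>\<sigma>. (perm_restrict \<sigma> C, perm_restrict \<sigma> (A - C))) ` {\<sigma>. \<sigma> permutes A \<and> orbit \<sigma> a = C}
    \<subseteq> cyclic_perms C a \<times> {\<rho>. \<rho> permutes A - C}"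
  proof (rule image_subsetI)
    fix \<sigma> assume "\<sigma> \<in> {\<sigma>. \<sigma> permutes A \<and> orbit \<sigma> a = C}"
    then have s: "\<sigma> permutes A" and C: "C = orbit \<sigma> a" by auto
    have cyc: "cyclic_on \<sigma> C" unfolding C using s assms(1) by (rule cyclic_on_orbit)
    have 1: "perm_restrict \<sigma> (A - C) permutes A - C"
      using perm_restrict_diff_cyclic[OF s cyc] .
    have cyc': "cyclic_on \<sigma> (A - (A - C))" using cyc assms(2) by (simp add: double_diff)
    have "\<sigma> ` C = C"
      using cyc assms(2) s
      by (intro endo_inj_surj finite_subset[OF assms(2,1)])
         (auto intro: cyclic_on_inI inj_on_subset[OF permutes_inj])
    then have 2: "perm_restrict \<sigma> C permutes C"
      by (intro bij_imp_permutes) (auto simp: bij_betw_def perm_restrict_def inj_on_def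
            image_iff permutes_inj[OF s, THEN inj_eq])
    have "orbit (perm_restrict \<sigma> C) a = C"
      using orbit_cyclic_eq3[of "perm_restrict \<sigma> C" C a] cyc assms(3) by (simp add: cyclic_on_perm_restrict)
    with 1 2 show "(perm_restrict \<sigma> C, perm_restrict \<sigma> (A - C)) \<in>
        cyclic_perms C a \<times> {\<rho>. \<rho> permutes A - C}"
      by (simp add: cyclic_perms_def)
  qed
qed

text \<open>Classing permutations by the cycle through \<open>a\<close> is the recursion behind
  every count below. With \<open>a = Min A\<close> it removes the first cycle of the lexicographic
  ordering.\<close>

lemma sum_permutations_first_cycle:
  fixes F :: "('a \<Rightarrow> 'a) \<Rightarrow> 'b::comm_monoid_add"
  assumes "finite A" "a \<in> A"
  shows "(\<Sum>\<sigma> | \<sigma> permutes A. F \<sigma>) =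
    (\<Sum>C | C \<subseteq> A \<and> a \<in> C. \<Sum>\<tau>\<in>cyclic_perms C a. \<Sum>\<rho> | \<rho> permutes A - C. F (\<tau> \<circ> \<rho>))"
proof -
  have "(\<Sum>\<sigma> | \<sigma> permutes A. F \<sigma>) =
    (\<Sum>C | C \<subseteq> A \<and> a \<in> C. \<Sum>\<sigma>\<in>{\<sigma> \<in> {\<sigma>. \<sigma> permutes A}. orbit \<sigma> a = C}. F \<sigma>)"
  proof (rule sum.group[symmetric])
    show "(\<lambda>\<sigma>. orbit \<sigma> a) ` {\<sigma>. \<sigma> permutes A} \<subseteq> {C. C \<subseteq> A \<and> a \<in> C}"
      using assms permutes_orbit_subset
      by (force intro: permutation_self_in_orbit simp: permutation_permutes)
  qed (use assms finite_permutations in auto)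
  also have "\<dots> = (\<Sum>C | C \<subseteq> A \<and> a \<in> C. \<Sum>\<tau>\<in>cyclic_perms C a. \<Sum>\<rho> | \<rho> permutes A - C. F (\<tau> \<circ> \<rho>))"
  proof (rule sum.cong[OF refl])
    fix C assume C: "C \<in> {C. C \<subseteq> A \<and> a \<in> C}"
    then have "(\<Sum>\<sigma>\<in>{\<sigma> \<in> {\<sigma>. \<sigma> permutes A}. orbit \<sigma> a = C}. F \<sigma>) =
      (\<Sum>x\<in>cyclic_perms C a \<times> {\<rho>. \<rho> permutes A - C}. F ((\<lambda>(\<tau>, \<rho>). \<tau> \<circ> \<rho>) x))"
      using sum.reindex_bij_betw[OF bij_betw_cyclic_perms[OF assms(1)], of C a F] by simp
    also have "\<dots> = (\<Sum>\<tau>\<in>cyclic_perms C a. \<Sum>\<rho> | \<rho> permutes A - C. F (\<tau> \<circ> \<rho>))"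
      by (simp add: sum.cartesian_product split_def)
    finally show "(\<Sum>\<sigma>\<in>{\<sigma> \<in> {\<sigma>. \<sigma> permutes A}. orbit \<sigma> a = C}. F \<sigma>) =
      (\<Sum>\<tau>\<in>cyclic_perms C a. \<Sum>\<rho> | \<rho> permutes A - C. F (\<tau> \<circ> \<rho>))" .
  qed
  finally show ?thesis .
qed

lemma card_subsets_containing:
  assumes "finite A" "a \<in> A" "1 \<le> l"
  shows "card {C. C \<subseteq> A \<and> a \<in> C \<and> card C = l} = (card A - 1) choose (l - 1)"
proof -
  have "bij_betw (insert a) {D. D \<subseteq> A - {a} \<and> card D = l - 1} {C. C \<subseteq> A \<and> a \<in> C \<and> card C = l}"
  proof (rule bij_betw_byWitness[where f' = "\<lambda>C. C - {a}"])
    show "insert a ` {D. D \<subseteq> A - {a} \<and> card D = l - 1} \<subseteq> {C. C \<subseteq> A \<and> a \<in> C \<and> card C = l}"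
    proof clarify
      fix D assume D: "D \<subseteq> A - {a}" "card D = l - 1"
      then have "finite D" "a \<notin> D" using assms(1) finite_subset by blast+
      then show "insert a D \<subseteq> A \<and> a \<in> insert a D \<and> card (insert a D) = l"
        using D assms by auto
    qed
  qed (use assms in auto)
  then show ?thesis
    using bij_betw_same_card n_subsets[of "A - {a}" "l - 1"] assms by fastforce
qed

text \<open>There are \<open>(card A - 1) choose (l - 1)\<close> sets of size \<open>l\<close>, and
  the two factorials turn this into \<open>fact (card A - 1)\<close> for every \<open>l\<close>. All
  lengths receive the same combinatorial factor, which leaves a plain convolution in
  \<open>l\<close>.\<close>

lemma sum_subsets_containing:
  fixes f :: "nat \<Rightarrow> real"
  assumes "finite A" "a \<in> A"
  shows "(\<Sum>C | C \<subseteq> A \<and> a \<in> C. fact (card C - 1) * fact (card A - card C) * f (card C)) =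
    fact (card A - 1) * (\<Sum>l = 1..card A. f l)"
proof -
  let ?n = "card A"
  have n: "?n \<ge> 1" using assms by (auto simp: Suc_le_eq card_gt_0_iff)
  have "(\<Sum>C | C \<subseteq> A \<and> a \<in> C. fact (card C - 1) * fact (?n - card C) * f (card C)) =
     (\<Sum>l = 1..?n. \<Sum>C\<in>{C\<in>{C. C \<subseteq> A \<and> a \<in> C}. card C = l}. fact (card C - 1) * fact (?n - card C) * f (card C))"
  proof (rule sum.group[symmetric])
    show "card ` {C. C \<subseteq> A \<and> a \<in> C} \<subseteq> {1..?n}"
    proof clarify
      fix C assume C: "C \<subseteq> A" "a \<in> C"
      then have "finite C" using assms finite_subset by blast
      with C show "card C \<in> {1..?n}" using card_mono[OF assms(1) C(1)] by (auto simp: Suc_le_eq card_gt_0_iff)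
    qed
  qed (use assms in auto)
  also have "\<dots> = (\<Sum>l = 1..?n. fact (?n - 1) * f l)"
  proof (intro sum.cong refl)
    fix l assume l: "l \<in> {1..?n}"
    have "(\<Sum>C\<in>{C\<in>{C. C \<subseteq> A \<and> a \<in> C}. card C = l}. fact (card C - 1) * fact (?n - card C) * f (card C))
      = (\<Sum>C\<in>{C. C \<subseteq> A \<and> a \<in> C \<and> card C = l}. fact (l - 1) * fact (?n - l) * f l)"
      by (intro sum.cong) auto
    also have "\<dots> = real ((?n - 1) choose (l - 1)) * (fact (l - 1) * fact (?n - l) * f l)"
      using card_subsets_containing[OF assms, of l] l by simp
    also have "\<dots> = real (fact (l - 1) * fact ((?n - 1) - (l - 1)) * ((?n - 1) choose (l - 1))) * f l"
      using l by (simp add: algebra_simps)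
    also have "\<dots> = fact (?n - 1) * f l"
      using l by (subst binomial_fact_lemma) auto
    finally show "(\<Sum>C\<in>{C\<in>{C. C \<subseteq> A \<and> a \<in> C}. card C = l}. fact (card C - 1) * fact (?n - card C) * f (card C))
      = fact (?n - 1) * f l" .
  qed
  finally show ?thesis by (simp add: sum_distrib_left)
qed

text \<open>Strong induction on \<open>n = card C\<close>: all \<open>fact n\<close> permutations
  are classed by the cycle of \<open>a\<close>. The proper subsets of \<open>C\<close> contribute
  \<open>fact n - fact (n - 1)\<close> by the induction hypothesis and
  \<open>sum_subsets_containing\<close>; what remains is the class of full cycles.\<close>

lemma card_cyclic_perms:
  assumes "finite C" "a \<in> C"
  shows "real (card (cyclic_perms C a)) = fact (card C - 1)"
  using assms
proof (induction "card C" arbitrary: C rule: less_induct)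
  case less
  let ?n = "card C"
  have n: "?n \<ge> 1" using less.prems by (auto simp: Suc_le_eq card_gt_0_iff)
  let ?S = "{D. D \<subseteq> C \<and> a \<in> D}"
  have fS: "finite ?S" using less.prems by auto
  have CS: "C \<in> ?S" using less.prems by auto
  have "fact ?n = (\<Sum>\<sigma> | \<sigma> permutes C. (1::real))"
    using card_permutations[OF refl less.prems(1)] by simp
  also have "\<dots> = (\<Sum>D\<in>?S. real (card (cyclic_perms D a)) * fact (?n - card D))"
    unfolding sum_permutations_first_cycle[OF less.prems]
  proof (intro sum.cong refl)
    fix D assume D: "D \<in> ?S"
    then have "finite D" using less.prems finite_subset by blast
    then have "card {\<rho>. \<rho> permutes C - D} = fact (?n - card D)"
      using D less.prems by (intro card_permutations) (auto simp: card_Diff_subset)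
    then show "(\<Sum>\<tau>\<in>cyclic_perms D a. \<Sum>\<rho> | \<rho> permutes C - D. (1::real)) =
        real (card (cyclic_perms D a)) * fact (?n - card D)" by simp
  qed
  also have "\<dots> = real (card (cyclic_perms C a)) + (\<Sum>D\<in>?S - {C}. real (card (cyclic_perms D a)) * fact (?n - card D))"
    by (subst sum.remove[OF fS CS]) simp
  also have "(\<Sum>D\<in>?S - {C}. real (card (cyclic_perms D a)) * fact (?n - card D)) =
      (\<Sum>D\<in>?S - {C}. fact (card D - 1) * fact (?n - card D) * 1)"
  proof (intro sum.cong refl)
    fix D assume D: "D \<in> ?S - {C}"
    then have "D \<subset> C" by auto
    then have "card D < ?n" using less.prems psubset_card_mono by blast
    then have "real (card (cyclic_perms D a)) = fact (card D - 1)"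
      using D less finite_subset by blast
    then show "real (card (cyclic_perms D a)) * fact (?n - card D) = fact (card D - 1) * fact (?n - card D) * 1" by simp
  qed
  also have "\<dots> = (\<Sum>D\<in>?S. fact (card D - 1) * fact (?n - card D) * 1) - fact (?n - 1)"
    by (subst sum.remove[OF fS CS]) simp
  also have "(\<Sum>D\<in>?S. fact (card D - 1) * fact (?n - card D) * 1) = fact (?n - 1) * (\<Sum>l = 1..?n. (1::real))"
    by (rule sum_subsets_containing[OF less.prems])
  finally show ?case using n by (simp add: fact_reduce[of ?n] algebra_simps)
qed

section \<open>Weights and cycle lengths under removal of the first cycle\<close>

primrec lex_lengths :: "nat \<Rightarrow> nat set \<Rightarrow> (nat \<Rightarrow> nat) \<Rightarrow> nat list" where
  "lex_lengths 0 A \<sigma> = []"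
| "lex_lengths (Suc b) A \<sigma> = (if A = {} then 0 else card (orbit \<sigma> (Min A))) # lex_lengths b (A - orbit \<sigma> (Min A)) \<sigma>"

lemma lex_lengths_cong:
  assumes "finite A" "\<And>x. x \<in> A \<Longrightarrow> orbit f x = orbit g x"
  shows "lex_lengths b A f = lex_lengths b A g"
  using assms
proof (induction b arbitrary: A)
  case (Suc b)
  show ?case
  proof (cases "A = {}")
    case True
    then show ?thesis using Suc.IH[of "{}"] by simp
  next
    case False
    then have "orbit f (Min A) = orbit g (Min A)" using Suc.prems by simp
    then show ?thesis using Suc.IH[of "A - orbit g (Min A)"] Suc.prems by simp
  qed
qed simp

lemma lex_lengths_eq_cycle_length:
  "lex_lengths b {1..n} \<sigma> = map (\<lambda>j. cycle_length n j \<sigma>) [1..<Suc b]"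
proof -
  \<comment> \<open>Generalising over the number \<open>j\<close> of cycles already removed lets the
    induction advance both recursions together.\<close>
  have "lex_lengths b (lex_remaining n \<sigma> j) \<sigma> = map (\<lambda>i. cycle_length n (Suc (j + i)) \<sigma>) [0..<b]" for b j
  proof (induction b arbitrary: j)
    case (Suc b)
    show ?case
      using Suc.IH[of "Suc j"]
      by (simp add: cycle_length_def Let_def upt_conv_Cons map_Suc_upt[symmetric] del: upt_Suc)
  qed simp
  from this[of b 0] show ?thesis
    by (simp add: map_Suc_upt[symmetric] del: upt_Suc)
qed

text \<open>An arbitrary set is allowed because removing a cycle from \<open>{1..n}\<close> in
  general leaves no interval; on \<open>{1..n}\<close> this is \<open>cycle_weight\<close>.\<close>

definition perm_weight :: "(nat \<Rightarrow> real) \<Rightarrow> 'a set \<Rightarrow> ('a \<Rightarrow> 'a) \<Rightarrow> real" where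
  "perm_weight \<theta> A \<sigma> = (\<Prod>C\<in>orbit \<sigma> ` A. \<theta> (card C))"

lemma perm_weight_comp:
  assumes "finite A" "C \<subseteq> A" "a \<in> C" "\<tau> \<in> cyclic_perms C a" "\<rho> permutes A - C"
  shows "perm_weight \<theta> A (\<tau> \<circ> \<rho>) = \<theta> (card C) * perm_weight \<theta> (A - C) \<rho>"
proof -
  have t: "\<tau> permutes C" and o: "orbit \<tau> a = C" using assms by (simp_all add: cyclic_perms_def)
  have fin: "finite C" using assms finite_subset by blast
  have "cyclic_on \<tau> C" using o assms(3) by (auto simp: cyclic_on_def)
  then have "orbit (\<tau> \<circ> \<rho>) ` C = {C}"
    using orbit_comp_left[OF t assms(5)] assms(3) by (force simp: orbit_cyclic_eq3)
  moreover have "orbit (\<tau> \<circ> \<rho>) ` (A - C) = orbit \<rho> ` (A - C)"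
    using orbit_comp_right[OF t assms(5)] by (intro image_cong) auto
  moreover have "A = C \<union> (A - C)" using assms by auto
  ultimately have "orbit (\<tau> \<circ> \<rho>) ` A = insert C (orbit \<rho> ` (A - C))"
    by (metis image_Un insert_is_Un)
  moreover have "C \<notin> orbit \<rho> ` (A - C)"
    using permutes_orbit_subset[OF assms(5)] assms(3) by blast
  ultimately show ?thesis using assms(1) by (simp add: perm_weight_def)
qed

lemma lex_lengths_comp:
  assumes "finite A" "C \<subseteq> A" "Min A \<in> C" "\<tau> \<in> cyclic_perms C (Min A)" "\<rho> permutes A - C"
  shows "lex_lengths (Suc b) A (\<tau> \<circ> \<rho>) = card C # lex_lengths b (A - C) \<rho>"
proof -
  have t: "\<tau> permutes C" and o: "orbit \<tau> (Min A) = C" using assms by (simp_all add: cyclic_perms_def)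
  have "orbit (\<tau> \<circ> \<rho>) (Min A) = C" using orbit_comp_left[OF t assms(5) _ assms(3)] o by auto
  moreover have "lex_lengths b (A - C) (\<tau> \<circ> \<rho>) = lex_lengths b (A - C) \<rho>"
    using assms(1) orbit_comp_right[OF t assms(5)] by (intro lex_lengths_cong) auto
  ultimately show ?thesis using assms by auto
qed

text \<open>The recursion for \<open>n * h_n\<close> is what removing the cycle of one point gives.
  It is at the same time the coefficient form of \<open>t * H' = (t * g') * H\<close>, so it links
  permutations to \<open>H = exp g\<close>.\<close>

fun hcoef :: "(nat \<Rightarrow> real) \<Rightarrow> nat \<Rightarrow> real" where
  "hcoef \<theta> n = (if n = 0 then 1 else (\<Sum>l = 1..n. \<theta> l * hcoef \<theta> (n - l)) / real n)"

declare hcoef.simps [simp del]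

lemma sum_perm_weight:
  assumes "finite A"
  shows "(\<Sum>\<sigma> | \<sigma> permutes A. perm_weight \<theta> A \<sigma>) = fact (card A) * hcoef \<theta> (card A)"
  using assms
proof (induction "card A" arbitrary: A rule: less_induct)
  case less
  show ?case
  proof (cases "A = {}")
    case True
    then show ?thesis by (simp add: perm_weight_def hcoef.simps)
  next
    case False
    then obtain a where a: "a \<in> A" by auto
    let ?n = "card A"
    have n: "?n \<ge> 1" using less.prems a by (auto simp: Suc_le_eq card_gt_0_iff)
    have "(\<Sum>\<sigma> | \<sigma> permutes A. perm_weight \<theta> A \<sigma>) =
       (\<Sum>C | C \<subseteq> A \<and> a \<in> C. fact (card C - 1) * fact (?n - card C) * (\<theta> (card C) * hcoef \<theta> (?n - card C)))"
      unfolding sum_permutations_first_cycle[OF less.prems a]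
    proof (intro sum.cong refl)
      fix C assume C: "C \<in> {C. C \<subseteq> A \<and> a \<in> C}"
      then have fC: "finite C" using less.prems finite_subset by blast
      have cd: "card (A - C) = ?n - card C" using C fC by (simp add: card_Diff_subset)
      have "card (A - C) < ?n" using C less.prems a by (intro psubset_card_mono) auto
      have "(\<Sum>\<tau>\<in>cyclic_perms C a. \<Sum>\<rho> | \<rho> permutes A - C. perm_weight \<theta> A (\<tau> \<circ> \<rho>)) =
         (\<Sum>\<tau>\<in>cyclic_perms C a. \<Sum>\<rho> | \<rho> permutes A - C. \<theta> (card C) * perm_weight \<theta> (A - C) \<rho>)"
        using C by (intro sum.cong refl perm_weight_comp[OF less.prems]) auto
      also have "\<dots> = fact (card C - 1) * (\<theta> (card C) * (fact (card (A - C)) * hcoef \<theta> (card (A - C))))"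
        using less.hyps[OF \<open>card (A - C) < ?n\<close>] less.prems card_cyclic_perms[OF fC, of a] C
        by (simp add: sum_distrib_left[symmetric])
      finally show "(\<Sum>\<tau>\<in>cyclic_perms C a. \<Sum>\<rho> | \<rho> permutes A - C. perm_weight \<theta> A (\<tau> \<circ> \<rho>)) =
         fact (card C - 1) * fact (?n - card C) * (\<theta> (card C) * hcoef \<theta> (?n - card C))"
        by (simp add: cd)
    qed
    also have "\<dots> = fact (?n - 1) * (\<Sum>l = 1..?n. \<theta> l * hcoef \<theta> (?n - l))"
      by (rule sum_subsets_containing[OF less.prems a, of "\<lambda>l. \<theta> l * hcoef \<theta> (card A - l)"])
    also have "\<dots> = fact ?n * hcoef \<theta> ?n"
      using n by (subst (2) hcoef.simps) (simp add: fact_reduce[of ?n])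
    finally show ?thesis .
  qed
qed

lemma h_norm_eq_hcoef: "h_norm \<theta> n = hcoef \<theta> n"
proof -
  have "(\<Sum>\<sigma> | \<sigma> permutes {1..n}. cycle_weight \<theta> n \<sigma>) = (\<Sum>\<sigma> | \<sigma> permutes {1..n}. perm_weight \<theta> {1..n} \<sigma>)"
    by (intro sum.cong refl) (simp add: cycle_weight_altdef perm_weight_def)
  then show ?thesis using sum_perm_weight[of "{1..n}" \<theta>] by (simp add: h_norm_def)
qed

lemma hcoef_nonneg:
  assumes "\<And>m. m \<ge> 1 \<Longrightarrow> 0 \<le> \<theta> m"
  shows "0 \<le> hcoef \<theta> n"
proof (induction n rule: less_induct)
  case (less n)
  show ?case
    by (subst hcoef.simps) (auto intro!: divide_nonneg_nonneg sum_nonneg mult_nonneg_nonneg less assms)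
qed

text \<open>The unnormalised dominated measure: \<open>F\<close> is summed with the weights
  \<open>\<theta>_(l_1) ... \<theta>_(l_b) * h_(n - l_1 - ... - l_b)\<close> over positive lengths.
  If nothing remains before \<open>b\<close> lengths are chosen, the sum is empty, so permutations
  with fewer than \<open>b\<close> cycles are left out; this is compatible with a lower bound for
  nonnegative \<open>F\<close>.\<close>

primrec len_sum :: "(nat \<Rightarrow> real) \<Rightarrow> nat \<Rightarrow> nat \<Rightarrow> (nat list \<Rightarrow> real) \<Rightarrow> real" where
  "len_sum \<theta> 0 n F = hcoef \<theta> n * F []"
| "len_sum \<theta> (Suc b) n F = (\<Sum>l = 1..n. \<theta> l * len_sum \<theta> b (n - l) (\<lambda>ls. F (l # ls)))"

lemma len_sum_nonneg:
  assumes "\<And>m. m \<ge> 1 \<Longrightarrow> 0 \<le> \<theta> m" "\<And>ls. 0 \<le> F ls"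
  shows "0 \<le> len_sum \<theta> b n F"
  using assms(2)
proof (induction b arbitrary: n F)
  case 0
  then show ?case using hcoef_nonneg[of \<theta>] assms(1) by simp
next
  case (Suc b)
  then show ?case using assms(1) by (auto intro!: sum_nonneg mult_nonneg_nonneg)
qed

text \<open>Given the first \<open>j\<close> cycles, the element starting the next one lies in a set of at most \<open>n\<close>
  remaining elements; bounding each remaining cardinality by \<open>n\<close> gives the factor \<open>n ^ b\<close>.\<close>

lemma len_sum_le:
  assumes \<theta>: "\<And>m. m \<ge> 1 \<Longrightarrow> 0 \<le> \<theta> m" and "finite A" "\<And>ls. 0 \<le> F ls"
  shows "fact (card A) / real (card A) ^ b * len_sum \<theta> b (card A) F \<le>
    (\<Sum>\<sigma> | \<sigma> permutes A. perm_weight \<theta> A \<sigma> * F (lex_lengths b A \<sigma>))"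
  using assms(2,3)
proof (induction b arbitrary: A F)
  case 0
  then show ?case using sum_perm_weight[of A \<theta>] by (simp add: sum_distrib_right[symmetric])
next
  case (Suc b)
  have pw: "0 \<le> perm_weight \<theta> B \<sigma>" if "\<sigma> permutes B" "finite B" for \<sigma> and B :: "nat set"
    unfolding perm_weight_def
  proof (rule prod_nonneg, clarify)
    fix i assume "i \<in> B"
    have "finite (orbit \<sigma> i)"
      using permutes_orbit_subset[OF that(1) \<open>i \<in> B\<close>] that(2) finite_subset by blast
    then show "0 \<le> \<theta> (card (orbit \<sigma> i))"
      using orbit_nonempty[of \<sigma> i] by (intro \<theta>) (auto simp: Suc_le_eq card_gt_0_iff)
  qed
  show ?case
  proof (cases "A = {}")
    \<comment> \<open>On the left, division by \<open>0 ^ Suc b\<close> yields zero; the right side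
      is nonnegative.\<close>
    case True
    then show ?thesis using Suc.prems pw by (auto intro!: sum_nonneg mult_nonneg_nonneg simp del: permutes_empty)
  next
    case False
    define a where "a = Min A"
    have a: "a \<in> A" using False Suc.prems by (simp add: a_def)
    let ?n = "card A"
    have n: "?n \<ge> 1" using Suc.prems a by (auto simp: Suc_le_eq card_gt_0_iff)
    have "fact ?n / real ?n ^ Suc b * len_sum \<theta> (Suc b) ?n F =
       fact (?n - 1) * (\<Sum>l = 1..?n. \<theta> l * (len_sum \<theta> b (?n - l) (\<lambda>ls. F (l # ls)) / real ?n ^ b))"
      using n by (simp add: fact_reduce[of ?n] sum_divide_distrib[symmetric])
    also have "\<dots> \<le> fact (?n - 1) * (\<Sum>l = 1..?n. \<theta> l * (len_sum \<theta> b (?n - l) (\<lambda>ls. F (l # ls)) / real (?n - l) ^ b))"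
    proof (intro mult_left_mono sum_mono)
      fix l assume l: "l \<in> {1..?n}"
      show "len_sum \<theta> b (?n - l) (\<lambda>ls. F (l # ls)) / real ?n ^ b \<le> len_sum \<theta> b (?n - l) (\<lambda>ls. F (l # ls)) / real (?n - l) ^ b"
      proof (cases "?n - l = 0 \<and> b \<noteq> 0")
        \<comment> \<open>No element remains: for \<open>b > 0\<close> the value of
          \<open>len_sum\<close> is then an empty sum, so the division by zero does no harm.\<close>
        case True
        then show ?thesis by (cases b) simp_all
      next
        case False
        then show ?thesis
          using n l by (cases "b = 0") (auto intro!: divide_left_mono len_sum_nonneg \<theta> Suc.prems power_mono)
      qed
    qed (use \<theta> in auto)
    also have "\<dots> = (\<Sum>C | C \<subseteq> A \<and> a \<in> C. fact (card C - 1) * fact (?n - card C) *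
        (\<theta> (card C) * (len_sum \<theta> b (?n - card C) (\<lambda>ls. F (card C # ls)) / real (?n - card C) ^ b)))"
      by (rule sum_subsets_containing[OF Suc.prems(1) a, symmetric,
           of "\<lambda>l. \<theta> l * (len_sum \<theta> b (card A - l) (\<lambda>ls. F (l # ls)) / real (card A - l) ^ b)"])
    also have "\<dots> \<le> (\<Sum>C | C \<subseteq> A \<and> a \<in> C. \<Sum>\<tau>\<in>cyclic_perms C a. \<Sum>\<rho> | \<rho> permutes A - C.
        perm_weight \<theta> A (\<tau> \<circ> \<rho>) * F (lex_lengths (Suc b) A (\<tau> \<circ> \<rho>)))"
    proof (rule sum_mono)
      fix C assume C: "C \<in> {C. C \<subseteq> A \<and> a \<in> C}"
      then have fC: "finite C" using Suc.prems finite_subset by blast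
      have cd: "card (A - C) = ?n - card C" using C fC by (simp add: card_Diff_subset)
      have "card C \<ge> 1" using C fC by (auto simp: Suc_le_eq card_gt_0_iff)
      have "(\<Sum>\<tau>\<in>cyclic_perms C a. \<Sum>\<rho> | \<rho> permutes A - C. perm_weight \<theta> A (\<tau> \<circ> \<rho>) * F (lex_lengths (Suc b) A (\<tau> \<circ> \<rho>))) =
         (\<Sum>\<tau>\<in>cyclic_perms C a. \<Sum>\<rho> | \<rho> permutes A - C.
            \<theta> (card C) * (perm_weight \<theta> (A - C) \<rho> * F (card C # lex_lengths b (A - C) \<rho>)))"
      proof (intro sum.cong refl)
        fix \<tau> \<rho> assume "\<tau> \<in> cyclic_perms C a" "\<rho> \<in> {\<rho>. \<rho> permutes A - C}"
        then show "perm_weight \<theta> A (\<tau> \<circ> \<rho>) * F (lex_lengths (Suc b) A (\<tau> \<circ> \<rho>)) =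
            \<theta> (card C) * (perm_weight \<theta> (A - C) \<rho> * F (card C # lex_lengths b (A - C) \<rho>))"
          using C Suc.prems perm_weight_comp[of A C a \<tau> \<rho> \<theta>] lex_lengths_comp[of A C \<tau> \<rho> b]
          by (simp add: a_def del: lex_lengths.simps)
      qed
      also have "\<dots> = fact (card C - 1) * (\<theta> (card C) *
          (\<Sum>\<rho> | \<rho> permutes A - C. perm_weight \<theta> (A - C) \<rho> * F (card C # lex_lengths b (A - C) \<rho>)))"
        using card_cyclic_perms[OF fC, of a] C by (simp add: sum_distrib_left[symmetric])
      finally have eq: "(\<Sum>\<tau>\<in>cyclic_perms C a. \<Sum>\<rho> | \<rho> permutes A - C. perm_weight \<theta> A (\<tau> \<circ> \<rho>) * F (lex_lengths (Suc b) A (\<tau> \<circ> \<rho>))) = \<dots>" .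
      have "fact (card C - 1) * (\<theta> (card C) * (fact (card (A - C)) / real (card (A - C)) ^ b * len_sum \<theta> b (card (A - C)) (\<lambda>ls. F (card C # ls))))
         \<le> fact (card C - 1) * (\<theta> (card C) *
          (\<Sum>\<rho> | \<rho> permutes A - C. perm_weight \<theta> (A - C) \<rho> * F (card C # lex_lengths b (A - C) \<rho>)))"
        using Suc.prems \<theta>[OF \<open>card C \<ge> 1\<close>] by (intro mult_left_mono Suc.IH) auto
      then show "fact (card C - 1) * fact (?n - card C) *
        (\<theta> (card C) * (len_sum \<theta> b (?n - card C) (\<lambda>ls. F (card C # ls)) / real (?n - card C) ^ b)) \<le>
        (\<Sum>\<tau>\<in>cyclic_perms C a. \<Sum>\<rho> | \<rho> permutes A - C. perm_weight \<theta> A (\<tau> \<circ> \<rho>) * F (lex_lengths (Suc b) A (\<tau> \<circ> \<rho>)))"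
        unfolding eq cd by (simp add: algebra_simps)
    qed
    also have "\<dots> = (\<Sum>\<sigma> | \<sigma> permutes A. perm_weight \<theta> A \<sigma> * F (lex_lengths (Suc b) A \<sigma>))"
      by (rule sum_permutations_first_cycle[OF Suc.prems(1) a, symmetric])
    finally show ?thesis .
  qed
qed

subsection \<open>Convergence in distribution from Laplace transforms\<close>

text \<open>Polynomial functions in the coordinates indexed by \<open>I\<close>. Generating them
  from monomials by addition lets a limit known for monomials pass to all of them by rule
  induction.\<close>

inductive_set monom_span :: "'i set \<Rightarrow> (('i \<Rightarrow> real) \<Rightarrow> real) set" for I where
  monomial: "(\<lambda>y. c * (\<Prod>i\<in>I. y i ^ s i)) \<in> monom_span I"
| add: "p \<in> monom_span I \<Longrightarrow> q \<in> monom_span I \<Longrightarrow> (\<lambda>y. p y + q y) \<in> monom_span I"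

lemma monom_span_mult:
  assumes "p \<in> monom_span I" "q \<in> monom_span I"
  shows "(\<lambda>y. p y * q y) \<in> monom_span I"
  using assms
proof (induction p rule: monom_span.induct)
  case (monomial c s)
  from monomial show ?case
  proof (induction q rule: monom_span.induct)
    case (monomial d t)
    have "(\<lambda>y. c * (\<Prod>i\<in>I. y i ^ s i) * (d * (\<Prod>i\<in>I. y i ^ t i))) =
          (\<lambda>y. (c * d) * (\<Prod>i\<in>I. y i ^ (s i + t i)))"
      by (simp add: power_add prod.distrib mult_ac)
    then show ?case by (simp only: monom_span.monomial)
  next
    case (add p q)
    then show ?case using monom_span.add by (simp add: distrib_left)
  qed
next
  case (add p r)
  then show ?case using monom_span.add by (simp add: distrib_right)
qed

lemma continuous_on_monom_span: "p \<in> monom_span I \<Longrightarrow> continuous_on S p"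
  by (induction p rule: monom_span.induct)
     (auto intro!: continuous_intros continuous_on_product_coordinates
        intro: continuous_on_subset[OF continuous_on_product_coordinates])

text \<open>Pinning the coordinates outside \<open>I\<close> to zero makes this a compact subset of
  the full function space whose points are separated by the coordinates in \<open>I\<close>.\<close>

definition unit_cube :: "'i set \<Rightarrow> ('i \<Rightarrow> real) set" where
  "unit_cube I = PiE UNIV (\<lambda>i. if i \<in> I then {0..1} else {0})"

lemma compact_unit_cube: "compact (unit_cube I)"
proof -
  have "compactin (product_topology (\<lambda>i. euclidean) UNIV) (PiE UNIV (\<lambda>i. if i \<in> I then {0..1} else {0::real}))"
    by (subst compactin_PiE) auto
  then show ?thesis by (simp add: unit_cube_def euclidean_product_topology)
qed

text \<open>Stone-Weierstrass: distinct points of the cube differ at some index \<open>j\<close> in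
  \<open>I\<close>, and the coordinate \<open>j\<close> is itself a monomial.\<close>

lemma monom_span_dense:
  fixes h :: "('i::countable \<Rightarrow> real) \<Rightarrow> real"
  assumes "finite I" "continuous_on UNIV h" "0 < e"
  obtains p where "p \<in> monom_span I" "\<And>y. y \<in> unit_cube I \<Longrightarrow> \<bar>h y - p y\<bar> < e"
proof -
  interpret function_ring_on "monom_span I" "unit_cube I"
  proof
    show "\<exists>f\<in>monom_span I. f x \<noteq> f y" if "x \<in> unit_cube I" "y \<in> unit_cube I" "x \<noteq> y" for x y
    proof -
      have "\<exists>j. x j \<noteq> y j" using that(3) by (meson ext)
      then obtain j where j: "x j \<noteq> y j" ..
      then have "j \<in> I" using that by (auto simp: unit_cube_def PiE_iff split: if_splits) (metis singletonD)
      let ?s = "\<lambda>i. if i = j then 1 else (0::nat)"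
      have "(\<Prod>i\<in>I. z i ^ ?s i) = z j" for z :: "'i \<Rightarrow> real"
      proof -
        have "(\<Prod>i\<in>I. z i ^ ?s i) = (\<Prod>i\<in>I. if i = j then z i else 1)" by (intro prod.cong) auto
        then show ?thesis using \<open>j \<in> I\<close> assms(1) by simp
      qed
      then have "(\<lambda>y :: 'i \<Rightarrow> real. 1 * (\<Prod>i\<in>I. y i ^ ?s i)) = (\<lambda>y. y j)" by (simp only: mult_1_left)
      then have "(\<lambda>z. z j) \<in> monom_span I"
        using monom_span.monomial[of 1 ?s I] by (simp only:)
      then show ?thesis using j by (intro bexI[of _ "\<lambda>z. z j"])
    qed
    show "(\<lambda>_. c) \<in> monom_span I" for c using monom_span.monomial[of c "\<lambda>_. 0" I] by simp
  qed (simp_all add: compact_unit_cube continuous_on_monom_span monom_span.add monom_span_mult)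
  show ?thesis
    using Stone_Weierstrass_basic[of h e] assms that continuous_on_subset[OF assms(2)] by blast
qed

text \<open>For nonnegative \<open>x\<close>, monomials in these coordinates integrate to Laplace
  transforms at integer points. The truncation \<open>max 0\<close> keeps the image in the cube for
  every \<open>x\<close>, also on the null set where a variable of the limit law may be
  negative.\<close>

definition exp_coords :: "'i set \<Rightarrow> ('i \<Rightarrow> real) \<Rightarrow> 'i \<Rightarrow> real" where
  "exp_coords I x = (\<lambda>i. if i \<in> I then exp (- max 0 (x i)) else 0)"

lemma exp_coords_in_unit_cube: "exp_coords I x \<in> unit_cube I"
  by (auto simp: exp_coords_def unit_cube_def)

lemma measurable_exp_coords:
  fixes X :: "'a \<Rightarrow> 'i::countable \<Rightarrow> real"
  assumes "\<And>i. i \<in> I \<Longrightarrow> (\<lambda>\<omega>. X \<omega> i) \<in> borel_measurable M"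
  shows "(\<lambda>\<omega>. exp_coords I (X \<omega>)) \<in> borel_measurable M"
proof (rule measurable_coordinatewise_then_product)
  fix i show "(\<lambda>\<omega>. exp_coords I (X \<omega>) i) \<in> borel_measurable M"
    using assms[of i] by (cases "i \<in> I") (simp_all add: exp_coords_def)
qed

lemma integrable_exp_coords:
  fixes X :: "'a \<Rightarrow> 'i::countable \<Rightarrow> real"
  assumes "prob_space M" and meas: "\<And>i. i \<in> I \<Longrightarrow> (\<lambda>\<omega>. X \<omega> i) \<in> borel_measurable M"
    and h: "continuous_on UNIV h"
  shows "integrable M (\<lambda>\<omega>. h (exp_coords I (X \<omega>)) :: real)"
proof -
  interpret prob_space M by fact
  have "compact (h ` unit_cube I)"
    using compact_unit_cube h by (intro compact_continuous_image) (auto intro: continuous_on_subset)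
  then obtain B where B: "\<And>y. y \<in> unit_cube I \<Longrightarrow> norm (h y) \<le> B"
    by (meson bounded_iff compact_imp_bounded imageI)
  have "(\<lambda>\<omega>. h (exp_coords I (X \<omega>))) \<in> borel_measurable M"
    using measurable_compose[OF measurable_exp_coords[of I X M, OF meas] borel_measurable_continuous_onI[OF h]] by simp
  then show ?thesis
    by (intro integrable_const_bound[of _ B] AE_I2 B exp_coords_in_unit_cube)
qed

text \<open>Monomials converge by assumption and polynomials by linearity. A uniform approximation
  of \<open>h\<close> on the cube within \<open>e / 3\<close> then moves each integral by at most
  that amount, whatever the law.\<close>

lemma tendsto_integral_exp_coords:
  fixes X :: "nat \<Rightarrow> 'a \<Rightarrow> 'i::countable \<Rightarrow> real" and Y :: "'b \<Rightarrow> 'i \<Rightarrow> real"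
  assumes "finite I" and M: "\<forall>\<^sub>F n in sequentially. prob_space (M n)" and N: "prob_space N"
    and X: "\<And>n i. i \<in> I \<Longrightarrow> (\<lambda>\<omega>. X n \<omega> i) \<in> borel_measurable (M n)"
    and Y: "\<And>i. i \<in> I \<Longrightarrow> (\<lambda>\<omega>. Y \<omega> i) \<in> borel_measurable N"
    and lim: "\<And>s. (\<lambda>n. \<integral>\<omega>. (\<Prod>i\<in>I. exp_coords I (X n \<omega>) i ^ s i) \<partial>M n) \<longlonglongrightarrow>
                  (\<integral>\<omega>. (\<Prod>i\<in>I. exp_coords I (Y \<omega>) i ^ s i) \<partial>N)"
    and h: "continuous_on UNIV h"
  shows "(\<lambda>n. \<integral>\<omega>. h (exp_coords I (X n \<omega>)) \<partial>M n) \<longlonglongrightarrow> (\<integral>\<omega>. h (exp_coords I (Y \<omega>)) \<partial>N :: real)"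
proof (rule tendstoI)
  fix e :: real assume "0 < e"
  have R: "(\<lambda>n. \<integral>\<omega>. p (exp_coords I (X n \<omega>)) \<partial>M n) \<longlonglongrightarrow> (\<integral>\<omega>. p (exp_coords I (Y \<omega>)) \<partial>N)"
    if "p \<in> monom_span I" for p
    using that
  proof (induction p rule: monom_span.induct)
    case (monomial c s)
    show ?case by (simp add: tendsto_mult_left[OF lim])
  next
    case (add p q)
    have "(\<integral>\<omega>. p (exp_coords I (Y \<omega>)) + q (exp_coords I (Y \<omega>)) \<partial>N) =
      (\<integral>\<omega>. p (exp_coords I (Y \<omega>)) \<partial>N) + (\<integral>\<omega>. q (exp_coords I (Y \<omega>)) \<partial>N)"
      using add N Y by (intro Bochner_Integration.integral_add integrable_exp_coords continuous_on_monom_span) auto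
    \<comment> \<open>Additivity needs integrability, which is derived for those \<open>n\<close>
      for which \<open>M n\<close> is a probability space.\<close>
    moreover have "\<forall>\<^sub>F n in sequentially. (\<integral>\<omega>. p (exp_coords I (X n \<omega>)) \<partial>M n) + (\<integral>\<omega>. q (exp_coords I (X n \<omega>)) \<partial>M n) =
      (\<integral>\<omega>. p (exp_coords I (X n \<omega>)) + q (exp_coords I (X n \<omega>)) \<partial>M n)"
      using M
    proof eventually_elim
      case (elim n)
      then show ?case
        using add X by (intro Bochner_Integration.integral_add[symmetric] integrable_exp_coords continuous_on_monom_span) auto
    qed
    ultimately show ?case
      using Lim_transform_eventually[OF tendsto_add[OF add.IH]] by simp
  qed
  obtain p where p: "p \<in> monom_span I" "\<And>y. y \<in> unit_cube I \<Longrightarrow> \<bar>h y - p y\<bar> < e / 3"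
    using monom_span_dense[OF assms(1) h, of "e / 3"] \<open>0 < e\<close> by auto
  have close: "\<bar>(\<integral>\<omega>. h (exp_coords I (Z \<omega>)) \<partial>L) - (\<integral>\<omega>. p (exp_coords I (Z \<omega>)) \<partial>L)\<bar> \<le> e / 3"
    if L: "prob_space L" and Z: "\<And>i. i \<in> I \<Longrightarrow> (\<lambda>\<omega>. Z \<omega> i) \<in> borel_measurable L" for L :: "'c measure" and Z
  proof -
    interpret L: prob_space L by fact
    have ih: "integrable L (\<lambda>\<omega>. h (exp_coords I (Z \<omega>)))" and ip: "integrable L (\<lambda>\<omega>. p (exp_coords I (Z \<omega>)))"
      using integrable_exp_coords[of L I Z, OF L Z] h continuous_on_monom_span[OF p(1)] by auto
    have "\<bar>(\<integral>\<omega>. h (exp_coords I (Z \<omega>)) \<partial>L) - (\<integral>\<omega>. p (exp_coords I (Z \<omega>)) \<partial>L)\<bar>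
        = \<bar>\<integral>\<omega>. h (exp_coords I (Z \<omega>)) - p (exp_coords I (Z \<omega>)) \<partial>L\<bar>"
      using ih ip by simp
    also have "\<dots> \<le> (\<integral>\<omega>. \<bar>h (exp_coords I (Z \<omega>)) - p (exp_coords I (Z \<omega>))\<bar> \<partial>L)"
      by (rule integral_abs_bound)
    also have "\<dots> \<le> (\<integral>\<omega>. e / 3 \<partial>L)"
      using ih ip p(2)[OF exp_coords_in_unit_cube] by (intro integral_mono) (auto intro: less_imp_le)
    finally show ?thesis by (simp add: L.prob_space)
  qed
  have "\<forall>\<^sub>F n in sequentially. dist (\<integral>\<omega>. p (exp_coords I (X n \<omega>)) \<partial>M n) (\<integral>\<omega>. p (exp_coords I (Y \<omega>)) \<partial>N) < e / 3"
    using R[OF p(1)] \<open>0 < e\<close> by (intro tendstoD) auto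
  with M show "\<forall>\<^sub>F n in sequentially. dist (\<integral>\<omega>. h (exp_coords I (X n \<omega>)) \<partial>M n) (\<integral>\<omega>. h (exp_coords I (Y \<omega>)) \<partial>N) < e"
  proof eventually_elim
    case (elim n)
    from close[of "M n" "X n", OF elim(1) X] close[of N Y, OF N Y] elim(2) show ?case
      unfolding dist_real_def by linarith
  qed
qed

text \<open>For \<open>m > 0\<close> a ramp that vanishes for \<open>y \<le> 1 / m\<close> and
  equals one for \<open>y \<ge> 2 / m\<close>.\<close>

definition cutoff :: "nat \<Rightarrow> real \<Rightarrow> real" where
  "cutoff m y = max 0 (min 1 (real m * y - 1))"

lemma cutoff_bounds: "0 \<le> cutoff m y" "cutoff m y \<le> 1"
  by (auto simp: cutoff_def)

lemma prod_cutoff_bounds: "0 \<le> (\<Prod>i\<in>I. cutoff m (y i))" "(\<Prod>i\<in>I. cutoff m (y i)) \<le> 1"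
  using cutoff_bounds by (auto intro!: prod_nonneg prod_le_1)

lemma continuous_on_prod_cutoff: "continuous_on UNIV (\<lambda>y. \<Prod>i\<in>I. cutoff m (y i))"
  unfolding cutoff_def by (intro continuous_intros continuous_on_product_coordinates)

text \<open>As a function of \<open>y = exp (- x)\<close>, a bounded continuous \<open>f\<close>
  need not extend to the faces \<open>y i = 0\<close>, that is, to infinite \<open>x i\<close>. It
  is therefore multiplied by the cutoff \<open>\<kappa>\<close>, at a cost of \<open>B\<close> times
  one minus the integral of \<open>\<kappa>\<close>. Since \<open>\<kappa>\<close> is itself
  continuous on the cube, its integrals converge too, and tightness of the \<open>X n\<close> is
  inherited from the limit.\<close>

lemma converges_in_distribution_laplace:
  fixes X :: "nat \<Rightarrow> 'a \<Rightarrow> 'i::countable \<Rightarrow> real" and Y :: "'b \<Rightarrow> 'i \<Rightarrow> real"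
  assumes I: "finite I" and M: "\<forall>\<^sub>F n in sequentially. prob_space (M n)" and N: "prob_space N"
    and X: "\<And>n i. i \<in> I \<Longrightarrow> (\<lambda>\<omega>. X n \<omega> i) \<in> borel_measurable (M n)"
    and Y: "\<And>i. i \<in> I \<Longrightarrow> (\<lambda>\<omega>. Y \<omega> i) \<in> borel_measurable N"
    and X0: "\<forall>\<^sub>F n in sequentially. \<forall>\<omega>. \<forall>i\<in>I. 0 \<le> X n \<omega> i" and Y0: "AE \<omega> in N. \<forall>i\<in>I. 0 \<le> Y \<omega> i"
    and lim: "\<And>s. (\<lambda>n. \<integral>\<omega>. (\<Prod>i\<in>I. exp (- X n \<omega> i) ^ s i) \<partial>M n) \<longlonglongrightarrow>
                  (\<integral>\<omega>. (\<Prod>i\<in>I. exp (- Y \<omega> i) ^ s i) \<partial>N)"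
  shows "converges_in_distribution (powertop_real I) M (\<lambda>n \<omega>. \<lambda>i\<in>I. X n \<omega> i) N (\<lambda>\<omega>. \<lambda>i\<in>I. Y \<omega> i)"
  unfolding converges_in_distribution_def
proof (intro allI impI, elim conjE)
  fix f :: "('i \<Rightarrow> real) \<Rightarrow> real"
  assume f: "continuous_map (powertop_real I) euclideanreal f" and bdd: "bounded (f ` topspace (powertop_real I))"
  obtain B where B: "\<And>x. x \<in> extensional I \<Longrightarrow> \<bar>f x\<bar> \<le> B"
    using bdd by (auto simp: bounded_iff PiE_UNIV_domain PiE_def)
  have B0: "0 \<le> B" using B[of "\<lambda>i\<in>I. 0"] by force
  have cont_f: "continuous_on UNIV (\<lambda>y. f (\<lambda>i\<in>I. g (y i)))" if "continuous_on UNIV g" for g :: "real \<Rightarrow> real"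
  proof -
    have "continuous_map euclidean (powertop_real I) (\<lambda>y. \<lambda>i\<in>I. g (y i))"
      using continuous_on_compose2[OF that continuous_on_product_coordinates]
      by (auto simp: continuous_map_componentwise)
    from continuous_map_compose[OF this f] show ?thesis by (simp add: o_def)
  qed
  define \<kappa> :: "nat \<Rightarrow> ('i \<Rightarrow> real) \<Rightarrow> real" where "\<kappa> m y = (\<Prod>i\<in>I. cutoff m (y i))" for m y
  \<comment> \<open>Clamping at \<open>1 / m\<close> keeps the logarithm continuous and changes
    nothing where \<open>\<kappa> m\<close> is nonzero.\<close>
  define h where "h m y = \<kappa> m y * f (\<lambda>i\<in>I. - ln (max (y i) (1 / real m)))" for m y
  have cont_\<kappa>: "continuous_on UNIV (\<kappa> m)" for m
    unfolding \<kappa>_def by (rule continuous_on_prod_cutoff)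
  have cont_h: "continuous_on UNIV (h m)" if "m > 0" for m
    unfolding h_def using that
    by (intro continuous_on_mult cont_\<kappa> cont_f continuous_intros) (auto simp: max_def)
  have lim': "(\<lambda>n. \<integral>\<omega>. (\<Prod>i\<in>I. exp_coords I (X n \<omega>) i ^ s i) \<partial>M n) \<longlonglongrightarrow>
                  (\<integral>\<omega>. (\<Prod>i\<in>I. exp_coords I (Y \<omega>) i ^ s i) \<partial>N)" for s
  proof -
    have "\<forall>\<^sub>F n in sequentially. (\<integral>\<omega>. (\<Prod>i\<in>I. exp (- X n \<omega> i) ^ s i) \<partial>M n) =
        (\<integral>\<omega>. (\<Prod>i\<in>I. exp_coords I (X n \<omega>) i ^ s i) \<partial>M n)"
      using X0
    proof eventually_elim
      case (elim n)
      then show ?case by (intro Bochner_Integration.integral_cong prod.cong) (auto simp: exp_coords_def)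
    qed
    from Lim_transform_eventually[OF lim[of s] this]
    have "(\<lambda>n. \<integral>\<omega>. (\<Prod>i\<in>I. exp_coords I (X n \<omega>) i ^ s i) \<partial>M n) \<longlonglongrightarrow>
        (\<integral>\<omega>. (\<Prod>i\<in>I. exp (- Y \<omega> i) ^ s i) \<partial>N)" .
    moreover have "(\<integral>\<omega>. (\<Prod>i\<in>I. exp_coords I (Y \<omega>) i ^ s i) \<partial>N) = (\<integral>\<omega>. (\<Prod>i\<in>I. exp (- Y \<omega> i) ^ s i) \<partial>N)"
    proof (rule integral_cong_AE)
      show "AE \<omega> in N. (\<Prod>i\<in>I. exp_coords I (Y \<omega>) i ^ s i) = (\<Prod>i\<in>I. exp (- Y \<omega> i) ^ s i)"
        using Y0 by eventually_elim (intro prod.cong, auto simp: exp_coords_def)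
    qed (use Y in \<open>simp_all add: exp_coords_def cong: prod.cong\<close>)
    ultimately show ?thesis by simp
  qed
  have approx: "\<bar>(\<integral>\<omega>. f (\<lambda>i\<in>I. Z \<omega> i) \<partial>L) - (\<integral>\<omega>. h m (exp_coords I (Z \<omega>)) \<partial>L)\<bar> \<le>
      B * (1 - (\<integral>\<omega>. \<kappa> m (exp_coords I (Z \<omega>)) \<partial>L))"
    if L: "prob_space L" and Z: "\<And>i. i \<in> I \<Longrightarrow> (\<lambda>\<omega>. Z \<omega> i) \<in> borel_measurable L"
      and Z0: "AE \<omega> in L. \<forall>i\<in>I. 0 \<le> Z \<omega> i" and m: "m > 0" for L :: "'c measure" and Z m
  proof -
    interpret L: prob_space L by fact
    have ih: "integrable L (\<lambda>\<omega>. h m (exp_coords I (Z \<omega>)))" and i\<kappa>: "integrable L (\<lambda>\<omega>. \<kappa> m (exp_coords I (Z \<omega>)))"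
      using integrable_exp_coords[of L I Z, OF L Z] cont_h[OF m] cont_\<kappa> by auto
    have "(\<lambda>\<omega> i. if i \<in> I then Z \<omega> i else 0) \<in> borel_measurable L"
    proof (rule measurable_coordinatewise_then_product)
      fix i show "(\<lambda>\<omega>. if i \<in> I then Z \<omega> i else 0) \<in> borel_measurable L"
        using Z[of i] by (cases "i \<in> I") simp_all
    qed
    from measurable_compose[OF this borel_measurable_continuous_onI[OF cont_f[of "\<lambda>x. x"]]]
    have "(\<lambda>\<omega>. f (\<lambda>i\<in>I. Z \<omega> i)) \<in> borel_measurable L"
      by (simp add: restrict_def cong: if_cong)
    then have iF: "integrable L (\<lambda>\<omega>. f (\<lambda>i\<in>I. Z \<omega> i))"
      by (intro L.integrable_const_bound[of _ B] AE_I2) (auto intro: B)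
    have "\<bar>(\<integral>\<omega>. f (\<lambda>i\<in>I. Z \<omega> i) \<partial>L) - (\<integral>\<omega>. h m (exp_coords I (Z \<omega>)) \<partial>L)\<bar>
        = \<bar>\<integral>\<omega>. f (\<lambda>i\<in>I. Z \<omega> i) - h m (exp_coords I (Z \<omega>)) \<partial>L\<bar>"
      using ih iF by simp
    also have "\<dots> \<le> (\<integral>\<omega>. \<bar>f (\<lambda>i\<in>I. Z \<omega> i) - h m (exp_coords I (Z \<omega>))\<bar> \<partial>L)"
      by (rule integral_abs_bound)
    also have "\<dots> \<le> (\<integral>\<omega>. B * (1 - \<kappa> m (exp_coords I (Z \<omega>))) \<partial>L)"
    proof (rule integral_mono_AE)
      show "AE \<omega> in L. \<bar>f (\<lambda>i\<in>I. Z \<omega> i) - h m (exp_coords I (Z \<omega>))\<bar> \<le> B * (1 - \<kappa> m (exp_coords I (Z \<omega>)))"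
        using Z0
      proof eventually_elim
        case (elim \<omega>)
        let ?y = "exp_coords I (Z \<omega>)"
        have fB: "\<bar>f (\<lambda>i\<in>I. Z \<omega> i)\<bar> \<le> B" by (rule B) simp
        show ?case
        proof (cases "\<kappa> m ?y = 0")
          case True
          then show ?thesis using fB by (simp add: h_def)
        next
          case False
          have "- ln (max (?y i) (1 / real m)) = Z \<omega> i" if i: "i \<in> I" for i
          proof -
            have "cutoff m (?y i) \<noteq> 0" using False i I by (auto simp: \<kappa>_def)
            then have "real m * ?y i > 1" by (auto simp: cutoff_def max_def split: if_splits)
            then have "?y i > 1 / real m" using m by (simp add: field_simps)
            then show ?thesis using elim i by (simp add: exp_coords_def)
          qed
          then have "(\<lambda>i\<in>I. - ln (max (?y i) (1 / real m))) = (\<lambda>i\<in>I. Z \<omega> i)" by (auto simp: restrict_def)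
          then have "f (\<lambda>i\<in>I. Z \<omega> i) - h m ?y = (1 - \<kappa> m ?y) * f (\<lambda>i\<in>I. Z \<omega> i)"
            by (simp add: h_def algebra_simps)
          moreover have "0 \<le> 1 - \<kappa> m ?y" using prod_cutoff_bounds[of m ?y I] by (simp add: \<kappa>_def)
          ultimately show ?thesis
            using mult_right_mono[OF fB, of "1 - \<kappa> m ?y"] by (simp add: abs_mult mult.commute)
        qed
      qed
    qed (use ih iF i\<kappa> in auto)
    also have "\<dots> = B * (1 - (\<integral>\<omega>. \<kappa> m (exp_coords I (Z \<omega>)) \<partial>L))"
      using i\<kappa> by (simp add: L.prob_space)
    finally show ?thesis .
  qed
  \<comment> \<open>The entries of \<open>exp_coords I (Y \<omega>)\<close> with index in
    \<open>I\<close> are positive, so each cutoff is eventually one: the limit law has no mass at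
    infinity.\<close>
  have \<kappa>_lim: "(\<lambda>m. \<integral>\<omega>. \<kappa> m (exp_coords I (Y \<omega>)) \<partial>N) \<longlonglongrightarrow> 1"
  proof -
    interpret N: prob_space N by fact
    have "(\<lambda>m. \<integral>\<omega>. \<kappa> m (exp_coords I (Y \<omega>)) \<partial>N) \<longlonglongrightarrow> (\<integral>\<omega>. 1 \<partial>N)"
    proof (rule integral_dominated_convergence[where w = "\<lambda>_. 1"])
      show "AE \<omega> in N. (\<lambda>m. \<kappa> m (exp_coords I (Y \<omega>))) \<longlonglongrightarrow> 1"
      proof (rule AE_I2)
        fix \<omega>
        let ?y = "exp_coords I (Y \<omega>)"
        have "(\<lambda>m. \<kappa> m ?y) \<longlonglongrightarrow> (\<Prod>i\<in>I. 1)"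
          unfolding \<kappa>_def
        proof (rule tendsto_prod)
          fix i assume "i \<in> I"
          then have y: "0 < ?y i" by (simp add: exp_coords_def)
          have "\<forall>\<^sub>F m in sequentially. real m * ?y i \<ge> 2"
            using filterlim_tendsto_pos_mult_at_top[OF tendsto_const y filterlim_real_sequentially]
            by (simp add: filterlim_at_top mult.commute)
          then have "\<forall>\<^sub>F m in sequentially. cutoff m (?y i) = 1"
            by eventually_elim (simp add: cutoff_def)
          then show "(\<lambda>m. cutoff m (?y i)) \<longlonglongrightarrow> 1" by (rule tendsto_eventually)
        qed
        then show "(\<lambda>m. \<kappa> m ?y) \<longlonglongrightarrow> 1" by simp
      qed
      show "AE \<omega> in N. norm (\<kappa> m (exp_coords I (Y \<omega>))) \<le> 1" for m
        by (intro AE_I2) (simp add: \<kappa>_def abs_of_nonneg prod_cutoff_bounds)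
      show "(\<lambda>\<omega>. \<kappa> m (exp_coords I (Y \<omega>))) \<in> borel_measurable N" for m
        using integrable_exp_coords[of N I Y, OF N Y cont_\<kappa>] by auto
    qed auto
    then show ?thesis by (simp add: N.prob_space)
  qed
  show "(\<lambda>n. \<integral>\<omega>. f (\<lambda>i\<in>I. X n \<omega> i) \<partial>M n) \<longlonglongrightarrow> (\<integral>\<omega>. f (\<lambda>i\<in>I. Y \<omega> i) \<partial>N)"
  proof (rule tendstoI)
    fix e :: real assume e: "0 < e"
    \<comment> \<open>The level \<open>m\<close> is fixed by the limit law alone; the same bound
      then passes to \<open>X n\<close> for large \<open>n\<close>.\<close>
    have "(\<lambda>m. B * (1 - (\<integral>\<omega>. \<kappa> m (exp_coords I (Y \<omega>)) \<partial>N))) \<longlonglongrightarrow> B * (1 - 1)"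
      by (intro tendsto_intros \<kappa>_lim)
    then have "\<forall>\<^sub>F m in sequentially. B * (1 - (\<integral>\<omega>. \<kappa> m (exp_coords I (Y \<omega>)) \<partial>N)) < e / 4"
      using e by (intro order_tendstoD(2)[where y = "B * (1 - 1)"]) auto
    then have "\<forall>\<^sub>F m in sequentially. m > 0 \<and> B * (1 - (\<integral>\<omega>. \<kappa> m (exp_coords I (Y \<omega>)) \<partial>N)) < e / 4"
      using eventually_gt_at_top[of 0] by eventually_elim auto
    then obtain m where m: "m > 0" "B * (1 - (\<integral>\<omega>. \<kappa> m (exp_coords I (Y \<omega>)) \<partial>N)) < e / 4"
      by (auto simp: eventually_sequentially)
    note conv = tendsto_integral_exp_coords[where M = M and X = X and N = N and Y = Y, OF I M N X Y lim']
    have "(\<lambda>n. B * (1 - (\<integral>\<omega>. \<kappa> m (exp_coords I (X n \<omega>)) \<partial>M n))) \<longlonglongrightarrow> B * (1 - (\<integral>\<omega>. \<kappa> m (exp_coords I (Y \<omega>)) \<partial>N))"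
      by (intro tendsto_intros conv cont_\<kappa>)
    then have 1: "\<forall>\<^sub>F n in sequentially. B * (1 - (\<integral>\<omega>. \<kappa> m (exp_coords I (X n \<omega>)) \<partial>M n)) < e / 4"
      by (rule order_tendstoD(2)) (rule m)
    have 2: "\<forall>\<^sub>F n in sequentially. dist (\<integral>\<omega>. h m (exp_coords I (X n \<omega>)) \<partial>M n) (\<integral>\<omega>. h m (exp_coords I (Y \<omega>)) \<partial>N) < e / 4"
      using e by (intro tendstoD conv cont_h m) auto
    show "\<forall>\<^sub>F n in sequentially. dist (\<integral>\<omega>. f (\<lambda>i\<in>I. X n \<omega> i) \<partial>M n) (\<integral>\<omega>. f (\<lambda>i\<in>I. Y \<omega> i) \<partial>N) < e"
      using M 1 2 X0
    proof eventually_elim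
      case (elim n)
      have "\<bar>(\<integral>\<omega>. f (\<lambda>i\<in>I. X n \<omega> i) \<partial>M n) - (\<integral>\<omega>. h m (exp_coords I (X n \<omega>)) \<partial>M n)\<bar> \<le>
          B * (1 - (\<integral>\<omega>. \<kappa> m (exp_coords I (X n \<omega>)) \<partial>M n))"
        using elim(4) by (intro approx elim(1) X m(1)) auto
      moreover have "\<bar>(\<integral>\<omega>. f (\<lambda>i\<in>I. Y \<omega> i) \<partial>N) - (\<integral>\<omega>. h m (exp_coords I (Y \<omega>)) \<partial>N)\<bar> \<le>
          B * (1 - (\<integral>\<omega>. \<kappa> m (exp_coords I (Y \<omega>)) \<partial>N))"
        by (intro approx N Y m(1) Y0)
      ultimately show ?case using m(2) elim unfolding dist_real_def by linarith
    qed
  qed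
qed

subsection \<open>Power series with nonnegative coefficients\<close>

text \<open>Coefficients and function are kept as a pair: the asymptotics concern the function on a
  circle, the wanted quantities are the coefficients, and their sign gives domination by the value
  at the positive real point.\<close>

definition pos_series :: "(nat \<Rightarrow> real) \<Rightarrow> (complex \<Rightarrow> complex) \<Rightarrow> bool" where
  "pos_series c f \<longleftrightarrow> (\<forall>n. 0 \<le> c n) \<and> (\<forall>t. norm t < 1 \<longrightarrow> (\<lambda>n. of_real (c n) * t ^ n) sums f t)"

lemma pos_series_sums_real:
  assumes "pos_series c f" "0 \<le> x" "x < 1"
  shows "(\<lambda>n. c n * x ^ n) sums Re (f (of_real x))" "f (of_real x) = of_real (Re (f (of_real x)))"
proof -
  have s: "(\<lambda>n. of_real (c n * x ^ n)) sums f (of_real x)"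
    using assms unfolding pos_series_def by auto
  from sums_Re[OF s] show 1: "(\<lambda>n. c n * x ^ n) sums Re (f (of_real x))" by simp
  have "(\<lambda>n. of_real (c n * x ^ n) :: complex) sums of_real (Re (f (of_real x)))"
    using 1 by (rule sums_of_real)
  then show "f (of_real x) = of_real (Re (f (of_real x)))" using s sums_unique2 by blast
qed

lemma pos_series_summable_norm:
  fixes t :: complex
  assumes "pos_series c f" "norm t < 1"
  shows "summable (\<lambda>n. norm (of_real (c n) * t ^ n))"
proof -
  have "norm (complex_of_real (c n) * t ^ n) = c n * norm t ^ n" for n
    using assms(1) by (simp add: pos_series_def norm_mult norm_power)
  then show ?thesis
    using pos_series_sums_real(1)[OF assms(1) norm_ge_zero assms(2)] by (simp add: sums_iff)
qed

text \<open>The triangle inequality term by term. It later bounds the factors \<open>t * g'\<close>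
  on a whole circle by their value on the positive axis.\<close>

lemma norm_pos_series_le:
  assumes "pos_series c f" "norm t < 1"
  shows "norm (f t) \<le> Re (f (of_real (norm t)))"
proof -
  have "norm (complex_of_real (c n) * t ^ n) = c n * norm t ^ n" for n
    using assms(1) by (simp add: pos_series_def norm_mult norm_power)
  moreover have "f t = (\<Sum>n. of_real (c n) * t ^ n)"
    using assms by (auto simp: pos_series_def sums_iff)
  ultimately show ?thesis
    using summable_norm[OF pos_series_summable_norm[OF assms]]
      pos_series_sums_real(1)[OF assms(1) norm_ge_zero assms(2)] by (simp add: sums_iff)
qed

lemma pos_series_mult:
  assumes "pos_series a f" "pos_series b g"
  shows "pos_series (\<lambda>n. \<Sum>i\<le>n. a i * b (n - i)) (\<lambda>t. f t * g t)"
  unfolding pos_series_def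
proof (intro conjI allI impI)
  show "0 \<le> (\<Sum>i\<le>n. a i * b (n - i))" for n
    using assms by (auto simp: pos_series_def intro!: sum_nonneg)
  fix t :: complex assume t: "norm t < 1"
  have "(\<lambda>n. \<Sum>i\<le>n. (of_real (a i) * t ^ i) * (of_real (b (n - i)) * t ^ (n - i))) sums
      ((\<Sum>n. of_real (a n) * t ^ n) * (\<Sum>n. of_real (b n) * t ^ n))"
    by (rule Cauchy_product_sums; rule pos_series_summable_norm[OF _ t]) (rule assms)+
  also have "(\<lambda>n. \<Sum>i\<le>n. (of_real (a i) * t ^ i) * (of_real (b (n - i)) * t ^ (n - i))) =
      (\<lambda>n. of_real (\<Sum>i\<le>n. a i * b (n - i)) * t ^ n)"
  proof
    fix n
    have "(of_real (a i) * t ^ i) * (of_real (b (n - i)) * t ^ (n - i)) = of_real (a i * b (n - i)) * t ^ n"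
      if "i \<le> n" for i
    proof -
      have "t ^ n = t ^ i * t ^ (n - i)" using that by (simp add: power_add[symmetric])
      then show ?thesis by simp
    qed
    then have "(\<Sum>i\<le>n. (of_real (a i) * t ^ i) * (of_real (b (n - i)) * t ^ (n - i))) =
      (\<Sum>i\<le>n. of_real (a i * b (n - i)) * t ^ n)"
      by (intro sum.cong refl) auto
    then show "(\<Sum>i\<le>n. (of_real (a i) * t ^ i) * (of_real (b (n - i)) * t ^ (n - i))) =
      of_real (\<Sum>i\<le>n. a i * b (n - i)) * t ^ n"
      by (simp add: sum_distrib_right)
  qed
  finally show "(\<lambda>n. of_real (\<Sum>i\<le>n. a i * b (n - i)) * t ^ n) sums (f t * g t)"
    using assms t by (simp add: pos_series_def sums_iff)
qed

lemma pos_series_scale: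
  assumes "pos_series c f" "0 \<le> q" "q \<le> 1"
  shows "pos_series (\<lambda>n. c n * q ^ n) (\<lambda>t. f (of_real q * t))"
  unfolding pos_series_def
proof (intro conjI allI impI)
  show "0 \<le> c n * q ^ n" for n using assms by (simp add: pos_series_def)
  fix t :: complex assume "norm t < 1"
  then have "norm (of_real q * t) < 1"
    using assms mult_le_one[of q "norm t"] mult_right_mono[of q 1 "norm t"] by (simp add: norm_mult)
  then have "(\<lambda>n. of_real (c n) * (of_real q * t) ^ n) sums f (of_real q * t)"
    using assms(1) by (simp only: pos_series_def)
  then show "(\<lambda>n. of_real (c n * q ^ n) * t ^ n) sums f (of_real q * t)"
    by (simp add: power_mult_distrib mult.assoc)
qed

section \<open>Coefficients as Fourier integrals over a circle\<close>

lemma integral_cis_int: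
  fixes k :: int
  shows "has_bochner_integral lborel (\<lambda>y. indicator {-pi..pi} y *\<^sub>R cis (of_int k * y)) (if k = 0 then 2 * pi else 0)"
proof (cases "k = 0")
  case True
  have "has_bochner_integral lborel (\<lambda>y. indicator {-pi..pi} y *\<^sub>R (1 :: complex)) (of_real pi - of_real (-pi))"
    by (rule has_bochner_integral_FTC_Icc) (auto intro!: derivative_eq_intros simp: has_vector_derivative_def scaleR_conv_of_real)
  then show ?thesis using True by simp
next
  case False
  let ?F = "\<lambda>y. cis (of_int k * y) / (\<i> * of_int k)"
  have "has_bochner_integral lborel (\<lambda>y. indicator {-pi..pi} y *\<^sub>R cis (of_int k * y)) (?F pi - ?F (-pi))"
  proof (rule has_bochner_integral_FTC_Icc[where F = ?F])
    fix y :: real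
    have "((\<lambda>z. exp (\<i> * (of_int k * z))) has_field_derivative exp (\<i> * (of_int k * of_real y)) * (\<i> * of_int k)) (at (of_real y))"
      by (auto intro!: derivative_eq_intros)
    from DERIV_cdivide[OF this, of "\<i> * of_int k"]
    have "((\<lambda>z. exp (\<i> * (of_int k * z)) / (\<i> * of_int k)) has_field_derivative exp (\<i> * (of_int k * of_real y))) (at (of_real y))"
      using False by (subst (asm) nonzero_mult_div_cancel_right) auto
    from field_vector_diff_chain_at[OF has_vector_derivative_of_real[OF DERIV_ident] this]
    have "((\<lambda>z. exp (\<i> * (of_int k * of_real z)) / (\<i> * of_int k)) has_vector_derivative exp (\<i> * (of_int k * of_real y))) (at y)"
      by (simp add: o_def)
    then show "(?F has_vector_derivative cis (of_int k * y)) (at y within {-pi..pi})"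
      by - (rule has_vector_derivative_at_within, simp only: cis_conv_exp of_real_mult of_real_of_int_eq)
  qed (auto intro!: continuous_intros)
  moreover have "cis (of_int k * pi) = cis (of_int k * (-pi))"
  proof -
    have "cis (of_int k * pi) = cis (of_int k * (-pi) + 2 * pi * of_int k)" by (simp add: algebra_simps)
    also have "\<dots> = cis (of_int k * (-pi))"
      by (subst cis_mult[symmetric]) simp
    finally show ?thesis .
  qed
  ultimately show ?thesis using False by simp
qed

text \<open>Cauchy's formula by termwise integration: the term of index \<open>m\<close> has
  frequency \<open>m - n\<close>, and sum and integral commute because the coefficients are summable
  at \<open>\<rho>\<close>. The interval enters as an indicator on the whole line, which prepares
  the change of scale and the dominated convergence below.\<close>

lemma pos_series_coefficient:
  assumes f: "pos_series c f" and \<rho>: "0 \<le> \<rho>" "\<rho> < 1"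
  shows "(\<integral>y. indicator {-pi..pi} y *\<^sub>R (f (of_real \<rho> * cis y) * cis (- real n * y)) \<partial>lborel) = 2 * pi * c n * \<rho> ^ n"
proof -
  define F :: "nat \<Rightarrow> real \<Rightarrow> complex" where
    "F m y = of_real (c m * \<rho> ^ m) * (indicator {-pi..pi} y *\<^sub>R cis (of_int (int m - int n) * y))" for m y
  have int: "has_bochner_integral lborel (F m) (of_real (c m * \<rho> ^ m) * of_real (if m = n then 2 * pi else 0))" for m
  proof -
    have "int m - int n = 0 \<longleftrightarrow> m = n" by simp
    then show ?thesis
      using has_bochner_integral_mult_right[OF integral_cis_int[of "int m - int n"], of "of_real (c m * \<rho> ^ m)"]
      unfolding F_def by (simp only:) 
  qed
  have nF: "norm (F m y) = c m * \<rho> ^ m * indicator {-pi..pi} y" for m y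
    using f \<rho> by (simp add: F_def norm_mult norm_power pos_series_def abs_mult split: split_indicator)
  have sm: "summable (\<lambda>m. c m * \<rho> ^ m)"
    using pos_series_sums_real(1)[OF f \<rho>] by (simp add: sums_iff)
  have "(\<lambda>m. integral\<^sup>L lborel (F m)) sums (\<integral>y. (\<Sum>m. F m y) \<partial>lborel)"
  proof (rule sums_integral)
    show "integrable lborel (F m)" for m using int has_bochner_integral_iff by blast
    show "AE y in lborel. summable (\<lambda>m. norm (F m y))"
      unfolding nF using sm by (intro AE_I2 summable_mult2)
    have "(\<integral>y. norm (F m y) \<partial>lborel) = c m * \<rho> ^ m * (2 * pi)" for m
      unfolding nF by simp
    then show "summable (\<lambda>m. \<integral>y. norm (F m y) \<partial>lborel)"
      using summable_mult2[OF sm] by simp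
  qed
  moreover have "integral\<^sup>L lborel (F m) = (if m = n then complex_of_real (2 * pi * c n * \<rho> ^ n) else 0)" for m
    using has_bochner_integral_integral_eq[OF int[of m]] by simp
  moreover have "(\<Sum>m. F m y) = indicator {-pi..pi} y *\<^sub>R (f (of_real \<rho> * cis y) * cis (- real n * y))" for y
  proof -
    have "norm (of_real \<rho> * cis y) < 1" using \<rho> by (simp add: norm_mult)
    then have "(\<lambda>m. of_real (c m) * (of_real \<rho> * cis y) ^ m) sums f (of_real \<rho> * cis y)"
      using f by (simp add: pos_series_def)
    from sums_mult[OF this, of "indicator {-pi..pi} y *\<^sub>R cis (- real n * y)"]
    have "(\<lambda>m. indicator {-pi..pi} y *\<^sub>R cis (- real n * y) * (of_real (c m) * (of_real \<rho> * cis y) ^ m)) sums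
       (indicator {-pi..pi} y *\<^sub>R cis (- real n * y) * f (of_real \<rho> * cis y))" .
    moreover have "indicator {-pi..pi} y *\<^sub>R cis (- real n * y) * (of_real (c m) * (of_real \<rho> * cis y) ^ m) = F m y" for m
    proof -
      have "cis (of_int (int m - int n) * y) = cis (- real n * y) * cis y ^ m"
        by (simp add: Complex.DeMoivre cis_mult algebra_simps)
      then show ?thesis by (simp add: F_def power_mult_distrib scaleR_conv_of_real)
    qed
    ultimately show ?thesis by (simp add: sums_iff mult.commute)
  qed
  ultimately have "(\<lambda>m. if m = n then complex_of_real (2 * pi * c n * \<rho> ^ n) else 0) sums
     (\<integral>y. indicator {-pi..pi} y *\<^sub>R (f (of_real \<rho> * cis y) * cis (- real n * y)) \<partial>lborel)"
    by (simp only:)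
  moreover have "(\<lambda>m. if m = n then complex_of_real (2 * pi * c n * \<rho> ^ n) else 0) sums
     complex_of_real (2 * pi * c n * \<rho> ^ n)"
    by (rule sums_single)
  ultimately show ?thesis
    by (rule sums_unique2)
qed

section \<open>Generating functions of the weights, of \<open>h_n\<close> and of the dominated
  measure\<close>

lemma pos_series_g_Theta:
  assumes \<theta>: "\<And>m. m \<ge> 1 \<Longrightarrow> 0 \<le> \<theta> m"
    and sm: "\<And>t. norm t < 1 \<Longrightarrow> summable (\<lambda>m. of_real (\<theta> m / real m) * t ^ m :: complex)"
  shows "pos_series (\<lambda>m. \<theta> m / real m) (g_Theta \<theta>)"
  unfolding pos_series_def
proof (intro conjI allI impI)
  show "0 \<le> \<theta> n / real n" for n using \<theta>[of n] by (cases "n = 0") auto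
qed (use sm in \<open>simp add: g_Theta_def summable_sums\<close>)

text \<open>The factor \<open>t\<close> aligns the coefficients with the weights. Since
  \<open>\<theta> 0\<close> is arbitrary, the constant coefficient has to be set to zero by
  hand.\<close>

lemma pos_series_deriv_g_Theta:
  assumes \<theta>: "\<And>m. m \<ge> 1 \<Longrightarrow> 0 \<le> \<theta> m"
    and sm: "\<And>t. norm t < 1 \<Longrightarrow> summable (\<lambda>m. of_real (\<theta> m / real m) * t ^ m :: complex)"
    and hol: "g_Theta \<theta> holomorphic_on ball 0 1"
  shows "pos_series (\<lambda>m. if m = 0 then 0 else \<theta> m) (\<lambda>t. t * deriv (g_Theta \<theta>) t)"
  unfolding pos_series_def
proof (intro conjI allI impI)
  show "0 \<le> (if n = 0 then 0 else \<theta> n)" for n using \<theta>[of n] by auto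
  fix t :: complex assume t: "norm t < 1"
  have "(g_Theta \<theta> has_field_derivative deriv (g_Theta \<theta>) t) (at t)"
    using hol t by (intro holomorphic_derivI[of _ "ball 0 1"]) auto
  then have "(\<lambda>n. diffs (\<lambda>m. of_real (\<theta> m / real m)) n * t ^ n) sums deriv (g_Theta \<theta>) t"
    using pos_series_g_Theta[OF \<theta> sm] t
    by (intro termdiffs_sums_strong[where K = 1 and f = "g_Theta \<theta>"]) (auto simp: pos_series_def)
  moreover have "diffs (\<lambda>m. complex_of_real (\<theta> m / real m)) n = of_real (\<theta> (Suc n))" for n
    by (simp add: diffs_def del: of_nat_Suc)
  ultimately have "(\<lambda>n. of_real (\<theta> (Suc n)) * t ^ n) sums deriv (g_Theta \<theta>) t" by simp
  from sums_mult[OF this, of t]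
  have "(\<lambda>n. (\<lambda>m. of_real (if m = 0 then 0 else \<theta> m) * t ^ m) (Suc n)) sums (t * deriv (g_Theta \<theta>) t)"
    by (simp add: mult_ac)
  then show "(\<lambda>m. of_real (if m = 0 then 0 else \<theta> m) * t ^ m) sums (t * deriv (g_Theta \<theta>) t)"
    by (subst (asm) sums_Suc_iff) simp
qed

text \<open>\<open>H = exp g\<close> satisfies \<open>t * H' = (t * g') * H\<close> and
  \<open>H 0 = 1\<close>. For formal power series this is the recursion of \<open>hcoef\<close>,
  which determines all coefficients; convergence in the whole disc comes from holomorphy.\<close>

lemma pos_series_hcoef:
  assumes \<theta>: "\<And>m. m \<ge> 1 \<Longrightarrow> 0 \<le> \<theta> m"
    and sm: "\<And>t. norm t < 1 \<Longrightarrow> summable (\<lambda>m. of_real (\<theta> m / real m) * t ^ m :: complex)"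
    and hol: "g_Theta \<theta> holomorphic_on ball 0 1"
  shows "pos_series (hcoef \<theta>) (\<lambda>t. exp (g_Theta \<theta> t))"
proof -
  let ?g = "g_Theta \<theta>" and ?q = "\<lambda>m. if m = 0 then 0 else \<theta> m"
  define f where "f = (\<lambda>t. exp (?g t))"
  define F where "F = fps_expansion f 0"
  have holf: "f holomorphic_on ball 0 1"
    unfolding f_def by (intro holomorphic_intros hol)
  have exF: "f has_fps_expansion F"
    unfolding F_def by (rule has_fps_expansion_fps_expansion[OF _ _ holf]) auto
  have sumsF: "(\<lambda>n. fps_nth F n * t ^ n) sums f t" if "norm t < 1" for t
    using holf that by (intro has_fps_expansion_imp_sums_complex[OF exF, of 1]) (auto simp: one_ereal_def)
  have near0: "eventually (\<lambda>t. t \<in> ball 0 1) (nhds (0::complex))"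
    by (intro eventually_nhds_in_open) auto
  have exQ: "(\<lambda>t. t * deriv ?g t) has_fps_expansion Abs_fps (\<lambda>m. of_real (?q m))"
    using near0 pos_series_deriv_g_Theta[OF \<theta> sm hol]
    by (intro has_fps_expansionI) (auto elim!: eventually_mono simp: pos_series_def)
  have "(\<lambda>t. t * deriv f t) has_fps_expansion fps_X * fps_deriv F"
    by (intro has_fps_expansion_mult has_fps_expansion_fps_X has_fps_expansion_deriv exF)
  moreover have "eventually (\<lambda>t. t * deriv f t = (t * deriv ?g t) * f t) (nhds 0)"
    using near0
  proof eventually_elim
    case (elim t)
    have "(?g has_field_derivative deriv ?g t) (at t)"
      using hol elim by (intro holomorphic_derivI[of _ "ball 0 1"]) auto
    then have "(f has_field_derivative exp (?g t) * deriv ?g t) (at t)"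
      unfolding f_def by (auto intro!: derivative_eq_intros)
    then show ?case by (simp add: DERIV_imp_deriv f_def)
  qed
  ultimately have "(\<lambda>t. (t * deriv ?g t) * f t) has_fps_expansion fps_X * fps_deriv F"
    by (subst (asm) has_fps_expansion_cong[OF _ refl]) auto
  moreover have "(\<lambda>t. (t * deriv ?g t) * f t) has_fps_expansion Abs_fps (\<lambda>m. of_real (?q m)) * F"
    by (intro has_fps_expansion_mult exQ exF)
  \<comment> \<open>Uniqueness of the expansion turns the differential equation into an identity of
    coefficients.\<close>
  ultimately have eq: "fps_X * fps_deriv F = Abs_fps (\<lambda>m. of_real (?q m)) * F"
    by (rule fps_expansion_unique_complex)
  have rec: "of_nat n * fps_nth F n = (\<Sum>l = 1..n. of_real (\<theta> l) * fps_nth F (n - l))" for n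
  proof -
    have "of_nat n * fps_nth F n = fps_nth (fps_X * fps_deriv F) n"
      by (cases n) simp_all
    also have "\<dots> = (\<Sum>l = 0..n. of_real (?q l) * fps_nth F (n - l))"
      unfolding eq by (simp add: fps_mult_nth)
    also have "\<dots> = (\<Sum>l = 1..n. of_real (\<theta> l) * fps_nth F (n - l))"
      by (rule sum.mono_neutral_cong_right) auto
    finally show ?thesis .
  qed
  have F_eq: "fps_nth F n = of_real (hcoef \<theta> n)" for n
  proof (induction n rule: less_induct)
    case (less n)
    show ?case
    proof (cases "n = 0")
      case True
      have "fps_nth F 0 = f 0" using exF by (simp add: has_fps_expansion_imp_0_eq_fps_nth_0)
      moreover have "?g 0 = 0" unfolding g_Theta_def by (subst powser_zero) simp
      ultimately show ?thesis using True by (simp add: f_def hcoef.simps)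
    next
      case False
      have "of_nat n * fps_nth F n = (\<Sum>l = 1..n. of_real (\<theta> l * hcoef \<theta> (n - l)))"
        unfolding rec by (intro sum.cong refl) (use less in auto)
      also have "\<dots> = of_nat n * of_real (hcoef \<theta> n)"
        using False by (subst (2) hcoef.simps) simp
      finally show ?thesis using False by simp
    qed
  qed
  show ?thesis
    unfolding pos_series_def using hcoef_nonneg[of \<theta>] \<theta> sumsF by (auto simp: F_eq f_def)
qed

definition laplace_kernel :: "real list \<Rightarrow> nat list \<Rightarrow> real" where
  "laplace_kernel ss ls = (\<Prod>(s, l) \<leftarrow> zip ss ls. exp (- s * real l))"

lemma laplace_kernel_Nil [simp]: "laplace_kernel [] ls = 1"
  by (simp add: laplace_kernel_def)

lemma laplace_kernel_Cons [simp]: "laplace_kernel (s # ss) (l # ls) = exp (- s * real l) * laplace_kernel ss ls"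
  by (simp add: laplace_kernel_def)

text \<open>\<open>len_sum\<close> is an iterated convolution, hence belongs to a product of series,
  and the weight \<open>exp (- s * l)\<close> amounts to replacing \<open>t\<close> by
  \<open>exp (- s) * t\<close> in the corresponding factor.\<close>

lemma pos_series_len_sum:
  assumes \<theta>: "\<And>m. m \<ge> 1 \<Longrightarrow> 0 \<le> \<theta> m"
    and sm: "\<And>t. norm t < 1 \<Longrightarrow> summable (\<lambda>m. of_real (\<theta> m / real m) * t ^ m :: complex)"
    and hol: "g_Theta \<theta> holomorphic_on ball 0 1"
    and ss: "\<forall>s\<in>set ss. 0 \<le> s"
  shows "pos_series (\<lambda>n. len_sum \<theta> (length ss) n (laplace_kernel ss))
    (\<lambda>t. (\<Prod>s\<leftarrow>ss. exp (- of_real s) * t * deriv (g_Theta \<theta>) (exp (- of_real s) * t)) * exp (g_Theta \<theta> t))"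
  using ss
proof (induction ss)
  case Nil
  then show ?case using pos_series_hcoef[OF \<theta> sm hol] by simp
next
  case (Cons s ss)
  let ?q = "\<lambda>m. if m = 0 then 0 else \<theta> m"
  have mult: "len_sum \<theta> b n (\<lambda>ls. a * G ls) = a * len_sum \<theta> b n G" for b n a G
    by (induction b arbitrary: n G) (simp_all add: sum_distrib_left mult_ac)
  have "pos_series (\<lambda>m. ?q m * exp (- s) ^ m) (\<lambda>t. (of_real (exp (- s)) * t) * deriv (g_Theta \<theta>) (of_real (exp (- s)) * t))"
    using Cons.prems pos_series_scale[OF pos_series_deriv_g_Theta[OF \<theta> sm hol], of "exp (- s)"] by simp
  from pos_series_mult[OF this Cons.IH] Cons.prems
  have "pos_series (\<lambda>n. \<Sum>i\<le>n. ?q i * exp (- s) ^ i * len_sum \<theta> (length ss) (n - i) (laplace_kernel ss))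
     (\<lambda>t. (\<Prod>s\<leftarrow>s # ss. exp (- of_real s) * t * deriv (g_Theta \<theta>) (exp (- of_real s) * t)) * exp (g_Theta \<theta> t))"
    by (simp add: exp_of_real[symmetric] mult_ac)
  moreover have "(\<Sum>i\<le>n. ?q i * exp (- s) ^ i * len_sum \<theta> (length ss) (n - i) (laplace_kernel ss)) =
      len_sum \<theta> (length (s # ss)) n (laplace_kernel (s # ss))" for n
  proof -
    have "(\<Sum>i\<le>n. ?q i * exp (- s) ^ i * len_sum \<theta> (length ss) (n - i) (laplace_kernel ss)) =
      (\<Sum>l = 1..n. \<theta> l * (exp (- s) ^ l * len_sum \<theta> (length ss) (n - l) (laplace_kernel ss)))"
      by (rule sum.mono_neutral_cong_right) auto
    also have "\<dots> = (\<Sum>l = 1..n. \<theta> l * len_sum \<theta> (length ss) (n - l) (\<lambda>ls. laplace_kernel (s # ss) (l # ls)))"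
      by (simp add: mult exp_of_nat2_mult[symmetric])
    finally show ?thesis by simp
  qed
  ultimately show ?case by simp
qed

subsection \<open>Estimates for polynomials and logarithms\<close>

lemma poly_norm_le_power:
  fixes q :: "complex poly"
  assumes "degree q \<le> d"
  obtains C where "0 \<le> C" "\<And>z. 1 \<le> norm z \<Longrightarrow> norm (poly q z) \<le> C * norm z ^ d"
proof
  show "0 \<le> (\<Sum>i\<le>degree q. norm (coeff q i))" by (simp add: sum_nonneg)
  fix z :: complex assume z: "1 \<le> norm z"
  have "norm (poly q z) \<le> (\<Sum>i\<le>degree q. norm (coeff q i * z ^ i))"
    unfolding poly_altdef by (rule norm_sum)
  also have "\<dots> \<le> (\<Sum>i\<le>degree q. norm (coeff q i) * norm z ^ d)"
    using z assms by (intro sum_mono) (auto simp: norm_mult norm_power intro!: mult_left_mono power_increasing)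
  finally show "norm (poly q z) \<le> (\<Sum>i\<le>degree q. norm (coeff q i)) * norm z ^ d"
    by (simp add: sum_distrib_right)
qed

lemma poly_map_of_real: "poly (map_poly of_real p) (of_real x :: complex) = of_real (poly p x)"
  by (induction p) (simp_all add: map_poly_pCons)

lemma pderiv_map_of_real: "pderiv (map_poly of_real p :: complex poly) = map_poly of_real (pderiv p)"
  by (rule poly_eqI) (simp add: coeff_pderiv coeff_map_poly)

text \<open>Convexity keeps the segment from \<open>a\<close> to \<open>a + z\<close> in the
  half-plane of real part at least one, where the second derivative is at most a multiple of the
  \<open>d\<close>-th power of the modulus.\<close>

lemma poly_taylor_quadratic:
  fixes p :: "complex poly"
  assumes "degree p \<le> d + 2"
  obtains C where "0 \<le> C"
    "\<And>a z. 1 \<le> a \<Longrightarrow> 1 \<le> a + Re z \<Longrightarrow>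
       norm (poly p (of_real a + z) - poly p (of_real a) - z * poly (pderiv p) (of_real a)) \<le>
         C * (a + norm z) ^ d * norm z ^ 2"
proof -
  have "degree (pderiv (pderiv p)) \<le> d" using assms by (simp add: degree_pderiv)
  then obtain C where C: "0 \<le> C" "\<And>z. 1 \<le> norm z \<Longrightarrow> norm (poly (pderiv (pderiv p)) z) \<le> C * norm z ^ d"
    by (rule poly_norm_le_power) blast
  show ?thesis
  proof (rule that[OF C(1)])
    fix a :: real and z :: complex
    assume a: "1 \<le> a" and az: "1 \<le> a + Re z"
    define S where "S = closed_segment (complex_of_real a) (of_real a + z)"
    have S: "1 \<le> norm x \<and> norm x \<le> a + norm z" if xS: "x \<in> S" for x
    proof -
      obtain u where u01: "0 \<le> u" "u \<le> 1" and x: "x = (1 - u) *\<^sub>R of_real a + u *\<^sub>R (of_real a + z)"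
        using xS by (auto simp: S_def in_segment)
      have u: "0 \<le> u" "u \<le> 1" "x = of_real a + of_real u * z"
        using u01 by (simp_all add: x scaleR_conv_of_real algebra_simps)
      have "1 \<le> (1 - u) * a + u * (a + Re z)"
        using a az u convex_bound_le[of "-a" "-1" "-(a + Re z)" "1 - u" u] by (simp add: algebra_simps)
      also have "\<dots> = Re x" using u by (simp add: algebra_simps)
      also have "\<dots> \<le> norm x" by (rule complex_Re_le_cmod)
      finally have 1: "1 \<le> norm x" .
      have "norm x \<le> norm (complex_of_real a) + norm (of_real u * z)" unfolding u by (rule norm_triangle_ineq)
      also have "\<dots> \<le> a + norm z" using a u by (simp add: norm_mult mult_left_le_one_le)
      finally show ?thesis using 1 by simp
    qed
    have "norm (poly ((pderiv ^^ 0) p) (of_real a + z) -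
        (\<Sum>i\<le>1. poly ((pderiv ^^ i) p) (of_real a) * (of_real a + z - of_real a) ^ i / fact i)) \<le>
        (C * (a + norm z) ^ d) * norm (of_real a + z - of_real a) ^ Suc 1 / fact 1"
    proof (rule complex_Taylor[where S = S])
      show "convex S" "complex_of_real a \<in> S" "of_real a + z \<in> S" by (auto simp: S_def)
      show "(poly ((pderiv ^^ i) p) has_field_derivative poly ((pderiv ^^ Suc i) p) x) (at x within S)" for i x
        using poly_DERIV[of "(pderiv ^^ i) p" x] by (simp add: has_field_derivative_at_within)
      show "norm (poly ((pderiv ^^ Suc 1) p) x) \<le> C * (a + norm z) ^ d" if "x \<in> S" for x
      proof -
        have "norm (poly (pderiv (pderiv p)) x) \<le> C * norm x ^ d" using S[OF that] C(2) by blast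
        also have "\<dots> \<le> C * (a + norm z) ^ d" using S[OF that] C(1) by (intro mult_left_mono power_mono) auto
        finally show ?thesis by simp
      qed
    qed
    then show "norm (poly p (of_real a + z) - poly p (of_real a) - z * poly (pderiv p) (of_real a)) \<le>
         C * (a + norm z) ^ d * norm z ^ 2"
      by (simp add: power2_eq_square algebra_simps)
  qed
qed

text \<open>On the saddle line the imaginary part of \<open>- Ln\<close> is \<open>arctan u\<close>,
  while the real part drops by \<open>ln (1 + u\<^sup>2) / 2\<close>; this inequality lets the drop
  absorb the quadratic error caused by the imaginary part. Differentiation reduces it to
  \<open>arctan x \<le> x\<close>.\<close>

lemma arctan_power2_le: "(arctan u)\<^sup>2 \<le> ln (1 + u\<^sup>2)"
proof -
  have *: "(arctan u)\<^sup>2 \<le> ln (1 + u\<^sup>2)" if "0 \<le> u" for u :: real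
  proof -
    have "ln (1 + 0\<^sup>2) - (arctan 0)\<^sup>2 \<le> ln (1 + u\<^sup>2) - (arctan u)\<^sup>2"
    proof (rule DERIV_nonneg_imp_nondecreasing[OF that])
      fix x :: real assume x: "0 \<le> x" "x \<le> u"
      have p: "1 + x\<^sup>2 > 0" by (simp add: add_pos_nonneg)
      have "((\<lambda>x. ln (1 + x\<^sup>2) - (arctan x)\<^sup>2) has_real_derivative (2 * x / (1 + x\<^sup>2) - 2 * arctan x * inverse (1 + x\<^sup>2))) (at x)"
        using p by (auto intro!: derivative_eq_intros simp: divide_simps)
      moreover have "0 \<le> 2 * x / (1 + x\<^sup>2) - 2 * arctan x * inverse (1 + x\<^sup>2)"
        using p arctan_le_self[OF x(1)] by (simp add: divide_simps)
      ultimately show "\<exists>y. ((\<lambda>x. ln (1 + x\<^sup>2) - (arctan x)\<^sup>2) has_real_derivative y) (at x) \<and> 0 \<le> y" by blast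
    qed
    then show ?thesis by simp
  qed
  show ?thesis using *[of "\<bar>u\<bar>"] by (cases "0 \<le> u") (simp_all add: arctan_minus)
qed

text \<open>Taylor's theorem: on the disc of radius \<open>1 / 2\<close> the third derivative is at
  most \<open>2 * 2 ^ 3 = 16\<close>, and division by \<open>fact 2\<close> leaves 8.\<close>

lemma norm_Ln_quadratic_le:
  assumes "norm z \<le> 1 / 2"
  shows "norm (Ln (1 + z) - (z - z\<^sup>2 / 2)) \<le> 8 * norm z ^ 3"
proof -
  \<comment> \<open>\<open>f i\<close> is the \<open>i\<close>-th derivative of
    \<open>Ln (1 + x)\<close> for \<open>i \<le> 3\<close>.\<close>
  define f :: "nat \<Rightarrow> complex \<Rightarrow> complex" where
    "f i = [\<lambda>x. Ln (1 + x), \<lambda>x. inverse (1 + x), \<lambda>x. - (inverse (1 + x) ^ 2), \<lambda>x. 2 * inverse (1 + x) ^ 3] ! i" for i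
  have S: "1 / 2 \<le> norm (1 + x)" "1 / 2 \<le> Re (1 + x)" if "x \<in> cball 0 (1 / 2)" for x :: complex
  proof -
    have "\<bar>Re x\<bar> \<le> 1 / 2" using that abs_Re_le_cmod[of x] by simp
    then show "1 / 2 \<le> Re (1 + x)" by simp
    then show "1 / 2 \<le> norm (1 + x)" using complex_Re_le_cmod[of "1 + x"] by linarith
  qed
  have "norm (f 0 z - (\<Sum>i\<le>2. f i 0 * (z - 0) ^ i / fact i)) \<le> 16 * norm (z - 0) ^ Suc 2 / fact 2"
  proof (rule complex_Taylor[where S = "cball 0 (1 / 2)"])
    fix i :: nat and x :: complex assume x: "x \<in> cball 0 (1 / 2)" and i: "i \<le> 2"
    have n0: "1 + x \<noteq> 0" using S[OF x] by (metis norm_zero not_one_le_zero half_gt_zero_iff linorder_not_less zero_less_one)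
    have nr: "1 + x \<notin> \<real>\<^sub>\<le>\<^sub>0" using S(2)[OF x] by (auto simp: complex_nonpos_Reals_iff)
    consider "i = 0" | "i = 1" | "i = 2" using i by linarith
    then show "(f i has_field_derivative f (Suc i) x) (at x within cball 0 (1 / 2))"
    proof cases
      case 1
      then show ?thesis using nr unfolding f_def
        by (auto intro!: derivative_eq_intros simp: field_simps)
    next
      case 2
      then show ?thesis using n0 unfolding f_def
        by (auto intro!: derivative_eq_intros simp: power2_eq_square)
    next
      case 3
      then show ?thesis using n0 unfolding f_def
        by (auto intro!: derivative_eq_intros simp: power2_eq_square power3_eq_cube eval_nat_numeral)
    qed
  next
    fix x :: complex assume x: "x \<in> cball 0 (1 / 2)"
    have "inverse (norm (1 + x)) \<le> 2" using le_imp_inverse_le[OF S(1)[OF x]] by simp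
    then have "inverse (norm (1 + x)) ^ 3 \<le> 2 ^ 3" by (intro power_mono) auto
    then show "norm (f (Suc 2) x) \<le> 16"
      by (simp add: f_def norm_mult norm_inverse norm_power power_inverse eval_nat_numeral)
  qed (use assms in auto)
  moreover have "(\<Sum>i\<le>2. f i 0 * (z - 0) ^ i / fact i) = z - z\<^sup>2 / 2"
    by (simp add: f_def eval_nat_numeral)
  moreover have "f 0 z = Ln (1 + z)" by (simp add: f_def)
  ultimately show ?thesis by (simp add: eval_nat_numeral)
qed

text \<open>Bernoulli's inequality for real exponents. With \<open>x = u\<^sup>2\<close> it converts
  the decay on the saddle line into a majorant that is integrable and, after rescaling, independent
  of \<open>n\<close>.\<close>

lemma exp_minus_ln_le:
  fixes a x :: real
  assumes "1 \<le> a" "0 \<le> x"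
  shows "exp (- (a * ln (1 + x))) \<le> 1 / (1 + a * x)"
proof -
  have "a * ln (1 + 0) - ln (1 + a * 0) \<le> a * ln (1 + x) - ln (1 + a * x)"
  proof (rule DERIV_nonneg_imp_nondecreasing[OF assms(2)])
    fix y :: real assume y: "0 \<le> y" "y \<le> x"
    have p: "1 + y > 0" "1 + a * y > 0" using y assms by (auto simp: add_pos_nonneg)
    have "((\<lambda>x. a * ln (1 + x) - ln (1 + a * x)) has_real_derivative (a / (1 + y) - a / (1 + a * y))) (at y)"
      using p by (auto intro!: derivative_eq_intros)
    moreover have "1 + y \<le> 1 + a * y" using y assms mult_right_mono[of 1 a y] by simp
    then have "0 \<le> a / (1 + y) - a / (1 + a * y)"
      using p assms by (simp add: divide_left_mono)
    ultimately show "\<exists>D. ((\<lambda>x. a * ln (1 + x) - ln (1 + a * x)) has_real_derivative D) (at y) \<and> 0 \<le> D" by blast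
  qed
  then have "ln (1 + a * x) \<le> a * ln (1 + x)" by simp
  then have "exp (ln (1 + a * x)) \<le> exp (a * ln (1 + x))" by simp
  moreover have "0 < 1 + a * x" using assms by (auto simp: add_pos_nonneg)
  ultimately show ?thesis by (simp add: exp_minus divide_simps)
qed

subsection \<open>The saddle point\<close>

locale log_weights =
  fixes \<theta> :: "nat \<Rightarrow> real" and k :: nat and c :: "nat \<Rightarrow> real"
  assumes standing: "standing_assumptions \<theta> k c"
    and derivs: "derivative_assumption \<theta> k"
begin

abbreviation g :: "complex \<Rightarrow> complex" where "g \<equiv> g_Theta \<theta>"
abbreviation P :: "real \<Rightarrow> real" where "P \<equiv> poly (P_poly k c)"
abbreviation P' :: "real \<Rightarrow> real" where "P' \<equiv> poly (pderiv (P_poly k c))"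
abbreviation Pc :: "complex \<Rightarrow> complex" where "Pc \<equiv> poly (map_poly of_real (P_poly k c))"

lemma theta_nonneg: "m \<ge> 1 \<Longrightarrow> 0 \<le> \<theta> m"
  and g_summable: "norm t < 1 \<Longrightarrow> summable (\<lambda>m. of_real (\<theta> m / real m) * t ^ m :: complex)"
  and holomorphic_g: "g holomorphic_on ball 0 1"
  and k_ge_1: "1 \<le> k"
  using standing by (auto simp: standing_assumptions_def)

section \<open>The polynomial \<open>P\<close> and the size of \<open>g\<close> near 1 and away from
  it\<close>

lemma degree_P_poly: "degree (P_poly k c) = Suc k"
  and coeff_P_poly: "coeff (P_poly k c) (Suc k) = 1 / real (Suc k)"
proof -
  have d: "degree (\<Sum>j = 0..k. monom (c j) j) \<le> k"
    by (intro degree_sum_le) (auto intro: order_trans[OF degree_monom_le])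
  then show c: "coeff (P_poly k c) (Suc k) = 1 / real (Suc k)"
    by (simp add: P_poly_def coeff_eq_0 del: of_nat_Suc)
  have "degree (P_poly k c) \<le> Suc k"
    unfolding P_poly_def using d by (intro degree_add_le) (auto intro: order_trans[OF degree_monom_le])
  moreover have "Suc k \<le> degree (P_poly k c)"
    using c by (intro le_degree) (simp del: of_nat_Suc)
  ultimately show "degree (P_poly k c) = Suc k" by simp
qed

lemma P'_asymp: "((\<lambda>x. P' x / x ^ k) \<longlongrightarrow> 1) at_top"
proof -
  have "degree (pderiv (P_poly k c)) = k" by (simp add: degree_pderiv degree_P_poly)
  moreover have "coeff (pderiv (P_poly k c)) k = 1" by (simp add: coeff_pderiv coeff_P_poly del: of_nat_Suc)
  ultimately show ?thesis
    using poly_divide_tendsto_aux[of "pderiv (P_poly k c)"] tendsto_mono[OF at_top_le_at_infinity] by metis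
qed

text \<open>Where \<open>P' x\<close> exceeds \<open>x ^ k / 2\<close>, the difference of
  \<open>P\<close> and half its leading term is nondecreasing, and
  \<open>r ^ (k + 1) - q ^ (k + 1)\<close> is at least \<open>(r - q) * r ^ k\<close>. The bound
  keeps the full power of \<open>r\<close> even when \<open>q\<close> is far below
  \<open>r\<close>.\<close>

lemma P_growth:
  obtains R where "1 \<le> R"
    "\<And>q r. R \<le> q \<Longrightarrow> q \<le> r \<Longrightarrow> (r - q) * r ^ k / (2 * real (Suc k)) \<le> P r - P q"
proof -
  have "\<forall>\<^sub>F x in at_top. 1 / 2 < P' x / x ^ k"
    using P'_asymp by (rule order_tendstoD) simp
  then obtain R where R: "\<And>x. R \<le> x \<Longrightarrow> 1 / 2 < P' x / x ^ k"
    by (auto simp: eventually_at_top_linorder)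
  show ?thesis
  proof (rule that[of "max 1 R"])
    fix q r :: real assume q: "max 1 R \<le> q" "q \<le> r"
    have "P q - q ^ Suc k / (2 * real (Suc k)) \<le> P r - r ^ Suc k / (2 * real (Suc k))"
    proof (rule DERIV_nonneg_imp_nondecreasing[OF q(2)])
      fix x :: real assume "q \<le> x" "x \<le> r"
      then have x: "1 \<le> x" "R \<le> x" using q by auto
      have "((\<lambda>x. P x - x ^ Suc k / (2 * real (Suc k))) has_real_derivative (P' x - real (Suc k) * x ^ k / (2 * real (Suc k)))) (at x)"
        using DERIV_pow[of "Suc k" x] by (intro DERIV_diff poly_DERIV DERIV_cdivide) simp
      moreover have "0 \<le> P' x - real (Suc k) * x ^ k / (2 * real (Suc k))"
      proof -
        have eq: "real (Suc k) * x ^ k / (2 * real (Suc k)) = x ^ k / 2" by (simp del: of_nat_Suc)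
        show ?thesis unfolding eq using R[OF x(2)] x(1) by (simp add: field_simps)
      qed
      ultimately show "\<exists>y. ((\<lambda>x. P x - x ^ Suc k / (2 * real (Suc k))) has_real_derivative y) (at x) \<and> 0 \<le> y" by blast
    qed
    moreover have "(r - q) * r ^ k \<le> r ^ Suc k - q ^ Suc k"
      using q power_mono[of q r k] mult_left_mono[of "q ^ k" "r ^ k" q] by (simp add: algebra_simps)
    then have "(r - q) * r ^ k / (2 * real (Suc k)) \<le> (r ^ Suc k - q ^ Suc k) / (2 * real (Suc k))"
      by (intro divide_right_mono) auto
    ultimately show "(r - q) * r ^ k / (2 * real (Suc k)) \<le> P r - P q"
      unfolding diff_divide_distrib by linarith
  qed simp
qed

lemma P_taylor:
  obtains C where "0 \<le> C"
    "\<And>a z. 1 \<le> a \<Longrightarrow> 1 \<le> a + Re z \<Longrightarrow>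
       norm (Pc (of_real a + z) - of_real (P a) - z * of_real (P' a)) \<le> C * (a + norm z) ^ (k - 1) * norm z ^ 2"
proof -
  have "degree (map_poly complex_of_real (P_poly k c)) \<le> (k - 1) + 2"
    using k_ge_1 degree_P_poly by (simp add: degree_map_poly)
  then show ?thesis
    by (rule poly_taylor_quadratic) (use that in \<open>simp add: poly_map_of_real pderiv_map_of_real\<close>)
qed

lemma exp_uminus_in_disc: "exp (- w) \<in> (cball 0 1 - {1}) \<inter> ball 0 1" if "0 < Re w" for w :: complex
proof -
  have "norm (exp (- w)) < 1" using that by simp
  then show ?thesis by (auto simp del: norm_exp_eq_Re)
qed

text \<open>For \<open>Re w > 0\<close> the point \<open>exp (- w)\<close> lies in the open disc,
  where the extension in the assumption agrees with \<open>g\<close>.\<close>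

lemma g_near:
  obtains C \<rho> where "0 < C" "0 < \<rho>"
    "\<And>w. 0 < Re w \<Longrightarrow> norm w < \<rho> \<Longrightarrow> norm (g (exp (- w)) - Pc (- Ln w)) \<le> C * norm w"
proof -
  obtain G where G: "disc_extension G g (cball 0 1 - {1})"
    and O: "(\<lambda>w. G (exp (- w)) - Pc (- Ln w)) \<in> O[at_zero_right_half](\<lambda>w. w)"
    using standing by (auto simp: standing_assumptions_def)
  from O obtain C where C: "0 < C"
    "\<forall>\<^sub>F w in at_zero_right_half. norm (G (exp (- w)) - Pc (- Ln w)) \<le> C * norm w"
    by (elim landau_o.bigE) auto
  from C(2) obtain \<rho> where \<rho>: "0 < \<rho>"
    "\<And>w. 0 \<le> Re w \<Longrightarrow> w \<noteq> 0 \<Longrightarrow> dist w 0 < \<rho> \<Longrightarrow> norm (G (exp (- w)) - Pc (- Ln w)) \<le> C * norm w"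
    unfolding eventually_at by auto
  show ?thesis
  proof (rule that[OF C(1) \<rho>(1)])
    fix w :: complex assume w: "0 < Re w" "norm w < \<rho>"
    have "G (exp (- w)) = g (exp (- w))"
      using G exp_uminus_in_disc[OF w(1)] unfolding disc_extension_def by blast
    then show "norm (g (exp (- w)) - Pc (- Ln w)) \<le> C * norm w"
      using \<rho>(2)[of w] w by (cases "w = 0") auto
  qed
qed

text \<open>For \<open>\<bar>Im w\<bar> \<le> pi\<close> the equation \<open>exp (- w) = 1\<close>
  forces \<open>w = 0\<close>. So the rectangle without a ball about zero maps into the punctured
  closed disc, and compactness bounds the continuous extension, uniformly as \<open>Re w\<close>
  tends to zero.\<close>

lemma g_far:
  assumes "0 < \<rho>"
  obtains B where "\<And>w. 0 < Re w \<Longrightarrow> Re w \<le> 1 \<Longrightarrow> \<bar>Im w\<bar> \<le> pi \<Longrightarrow> \<rho> \<le> norm w \<Longrightarrow> norm (g (exp (- w))) \<le> B"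
proof -
  obtain G where G: "disc_extension G g (cball 0 1 - {1})"
    using standing by (auto simp: standing_assumptions_def)
  define K where "K = cbox (Complex 0 (-pi)) (Complex 1 pi) - ball 0 \<rho>"
  have K: "compact K" unfolding K_def by (intro compact_diff compact_cbox open_ball)
  have mem: "exp (- w) \<in> cball 0 1 - {1}" if "w \<in> K" for w
  proof -
    from that have w: "0 \<le> Re w" "\<bar>Im w\<bar> \<le> pi" "\<rho> \<le> norm w"
      by (auto simp: K_def in_cbox_complex_iff)
    have "exp (- w) \<noteq> 1"
    proof
      assume "exp (- w) = 1"
      then obtain n :: int where n: "Re w = 0" "- Im w = real_of_int (2 * n) * pi"
        by (auto simp: exp_eq_1)
      have "\<bar>real_of_int (2 * n)\<bar> * pi = \<bar>- Im w\<bar>" unfolding n(2) by (simp add: abs_mult)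
      then have "\<bar>real_of_int (2 * n)\<bar> * pi \<le> 1 * pi" using w(2) by simp
      then have "\<bar>real_of_int (2 * n)\<bar> \<le> 1" by simp
      then have "n = 0" by linarith
      with n have "w = 0" by (simp add: complex_eq_iff)
      with w(3) assms show False by simp
    qed
    then show ?thesis using w(1) by simp
  qed
  have "continuous_on K (\<lambda>w. G (exp (- w)))"
  proof (rule continuous_on_compose2[where g = G and f = "\<lambda>w. exp (- w)"])
    show "continuous_on (cball 0 1 - {1}) G" using G by (simp add: disc_extension_def)
    show "continuous_on K (\<lambda>w. exp (- w))" by (intro continuous_intros)
    show "(\<lambda>w. exp (- w)) ` K \<subseteq> cball 0 1 - {1}" by (rule image_subsetI) (rule mem)
  qed
  from compact_imp_bounded[OF compact_continuous_image[OF this K]]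
  obtain B where B: "\<And>w. w \<in> K \<Longrightarrow> norm (G (exp (- w))) \<le> B"
    by (meson bounded_iff imageI)
  show ?thesis
  proof (rule that[of B])
    fix w assume w: "0 < Re w" "Re w \<le> 1" "\<bar>Im w\<bar> \<le> pi" "\<rho> \<le> norm w"
    have "G (exp (- w)) = g (exp (- w))"
      using G exp_uminus_in_disc[OF w(1)] unfolding disc_extension_def by blast
    moreover have "w \<in> K" using w by (auto simp: K_def in_cbox_complex_iff)
    ultimately show "norm (g (exp (- w))) \<le> B" using B by metis
  qed
qed

text \<open>The saddle point \<open>w = exp (- r)\<close> of \<open>P (- log w) + n * w\<close> is shifted along the vertical line
  through it, in relative units.\<close>

definition vline :: "real \<Rightarrow> real \<Rightarrow> complex" where
  "vline r u = of_real (exp (- r)) * (1 - \<i> * of_real u)"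

lemma Re_vline [simp]: "Re (vline r u) = exp (- r)"
  and Im_vline [simp]: "Im (vline r u) = - exp (- r) * u"
  by (simp_all add: vline_def)

lemma vline_nonzero: "vline r u \<noteq> 0"
  by (metis Re_vline exp_not_eq_zero zero_complex.simps(1))

lemma norm_vline: "norm (vline r u) = exp (- r) * sqrt (1 + u\<^sup>2)"
  unfolding vline_def norm_mult by (simp add: cmod_def)

lemma Ln_vline: "- Ln (vline r u) = of_real (r - ln (1 + u\<^sup>2) / 2) + \<i> * of_real (arctan u)"
proof (rule complex_eqI)
  have "1 + u\<^sup>2 > 0" by (simp add: add_pos_nonneg)
  then show "Re (- Ln (vline r u)) = Re (of_real (r - ln (1 + u\<^sup>2) / 2) + \<i> * of_real (arctan u))"
    using vline_nonzero by (simp add: norm_vline ln_mult ln_sqrt)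
  show "Im (- Ln (vline r u)) = Im (of_real (r - ln (1 + u\<^sup>2) / 2) + \<i> * of_real (arctan u))"
    using vline_nonzero by (simp add: Im_Ln_eq arctan_minus)
qed

text \<open>Near zero the displacement \<open>u\<close> lowers the real part of
  \<open>- Ln w\<close> by \<open>ln (1 + u\<^sup>2) / 2\<close>, which by \<open>P_growth\<close>
  lowers \<open>P\<close> by at least \<open>2 * d * r ^ k * ln (1 + u\<^sup>2)\<close>. The linear
  effect of the imaginary part \<open>arctan u\<close> is purely imaginary, and its quadratic effect
  costs at most half of this gain. Away from zero \<open>g\<close> is bounded, whereas
  \<open>P r\<close> alone outweighs the required decay because \<open>ln (1 + u\<^sup>2)\<close> is
  at most \<open>2 * r + 5\<close>.\<close>

lemma g_vline_decay:
  obtains C d R where "0 < d"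
    "\<And>r u. R \<le> r \<Longrightarrow> \<bar>u\<bar> * exp (- r) \<le> pi \<Longrightarrow>
       Re (g (exp (- vline r u))) - Re (g (exp (- vline r 0))) \<le> C - d * r ^ k * ln (1 + u\<^sup>2)"
proof -
  obtain R0 where R0: "1 \<le> R0"
    and growth: "\<And>q r. R0 \<le> q \<Longrightarrow> q \<le> r \<Longrightarrow> (r - q) * r ^ k / (2 * real (Suc k)) \<le> P r - P q"
    using P_growth by blast
  obtain C1 where C1: "0 \<le> C1" and taylor: "\<And>a z. 1 \<le> a \<Longrightarrow> 1 \<le> a + Re z \<Longrightarrow>
       norm (Pc (of_real a + z) - of_real (P a) - z * of_real (P' a)) \<le> C1 * (a + norm z) ^ (k - 1) * norm z ^ 2"
    using P_taylor by blast
  obtain C2 \<rho> where C2: "0 < C2" "0 < \<rho>"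
    and near: "\<And>w. 0 < Re w \<Longrightarrow> norm w < \<rho> \<Longrightarrow> norm (g (exp (- w)) - Pc (- Ln w)) \<le> C2 * norm w"
    using g_near by blast
  \<comment> \<open>Within \<open>\<rho>'\<close> the local expansion holds and the real part of
    \<open>- Ln w\<close> is at least \<open>R0\<close>, so that \<open>P_growth\<close>
    applies.\<close>
  define \<rho>' where "\<rho>' = min (\<rho> / 2) (exp (- R0))"
  have \<rho>': "0 < \<rho>'" "\<rho>' < \<rho>" "\<rho>' \<le> exp (- R0)" using C2 by (auto simp: \<rho>'_def)
  obtain B where far: "\<And>w. 0 < Re w \<Longrightarrow> Re w \<le> 1 \<Longrightarrow> \<bar>Im w\<bar> \<le> pi \<Longrightarrow> \<rho>' \<le> norm w \<Longrightarrow> norm (g (exp (- w))) \<le> B"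
    using g_far[OF \<rho>'(1)] by blast
  \<comment> \<open>Half of the gain \<open>1 / (4 * (k + 1))\<close> from \<open>P_growth\<close>;
    the other half pays for the Taylor remainder.\<close>
  define d where "d = 1 / (8 * real (Suc k))"
  \<comment> \<open>In order, the entries serve: the bound
    \<open>q + \<bar>arctan u\<bar> \<le> 3 * r\<close>; the comparison
    \<open>2 * r + 5 \<le> 4 * (r - R0)\<close>; the bound \<open>exp (- r) \<le> \<rho>'\<close>;
    the absorption of the Taylor remainder, which is only of order
    \<open>r ^ (k - 1)\<close>.\<close>
  define R where "R = Max {2, 2 * R0 + 3, - ln \<rho>', 8 * real (Suc k) * C1 * 3 ^ (k - 1)}"
  define C where "C = \<bar>2 * C2 * \<rho>'\<bar> + \<bar>B + C2 * \<rho>' - P R0\<bar>"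
  show ?thesis
  proof (rule that[of d R C])
    show "0 < d" by (simp add: d_def)
    fix r u :: real assume r: "R \<le> r" and u: "\<bar>u\<bar> * exp (- r) \<le> pi"
    have r1: "2 \<le> r" "2 * R0 + 3 \<le> r" "- ln \<rho>' \<le> r" "8 * real (Suc k) * C1 * 3 ^ (k - 1) \<le> r"
      using r by (auto simp: R_def)
    have w0: "exp (- r) \<le> \<rho>'" using r1(3) \<rho>'(1) by (metis exp_ln exp_le_cancel_iff minus_le_iff)
    let ?L = "ln (1 + u\<^sup>2)"
    have L0: "0 \<le> ?L" by simp
    have n0: "norm (vline r 0) = exp (- r)" by (simp add: norm_vline)
    have "norm (g (exp (- vline r 0)) - Pc (- Ln (vline r 0))) \<le> C2 * norm (vline r 0)"
      using w0 \<rho>' by (intro near) (auto simp: n0)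
    also have "Pc (- Ln (vline r 0)) = of_real (P r)" by (simp add: Ln_vline poly_map_of_real)
    also have "C2 * norm (vline r 0) \<le> C2 * \<rho>'" using w0 C2 by (simp add: n0)
    finally have "\<bar>Re (g (exp (- vline r 0)) - of_real (P r))\<bar> \<le> C2 * \<rho>'"
      by (rule order_trans[OF abs_Re_le_cmod])
    then have base: "P r - C2 * \<rho>' \<le> Re (g (exp (- vline r 0)))" by simp
    show "Re (g (exp (- vline r u))) - Re (g (exp (- vline r 0))) \<le> C - d * r ^ k * ?L"
    proof (cases "norm (vline r u) \<le> \<rho>'")
      case True
      define q where "q = r - ?L / 2"
      have q: "- ln (norm (vline r u)) = q" using Ln_vline[of r u] vline_nonzero[of r u]
        by (simp add: q_def complex_eq_iff)
      have "ln (norm (vline r u)) \<le> ln (exp (- R0))"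
        using True \<rho>'(3) vline_nonzero[of r u] by (subst ln_le_cancel_iff) auto
      then have qR: "R0 \<le> q" "q \<le> r" using q L0 by (auto simp: q_def)
      have "norm (g (exp (- vline r u)) - Pc (- Ln (vline r u))) \<le> C2 * norm (vline r u)"
        using True \<rho>' by (intro near) auto
      also have "\<dots> \<le> C2 * \<rho>'" using True C2 by simp
      finally have "\<bar>Re (g (exp (- vline r u)) - Pc (- Ln (vline r u)))\<bar> \<le> C2 * \<rho>'"
        by (rule order_trans[OF abs_Re_le_cmod])
      then have 1: "Re (g (exp (- vline r u))) \<le> Re (Pc (- Ln (vline r u))) + C2 * \<rho>'" by simp
      have "norm (Pc (of_real q + \<i> * of_real (arctan u)) - of_real (P q) - (\<i> * of_real (arctan u)) * of_real (P' q)) \<le>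
          C1 * (q + norm (\<i> * of_real (arctan u))) ^ (k - 1) * norm (\<i> * of_real (arctan u)) ^ 2"
        using qR R0 by (intro taylor) auto
      also have "\<dots> = C1 * (q + \<bar>arctan u\<bar>) ^ (k - 1) * (arctan u)\<^sup>2"
        by (simp add: norm_mult)
      also have "\<dots> \<le> C1 * (3 * r) ^ (k - 1) * ?L"
      proof (intro mult_mono power_mono arctan_power2_le mult_nonneg_nonneg C1)
        have "\<bar>arctan u\<bar> \<le> 2" using arctan_bounded[of u] pi_less_4 by linarith
        then show "q + \<bar>arctan u\<bar> \<le> 3 * r" using qR r1(1) by linarith
      qed (use qR R0 C1 r1 in auto)
      finally have "\<bar>Re (Pc (of_real q + \<i> * of_real (arctan u)) - of_real (P q) - (\<i> * of_real (arctan u)) * of_real (P' q))\<bar>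
          \<le> C1 * (3 * r) ^ (k - 1) * ?L"
        by (rule order_trans[OF abs_Re_le_cmod])
      then have "Re (Pc (- Ln (vline r u))) - P q \<le> C1 * (3 * r) ^ (k - 1) * ?L"
        unfolding Ln_vline q_def[symmetric] by simp
      also have "C1 * (3 * r) ^ (k - 1) * ?L \<le> (r ^ k / (8 * real (Suc k))) * ?L"
      proof (rule mult_right_mono[OF _ L0])
        have "(8 * real (Suc k) * C1 * 3 ^ (k - 1)) * r ^ (k - 1) \<le> r * r ^ (k - 1)"
          using r1 by (intro mult_right_mono) auto
        also have "r * r ^ (k - 1) = r ^ k" using k_ge_1 by (cases k) auto
        finally show "C1 * (3 * r) ^ (k - 1) \<le> r ^ k / (8 * real (Suc k))"
          by (simp add: power_mult_distrib field_simps)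
      qed
      finally have 2: "Re (Pc (- Ln (vline r u))) - P q \<le> (r ^ k / (8 * real (Suc k))) * ?L" .
      have "(r - q) * r ^ k / (2 * real (Suc k)) \<le> P r - P q" by (rule growth[OF qR])
      moreover have "(r - q) * r ^ k / (2 * real (Suc k)) = 2 * (d * r ^ k * ?L)"
        by (simp add: q_def d_def divide_simps)
      moreover have "(r ^ k / (8 * real (Suc k))) * ?L = d * r ^ k * ?L" by (simp add: d_def)
      moreover have "2 * C2 * \<rho>' \<le> C" by (simp add: C_def)
      ultimately show ?thesis using 1 2 base by linarith
    next
      case False
      have "norm (g (exp (- vline r u))) \<le> B"
      proof (rule far)
        show "Re (vline r u) \<le> 1" using r1 by simp
        show "\<bar>Im (vline r u)\<bar> \<le> pi" using u by (simp add: abs_mult mult.commute)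
      qed (use False in auto)
      then have 1: "Re (g (exp (- vline r u))) \<le> B" using complex_Re_le_cmod order_trans by blast
      \<comment> \<open>An angle of at most \<open>pi\<close> gives
        \<open>1 + u\<^sup>2 \<le> 17 * (exp r)\<^sup>2\<close>, so
        \<open>ln (1 + u\<^sup>2)\<close> exceeds \<open>2 * r\<close> by at most
        \<open>ln 17\<close>, which is rounded up to 5.\<close>
      have "\<bar>u\<bar> \<le> pi * exp r" using u by (simp add: exp_minus field_simps)
      then have "\<bar>u\<bar>\<^sup>2 \<le> (4 * exp r)\<^sup>2"
        using pi_less_4 by (intro power_mono) (auto intro: order_trans mult_right_mono)
      then have "1 + u\<^sup>2 \<le> 1 + 16 * (exp r)\<^sup>2" by (simp add: power_mult_distrib)
      also have "\<dots> \<le> 17 * (exp r)\<^sup>2" using r1 by (simp add: one_le_power)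
      also have "\<dots> \<le> exp 5 * (exp r)\<^sup>2"
        using exp_lower_Taylor_quadratic[of "5 :: real"] by (intro mult_right_mono) auto
      also have "\<dots> = exp (2 * r + 5)" by (simp add: power2_eq_square mult_exp_exp algebra_simps)
      finally have "?L \<le> ln (exp (2 * r + 5))" by (subst ln_le_cancel_iff) (auto simp: add_pos_nonneg)
      then have "?L \<le> 2 * r + 5" by simp
      also have "\<dots> \<le> 4 * (r - R0)" using r1(2) by argo
      finally have "d * r ^ k * ?L \<le> d * r ^ k * (4 * (r - R0))"
        using r1 by (intro mult_left_mono) (auto simp: d_def)
      also have "\<dots> = (r - R0) * r ^ k / (2 * real (Suc k))" by (simp add: d_def divide_simps algebra_simps)
      also have "\<dots> \<le> P r - P R0" using r1 R0 by (intro growth) auto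
      finally have 2: "d * r ^ k * ?L \<le> P r - P R0" .
      have "B + C2 * \<rho>' - P R0 \<le> C" by (simp add: C_def)
      then show ?thesis using 1 2 base by linarith
    qed
  qed
qed


lemma Ln_scaled: "z \<noteq> 0 \<Longrightarrow> - Ln (of_real (exp (- r)) * z) = of_real r - Ln z"
  by (simp add: Ln_times_of_real Ln_of_real del: of_real_exp)

text \<open>With \<open>u = v / sqrt (r ^ k)\<close> one has
  \<open>- Ln (1 - \<i> * u) = \<i> * u - u\<^sup>2 / 2 + O(u ^ 3)\<close>. After multiplication by
  \<open>P' r\<close>, which is asymptotic to \<open>r ^ k\<close>, the linear term is the one
  subtracted, the quadratic one tends to \<open>- v\<^sup>2 / 2\<close> and the cubic one vanishes.
  The second order term of \<open>P\<close> is \<open>O(1 / r)\<close>.\<close>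

lemma g_vline_limit:
  assumes r: "filterlim r at_top sequentially"
  shows "(\<lambda>n. g (exp (- vline (r n) (v / sqrt (r n ^ k)))) - g (exp (- vline (r n) 0))
            - \<i> * of_real (P' (r n) * (v / sqrt (r n ^ k)))) \<longlonglongrightarrow> of_real (- (v\<^sup>2 / 2))"
proof -
  obtain C1 where C1: "0 \<le> C1" and taylor: "\<And>a z. 1 \<le> a \<Longrightarrow> 1 \<le> a + Re z \<Longrightarrow>
       norm (Pc (of_real a + z) - of_real (P a) - z * of_real (P' a)) \<le> C1 * (a + norm z) ^ (k - 1) * norm z ^ 2"
    using P_taylor by blast
  obtain C2 \<rho> where C2: "0 < C2" "0 < \<rho>"
    and near: "\<And>w. 0 < Re w \<Longrightarrow> norm w < \<rho> \<Longrightarrow> norm (g (exp (- w)) - Pc (- Ln w)) \<le> C2 * norm w"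
    using g_near by blast
  define u where "u n = v / sqrt (r n ^ k)" for n
  define a where "a n = P' (r n) / r n ^ k" for n
  \<comment> \<open>The four summands bound the error of the expansion of \<open>g\<close> at the
    two points, the Taylor remainder of \<open>P\<close>, the deviation of
    \<open>P' r / r ^ k\<close> from one, and the cubic remainder of the logarithm.\<close>
  define B where "B n = C2 * exp (- r n) * (2 + \<bar>u n\<bar>) + C1 * 2 ^ (k - 1) * 4 * v\<^sup>2 / r n
      + \<bar>v\<^sup>2 / 2 - a n * (v\<^sup>2 / 2)\<bar> + 8 * a n * v\<^sup>2 * \<bar>u n\<bar>" for n
  have a_lim: "a \<longlonglongrightarrow> 1"
    unfolding a_def by (rule filterlim_compose[OF P'_asymp r])
  have rk: "filterlim (\<lambda>n. r n ^ k) at_top sequentially"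
    using k_ge_1 by (intro filterlim_pow_at_top r) auto
  have u_lim: "u \<longlonglongrightarrow> 0"
    unfolding u_def
    by (intro real_tendsto_divide_at_top[OF tendsto_const] filterlim_compose[OF sqrt_at_top rk])
  have e_lim: "(\<lambda>n. exp (- r n)) \<longlonglongrightarrow> 0"
    by (intro filterlim_compose[OF exp_at_bot] filterlim_compose[OF filterlim_uminus_at_bot_at_top r])
  have "(\<lambda>n. C1 * 2 ^ (k - 1) * 4 * v\<^sup>2 / r n) \<longlonglongrightarrow> 0"
    by (rule real_tendsto_divide_at_top[OF tendsto_const r])
  then have "B \<longlonglongrightarrow> C2 * 0 * (2 + \<bar>0\<bar>) + 0 + \<bar>v\<^sup>2 / 2 - 1 * (v\<^sup>2 / 2)\<bar> + 8 * 1 * v\<^sup>2 * \<bar>0\<bar>"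
    unfolding B_def by (intro tendsto_intros a_lim u_lim e_lim)
  then have B_lim: "B \<longlonglongrightarrow> 0" by simp
  have ev: "\<forall>\<^sub>F n in sequentially. 3 \<le> r n \<and> \<bar>u n\<bar> < 1 / 4 \<and> exp (- r n) < \<rho> / 2 \<and> 0 < a n"
  proof (intro eventually_conj)
    show "\<forall>\<^sub>F n in sequentially. 3 \<le> r n" using r by (simp add: filterlim_at_top)
    show "\<forall>\<^sub>F n in sequentially. \<bar>u n\<bar> < 1 / 4"
      using order_tendstoD(2)[OF tendsto_rabs_zero[OF u_lim], of "1 / 4"] by simp
    show "\<forall>\<^sub>F n in sequentially. exp (- r n) < \<rho> / 2" using order_tendstoD(2)[OF e_lim, of "\<rho> / 2"] C2 by simp
    show "\<forall>\<^sub>F n in sequentially. 0 < a n" using order_tendstoD(1)[OF a_lim, of 0] by simp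
  qed
  let ?X = "\<lambda>n. g (exp (- vline (r n) (u n))) - g (exp (- vline (r n) 0)) - \<i> * of_real (P' (r n) * u n)"
  have "\<forall>\<^sub>F n in sequentially. norm (?X n - of_real (- (v\<^sup>2 / 2))) \<le> B n"
    using ev
  proof eventually_elim
    case (elim n)
    define s where "s = r n"
    define y where "y = u n"
    have s: "3 \<le> s" and y: "\<bar>y\<bar> < 1 / 4" and es: "exp (- s) < \<rho> / 2" and an: "0 < a n"
      using elim by (auto simp: s_def y_def)
    define L where "L = Ln (1 - \<i> * of_real y)"
    have nz: "1 - \<i> * complex_of_real y \<noteq> 0" by (simp add: complex_eq_iff)
    have Lnv: "- Ln (vline s y) = of_real s + (- L)"
      unfolding vline_def L_def using Ln_scaled[OF nz] by simp
    have L2: "norm L \<le> 2 * \<bar>y\<bar>"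
      using norm_Ln_le[of "- \<i> * of_real y"] y by (simp add: L_def norm_mult)
    have LE: "norm (L + \<i> * of_real y - of_real (y\<^sup>2 / 2)) \<le> 8 * \<bar>y\<bar> ^ 3"
      using norm_Ln_quadratic_le[of "- \<i> * of_real y"] y
      by (simp add: L_def norm_mult power_mult_distrib algebra_simps)
    have nv: "norm (vline s y) \<le> exp (- s) * (1 + \<bar>y\<bar>)"
      unfolding vline_def norm_mult
      using norm_triangle_ineq4[of 1 "\<i> * complex_of_real y"] by (intro mult_mono) (auto simp: norm_mult)
    have "exp (- s) * (1 + \<bar>y\<bar>) \<le> exp (- s) * 2" using y by (intro mult_left_mono) auto
    then have "norm (vline s y) < \<rho>" using nv es by linarith
    then have "norm (g (exp (- vline s y)) - Pc (of_real s - L)) \<le> C2 * norm (vline s y)"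
      using near[of "vline s y"] by (simp add: Lnv)
    also have "\<dots> \<le> C2 * (exp (- s) * (1 + \<bar>y\<bar>))" using C2 by (intro mult_left_mono nv) auto
    finally have 1: "norm (g (exp (- vline s y)) - Pc (of_real s - L)) \<le> C2 * (exp (- s) * (1 + \<bar>y\<bar>))" .
    have "norm (vline s 0) < \<rho>" using es C2 by (simp add: norm_vline)
    then have 2: "norm (g (exp (- vline s 0)) - of_real (P s)) \<le> C2 * exp (- s)"
      using near[of "vline s 0"] by (simp add: Ln_vline poly_map_of_real norm_vline)
    have "\<bar>Re L\<bar> \<le> 1 / 2" using abs_Re_le_cmod[of L] L2 y by linarith
    then have "norm (Pc (of_real s + (- L)) - of_real (P s) - (- L) * of_real (P' s)) \<le>
        C1 * (s + norm (- L)) ^ (k - 1) * norm (- L) ^ 2"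
      using s by (intro taylor) auto
    also have "\<dots> \<le> C1 * (2 * s) ^ (k - 1) * (2 * \<bar>y\<bar>) ^ 2"
      using C1 L2 y s by (intro mult_mono power_mono) auto
    also have "\<dots> = C1 * 2 ^ (k - 1) * 4 * v\<^sup>2 / s"
    proof -
      have "y\<^sup>2 = v\<^sup>2 / s ^ k" using s by (simp add: y_def u_def s_def power_divide)
      also have "s ^ k = s * s ^ (k - 1)" using k_ge_1 by (cases k) auto
      finally show ?thesis using s by (simp add: power_mult_distrib field_simps)
    qed
    finally have 3: "norm (Pc (of_real s - L) - of_real (P s) + L * of_real (P' s)) \<le> C1 * 2 ^ (k - 1) * 4 * v\<^sup>2 / s"
      by simp
    have y2: "y\<^sup>2 * P' s = a n * v\<^sup>2"
      using s by (simp add: y_def u_def s_def a_def power_divide)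
    have P'0: "0 < P' s" using an s by (simp add: a_def s_def zero_less_divide_iff)
    have "norm (of_real (P' s) * (L + \<i> * of_real y - of_real (y\<^sup>2 / 2))) \<le> P' s * (8 * \<bar>y\<bar> ^ 3)"
      using P'0 LE by (simp add: norm_mult)
    also have "\<dots> = 8 * (y\<^sup>2 * P' s) * \<bar>y\<bar>" by (simp add: power3_eq_cube power2_eq_square)
    finally have 4: "norm (of_real (P' s) * (L + \<i> * of_real y - of_real (y\<^sup>2 / 2))) \<le> 8 * a n * v\<^sup>2 * \<bar>y\<bar>"
      by (simp add: y2)
    have "P' s * (y\<^sup>2 / 2) = a n * (v\<^sup>2 / 2)" using y2 by (simp add: mult.commute)
    then have 5: "complex_of_real (P' s) * of_real (y\<^sup>2 / 2) = of_real (a n * (v\<^sup>2 / 2))"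
      by (simp only: of_real_mult[symmetric])
    have "?X n - of_real (- (v\<^sup>2 / 2)) =
        (g (exp (- vline s y)) - Pc (of_real s - L)) - (g (exp (- vline s 0)) - of_real (P s))
        + (Pc (of_real s - L) - of_real (P s) + L * of_real (P' s))
        - of_real (P' s) * (L + \<i> * of_real y - of_real (y\<^sup>2 / 2)) + (of_real (v\<^sup>2 / 2) - of_real (P' s) * of_real (y\<^sup>2 / 2))"
      by (simp add: s_def y_def algebra_simps)
    also have "\<dots> = (g (exp (- vline s y)) - Pc (of_real s - L)) - (g (exp (- vline s 0)) - of_real (P s))
        + (Pc (of_real s - L) - of_real (P s) + L * of_real (P' s))
        - of_real (P' s) * (L + \<i> * of_real y - of_real (y\<^sup>2 / 2)) + of_real (v\<^sup>2 / 2 - a n * (v\<^sup>2 / 2))"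
      by (simp only: 5 of_real_diff)
    also have "norm \<dots> \<le> C2 * (exp (- s) * (1 + \<bar>y\<bar>)) + C2 * exp (- s) + C1 * 2 ^ (k - 1) * 4 * v\<^sup>2 / s
        + 8 * a n * v\<^sup>2 * \<bar>y\<bar> + \<bar>v\<^sup>2 / 2 - a n * (v\<^sup>2 / 2)\<bar>"
      by (intro norm_triangle_mono norm_triangle_le_diff add_mono order_trans[OF norm_triangle_ineq4] 1 2 3 4) (simp_all add: norm_of_real del: of_real_diff)
    also have "\<dots> = B n" by (simp add: B_def s_def y_def algebra_simps)
    finally show ?case .
  qed
  from Lim_null_comparison[OF this B_lim]
  show ?thesis unfolding u_def[symmetric] by (rule LIM_zero_cancel)
qed

section \<open>The factor \<open>t * g'\<close> near the saddle point\<close>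

lemma deriv_g_near:
  obtains C \<rho> where "0 < C" "0 < \<rho>"
    "\<And>w. 0 < Re w \<Longrightarrow> norm w < \<rho> \<Longrightarrow>
      norm (exp (- w) * deriv g (exp (- w)) * w - (- Ln w) ^ k) \<le> C * norm (Ln w) ^ (k - 1)"
proof -
  obtain G \<delta> where \<delta>: "0 < \<delta>" and G: "disc_extension G (deriv g) ((cball 0 1 - {1}) \<inter> ball 1 \<delta>)"
    and O: "(\<lambda>w. G (exp (- w)) - exp w / w * (- Ln w) ^ k) \<in> O[at_zero_right_half](\<lambda>w. exp w / w * (- Ln w) ^ (k - 1))"
    using derivs[unfolded derivative_assumption_def, rule_format, of 1] by auto
  from O obtain C where C: "0 < C" "\<forall>\<^sub>F w in at_zero_right_half.
      norm (G (exp (- w)) - exp w / w * (- Ln w) ^ k) \<le> C * norm (exp w / w * (- Ln w) ^ (k - 1))"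
    by (elim landau_o.bigE) auto
  have "((\<lambda>w. exp (- w)) \<longlongrightarrow> exp (- 0 :: complex)) at_zero_right_half"
    by (intro tendsto_intros)
  then have "\<forall>\<^sub>F w in at_zero_right_half. dist (exp (- w)) (1 :: complex) < \<delta>"
    using \<delta> by (intro tendstoD) auto
  with C(2) have "\<forall>\<^sub>F w in at_zero_right_half. dist (exp (- w)) 1 < \<delta> \<and>
      norm (G (exp (- w)) - exp w / w * (- Ln w) ^ k) \<le> C * norm (exp w / w * (- Ln w) ^ (k - 1))"
    by eventually_elim simp
  then obtain \<rho> where \<rho>: "0 < \<rho>"
    "\<And>w. 0 \<le> Re w \<Longrightarrow> w \<noteq> 0 \<Longrightarrow> norm w < \<rho> \<Longrightarrow> dist (exp (- w)) 1 < \<delta> \<and>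
      norm (G (exp (- w)) - exp w / w * (- Ln w) ^ k) \<le> C * norm (exp w / w * (- Ln w) ^ (k - 1))"
    unfolding eventually_at by auto
  show ?thesis
  proof (rule that[OF C(1) \<rho>(1)])
    fix w :: complex assume w: "0 < Re w" "norm w < \<rho>"
    have w0: "w \<noteq> 0" using w by auto
    have \<rho>w: "dist (exp (- w)) 1 < \<delta>"
      "norm (G (exp (- w)) - exp w / w * (- Ln w) ^ k) \<le> C * norm (exp w / w * (- Ln w) ^ (k - 1))"
      using \<rho>(2)[of w] w w0 by auto
    have "exp (- w) \<in> (cball 0 1 - {1}) \<inter> ball 1 \<delta> \<inter> ball 0 1"
      using exp_uminus_in_disc[OF w(1)] \<rho>w(1) by (simp add: dist_commute)
    then have "G (exp (- w)) = deriv g (exp (- w))"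
      using G unfolding disc_extension_def by blast
    \<comment> \<open>Multiplying by \<open>exp (- w) * w\<close> clears the factor
      \<open>exp w / w\<close> of the assumption.\<close>
    then have "exp (- w) * deriv g (exp (- w)) * w - (- Ln w) ^ k =
       (exp (- w) * w) * (G (exp (- w)) - exp w / w * (- Ln w) ^ k)"
      using w0 by (simp add: exp_minus field_simps)
    also have "norm \<dots> \<le> norm (exp (- w) * w) * (C * norm (exp w / w * (- Ln w) ^ (k - 1)))"
      unfolding norm_mult[of "exp (- w) * w"] by (rule mult_left_mono[OF \<rho>w(2)]) simp
    also have "\<dots> = C * norm ((exp (- w) * w) * (exp w / w * (- Ln w) ^ (k - 1)))"
      by (simp only: norm_mult mult_ac)
    also have "(exp (- w) * w) * (exp w / w * (- Ln w) ^ (k - 1)) = (- Ln w) ^ (k - 1)"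
      using w0 by (simp add: exp_minus field_simps)
    finally show "norm (exp (- w) * deriv g (exp (- w)) * w - (- Ln w) ^ k) \<le> C * norm (Ln w) ^ (k - 1)"
      by (simp add: norm_power)
  qed
qed

text \<open>At \<open>w = exp (- r) * \<zeta>\<close> the logarithm is \<open>- r\<close> up to a
  bounded term, so \<open>t * g'\<close> is close to
  \<open>r ^ k / w = r ^ k * exp r / \<zeta>\<close>, while the saddle point equation makes
  \<open>n\<close> asymptotic to \<open>r ^ k * exp r\<close>.\<close>

lemma deriv_g_limit:
  assumes r: "filterlim r at_top sequentially"
    and saddle: "\<forall>\<^sub>F n in sequentially. P' (r n) = real n * exp (- r n)"
    and \<zeta>: "\<zeta> \<longlonglongrightarrow> complex_of_real z" and z: "0 < z"
  shows "(\<lambda>n. exp (- (of_real (exp (- r n)) * \<zeta> n)) * deriv g (exp (- (of_real (exp (- r n)) * \<zeta> n))) / of_nat n)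
           \<longlonglongrightarrow> of_real (1 / z)"
proof -
  obtain C \<rho> where C: "0 < C" "0 < \<rho>" and near: "\<And>w. 0 < Re w \<Longrightarrow> norm w < \<rho> \<Longrightarrow>
      norm (exp (- w) * deriv g (exp (- w)) * w - (- Ln w) ^ k) \<le> C * norm (Ln w) ^ (k - 1)"
    using deriv_g_near by blast
  define w where "w n = of_real (exp (- r n)) * \<zeta> n" for n
  define X where "X n = exp (- w n) * deriv g (exp (- w n)) * w n" for n
  \<comment> \<open>\<open>l n\<close> tends to one, and \<open>X n / r ^ k\<close> differs from
    \<open>l n ^ k\<close> by \<open>O(1 / r)\<close>.\<close>
  define l where "l n = - Ln (w n) / of_real (r n)" for n
  have e_lim: "(\<lambda>n. exp (- r n)) \<longlonglongrightarrow> 0"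
    by (intro filterlim_compose[OF exp_at_bot] filterlim_compose[OF filterlim_uminus_at_bot_at_top r])
  have "w \<longlonglongrightarrow> of_real 0 * of_real z"
    unfolding w_def by (intro tendsto_intros e_lim \<zeta>)
  then have w_lim: "w \<longlonglongrightarrow> 0" by simp
  have "(\<lambda>n. Re (\<zeta> n)) \<longlonglongrightarrow> Re (of_real z)" by (intro tendsto_intros \<zeta>)
  then have evz: "\<forall>\<^sub>F n in sequentially. 0 < Re (\<zeta> n)" using z by (intro order_tendstoD(1)) auto
  have evr: "\<forall>\<^sub>F n in sequentially. 1 \<le> r n" using r by (simp add: filterlim_at_top)
  have evw: "\<forall>\<^sub>F n in sequentially. norm (w n) < \<rho>"
    using order_tendstoD(2)[OF tendsto_norm_zero[OF w_lim] C(2)] .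
  have inv_r: "(\<lambda>n. 1 / r n) \<longlonglongrightarrow> 0" by (rule real_tendsto_divide_at_top[OF tendsto_const r])
  have l_lim: "l \<longlonglongrightarrow> 1"
  proof (rule Lim_transform_eventually)
    have "(\<lambda>n. 1 - Ln (\<zeta> n) * of_real (1 / r n)) \<longlonglongrightarrow> 1 - Ln (of_real z) * of_real 0"
      using z by (intro tendsto_intros inv_r \<zeta>) auto
    then show "(\<lambda>n. 1 - Ln (\<zeta> n) * of_real (1 / r n)) \<longlonglongrightarrow> 1" by simp
    show "\<forall>\<^sub>F n in sequentially. 1 - Ln (\<zeta> n) * of_real (1 / r n) = l n"
      using evz evr
    proof eventually_elim
      case (elim n)
      have "\<zeta> n \<noteq> 0" using elim(1) by auto
      then show ?case using elim(2) Ln_scaled[of "\<zeta> n" "r n"] unfolding l_def w_def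
        by (simp add: divide_simps)
    qed
  qed
  have "(\<lambda>n. X n / of_real (r n ^ k) - l n ^ k) \<longlonglongrightarrow> 0"
  proof (rule Lim_null_comparison)
    show "\<forall>\<^sub>F n in sequentially. norm (X n / of_real (r n ^ k) - l n ^ k) \<le> C * norm (l n) ^ (k - 1) * (1 / r n)"
      using evz evr evw
    proof eventually_elim
      case (elim n)
      have "0 < Re (w n)" using elim(1) by (simp add: w_def)
      then have b: "norm (X n - (- Ln (w n)) ^ k) \<le> C * norm (Ln (w n)) ^ (k - 1)"
        unfolding X_def using elim(3) by (rule near)
      have "X n / of_real (r n ^ k) - l n ^ k = (X n - (- Ln (w n)) ^ k) / of_real (r n ^ k)"
        unfolding l_def power_divide by (simp add: diff_divide_distrib)
      then have "norm (X n / of_real (r n ^ k) - l n ^ k) = norm (X n - (- Ln (w n)) ^ k) / r n ^ k"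
        using elim(2) by (simp add: norm_divide norm_power)
      also have "\<dots> \<le> C * norm (Ln (w n)) ^ (k - 1) / r n ^ k"
        using b elim(2) by (intro divide_right_mono) auto
      also have "\<dots> = C * norm (l n) ^ (k - 1) * (1 / r n)"
      proof -
        have "r n ^ k = r n * r n ^ (k - 1)" using k_ge_1 by (cases k) auto
        then show ?thesis using elim(2) by (simp add: l_def norm_divide power_divide)
      qed
      finally show ?case .
    qed
    have "(\<lambda>n. C * norm (l n) ^ (k - 1) * (1 / r n)) \<longlonglongrightarrow> C * norm (1 :: complex) ^ (k - 1) * 0"
      by (intro tendsto_intros l_lim inv_r)
    then show "(\<lambda>n. C * norm (l n) ^ (k - 1) * (1 / r n)) \<longlonglongrightarrow> 0" by simp
  qed
  from tendsto_add[OF this tendsto_power[OF l_lim, of k]]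
  have X_lim: "(\<lambda>n. X n / of_real (r n ^ k)) \<longlonglongrightarrow> 1" by simp
  have a_lim: "(\<lambda>n. P' (r n) / r n ^ k) \<longlonglongrightarrow> 1"
    by (rule filterlim_compose[OF P'_asymp r])
  show ?thesis
  proof (rule Lim_transform_eventually)
    have "(\<lambda>n. X n / of_real (r n ^ k) / of_real (P' (r n) / r n ^ k) / \<zeta> n) \<longlonglongrightarrow> 1 / of_real 1 / of_real z"
      using z by (intro tendsto_divide tendsto_of_real X_lim a_lim \<zeta>) auto
    then show "(\<lambda>n. X n / of_real (r n ^ k) / of_real (P' (r n) / r n ^ k) / \<zeta> n) \<longlonglongrightarrow> of_real (1 / z)"
      by simp
    show "\<forall>\<^sub>F n in sequentially. X n / of_real (r n ^ k) / of_real (P' (r n) / r n ^ k) / \<zeta> n =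
      exp (- (of_real (exp (- r n)) * \<zeta> n)) * deriv g (exp (- (of_real (exp (- r n)) * \<zeta> n))) / of_nat n"
      using saddle evz evr eventually_gt_at_top[of 0]
    proof eventually_elim
      case (elim n)
      have z0: "\<zeta> n \<noteq> 0" using elim(2) by auto
      have "X n / of_real (r n ^ k) / of_real (P' (r n) / r n ^ k) / \<zeta> n = X n / (of_real (P' (r n)) * \<zeta> n)"
        using elim(3) z0 by simp
      also have "complex_of_real (P' (r n)) * \<zeta> n = of_nat n * w n"
        by (simp add: elim(1) w_def)
      also have "X n / (of_nat n * w n) = exp (- w n) * deriv g (exp (- w n)) / of_nat n"
        using z0 by (simp add: X_def w_def)
      finally show ?case by (simp only: w_def)
    qed
  qed
qed

text \<open>On a half-line \<open>x \<le> R\<close> the function \<open>P' x * exp x\<close> is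
  bounded above: by the exponential far to the left and by compactness on the rest. At
  \<open>r n\<close> it equals \<open>n\<close>, so \<open>r n\<close> must leave every such
  half-line.\<close>

lemma saddle_point_at_top:
  assumes saddle: "\<forall>\<^sub>F n in sequentially. P' (r n) = real n * exp (- r n)"
  shows "filterlim r at_top sequentially"
proof -
  have "degree (map_poly complex_of_real (pderiv (P_poly k c))) \<le> k"
    using degree_P_poly by (simp add: degree_map_poly degree_pderiv)
  then obtain C where C: "0 \<le> C" "\<And>z. 1 \<le> norm z \<Longrightarrow>
      norm (poly (map_poly complex_of_real (pderiv (P_poly k c))) z) \<le> C * norm z ^ k"
    by (rule poly_norm_le_power) blast
  have P'_le: "\<bar>P' x\<bar> \<le> C * \<bar>x\<bar> ^ k" if "1 \<le> \<bar>x\<bar>" for x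
    using C(2)[of "of_real x"] that by (simp add: poly_map_of_real)
  have "((\<lambda>x. x ^ k / exp x) \<longlongrightarrow> (0::real)) at_top" by (rule tendsto_power_div_exp_0)
  then have "\<forall>\<^sub>F x in at_top. x ^ k / exp x < (1::real)" by (rule order_tendstoD) simp
  then obtain Y where Y: "\<And>x::real. Y \<le> x \<Longrightarrow> x ^ k / exp x < 1"
    by (auto simp: eventually_at_top_linorder)
  define Z where "Z = max 1 Y"
  show ?thesis
    unfolding filterlim_at_top
  proof
    fix R :: real
    have "compact ((\<lambda>x. P' x * exp x) ` {-Z..R})"
      by (intro compact_continuous_image continuous_intros) auto
    then obtain D where D: "\<And>x. x \<in> {-Z..R} \<Longrightarrow> norm (P' x * exp x) \<le> D"
      by (meson bounded_iff compact_imp_bounded imageI)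
    have bound: "P' x * exp x \<le> max C D" if "x \<le> R" for x
    proof (cases "x < -Z")
      case True
      then have x: "1 \<le> \<bar>x\<bar>" "Y \<le> \<bar>x\<bar>" "\<bar>x\<bar> = -x" by (auto simp: Z_def)
      have "P' x * exp x \<le> (C * \<bar>x\<bar> ^ k) * exp x" using P'_le[OF x(1)] by (intro mult_right_mono) auto
      also have "\<dots> = C * (\<bar>x\<bar> ^ k / exp \<bar>x\<bar>)" by (simp add: x(3) exp_minus divide_inverse)
      also have "\<dots> \<le> C * 1" using Y[OF x(2)] C(1) by (intro mult_left_mono) auto
      finally show ?thesis by simp
    next
      case False
      then have "norm (P' x * exp x) \<le> D" using that by (intro D) auto
      then show ?thesis by (simp add: abs_le_iff le_max_iff_disj)
    qed
    have "\<forall>\<^sub>F n in sequentially. max C D < real n"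
      by (rule filterlim_at_top_dense[THEN iffD1, rule_format, OF filterlim_real_sequentially])
    with saddle show "\<forall>\<^sub>F n in sequentially. R \<le> r n"
    proof eventually_elim
      case (elim n)
      have "P' (r n) * exp (r n) = real n" by (simp add: elim(1) exp_minus)
      with bound[of "r n"] elim(2) show ?case by fastforce
    qed
  qed
qed

end

section \<open>Laplace's method for the coefficient integral\<close>

lemma tendsto_prod_list:
  fixes f :: "'a \<Rightarrow> 'b \<Rightarrow> 'c :: real_normed_field"
  assumes "\<And>x. x \<in> set xs \<Longrightarrow> (f x \<longlongrightarrow> l x) F"
  shows "((\<lambda>n. \<Prod>x\<leftarrow>xs. f x n) \<longlongrightarrow> (\<Prod>x\<leftarrow>xs. l x)) F"
  using assms by (induction xs) (auto intro!: tendsto_mult)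

lemma norm_prod_list_le:
  fixes f :: "'a \<Rightarrow> 'c :: real_normed_field"
  assumes "\<And>x. x \<in> set xs \<Longrightarrow> norm (f x) \<le> B" "0 \<le> B"
  shows "norm (\<Prod>x\<leftarrow>xs. f x) \<le> B ^ length xs"
  using assms(1) by (induction xs) (auto simp: norm_mult intro!: mult_mono assms(2))

lemma prod_list_divide_const:
  fixes f :: "'a \<Rightarrow> 'c :: field"
  shows "(\<Prod>x\<leftarrow>xs. f x) / a ^ length xs = (\<Prod>x\<leftarrow>xs. f x / a)"
proof (induction xs)
  case (Cons x xs)
  then show ?case by (simp flip: Cons.IH)
qed simp

text \<open>Rescaling by \<open>sqrt d\<close> reduces this to the derivative of the arctangent. It
  is the majorant for the dominated convergence.\<close>

lemma integrable_inverse_1_plus_const_square: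
  assumes "0 < d"
  shows "integrable lborel (\<lambda>v :: real. 1 / (1 + d * v\<^sup>2))"
proof -
  have "integrable lborel (\<lambda>x :: real. inverse (1 + x\<^sup>2))"
    using integrable_inverse_1_plus_square by (simp add: set_integrable_def einterval_def)
  then have "integrable lborel (\<lambda>x :: real. inverse (1 + (0 + sqrt d * x)\<^sup>2))"
    using assms by (intro lborel_integrable_real_affine) auto
  then show ?thesis using assms by (simp add: power_mult_distrib divide_inverse)
qed

lemma integral_exp_minus_half_square: "(\<integral>v. exp (- (v\<^sup>2 / 2)) \<partial>lborel) = sqrt (2 * pi)"
proof -
  have "(\<integral>x. std_normal_density x \<partial>lborel) = 1"
    using integral_std_normal_moment_even[of 0] by simp
  moreover have "std_normal_density = (\<lambda>x. 1 / sqrt (2 * pi) * exp (- (x\<^sup>2 / 2)))"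
    by (simp add: std_normal_density_def fun_eq_iff)
  ultimately have eq: "1 / sqrt (2 * pi) * (\<integral>v. exp (- (v\<^sup>2 / 2)) \<partial>lborel) = 1"
    by (simp only: integral_mult_right_zero)
  have "(\<integral>v. exp (- (v\<^sup>2 / 2)) \<partial>lborel) = sqrt (2 * pi) * (1 / sqrt (2 * pi) * (\<integral>v. exp (- (v\<^sup>2 / 2)) \<partial>lborel))"
    by simp
  also note eq
  finally show ?thesis by simp
qed

lemma pos_series_holomorphic: "pos_series c f \<Longrightarrow> f holomorphic_on ball 0 1"
  by (rule power_series_holomorphic[where a = "\<lambda>n. of_real (c n)"]) (simp add: pos_series_def)

context log_weights
begin

abbreviation Q :: "complex \<Rightarrow> complex" where "Q \<equiv> \<lambda>t. t * deriv g t"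

text \<open>This joins the estimates on \<open>vline\<close> to Cauchy's formula: the relative
  displacement \<open>u\<close> is the angle \<open>exp (- r) * u\<close> on a circle about the
  origin.\<close>

lemma exp_uminus_vline:
  "exp (- vline r u) = of_real (exp (- exp (- r))) * cis (exp (- r) * u)"
  by (simp add: vline_def cis_conv_exp mult_exp_exp algebra_simps flip: exp_of_real)

text \<open>The angle is rescaled by the width \<open>\<eta> = exp (- r) / sqrt (r ^ k)\<close> of
  the peak. The normalised integrand tends pointwise to a Gaussian times the limits of the factors
  \<open>t * g'\<close>, and \<open>g_vline_decay\<close> with \<open>exp_minus_ln_le\<close>
  supplies a majorant. Apart from \<open>n ^ length ss\<close> the normalisation does not depend on
  \<open>ss\<close>.\<close>

lemma len_sum_asymp:
  assumes r: "filterlim r at_top sequentially"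
    and saddle: "\<forall>\<^sub>F n in sequentially. P' (r n) = real n * exp (- r n)"
    and ss: "\<forall>s\<in>set ss. 0 \<le> s"
  shows "(\<lambda>n. 2 * pi * len_sum \<theta> (length ss) n (laplace_kernel (map (\<lambda>s. s * (r n ^ k / real n)) ss)) * exp (- exp (- r n)) ^ n /
            (exp (- r n) / sqrt (r n ^ k) * exp (Re (g (exp (- vline (r n) 0)))) * real n ^ length ss))
         \<longlonglongrightarrow> sqrt (2 * pi) * (\<Prod>s\<leftarrow>ss. 1 / (1 + s))"
proof -
  define R where "R n = r n ^ k" for n
  define u where "u n v = v / sqrt (R n)" for n v
  define \<rho> where "\<rho> n = exp (- exp (- r n))" for n
  define \<eta> where "\<eta> n = exp (- r n) / sqrt (R n)" for n
  define \<alpha> where "\<alpha> n = R n / real n" for n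
  define t where "t n v = exp (- vline (r n) (u n v))" for n v
  define F where "F n z = (\<Prod>s\<leftarrow>map (\<lambda>s. s * \<alpha> n) ss. exp (- of_real s) * z * deriv g (exp (- of_real s) * z)) * exp (g z)" for n z
  define T where "T n = len_sum \<theta> (length ss) n (laplace_kernel (map (\<lambda>s. s * \<alpha> n) ss))" for n
  \<comment> \<open>The integrand of Cauchy's formula after the substitution, divided by the size of
    its peak: \<open>exp g\<close> at the real point and one \<open>n\<close> for each factor
    \<open>t * g'\<close>.\<close>
  define I where "I n v = indicator {-pi..pi} (\<eta> n * v) *\<^sub>R (F n (t n v) * cis (- real n * (\<eta> n * v)))
      / (exp (g (of_real (\<rho> n))) * of_nat n ^ length ss)" for n v
  define L where "L = (\<Prod>s\<leftarrow>ss. complex_of_real (1 / (1 + s)))"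

  have a_lim: "(\<lambda>n. R n / P' (r n)) \<longlonglongrightarrow> 1"
    using tendsto_inverse[OF filterlim_compose[OF P'_asymp r]] by (simp add: R_def)
  have R_top: "filterlim R at_top sequentially"
    unfolding R_def using k_ge_1 by (intro filterlim_pow_at_top r) auto
  have u_lim: "(\<lambda>n. u n v) \<longlonglongrightarrow> 0" for v
    unfolding u_def
    by (intro real_tendsto_divide_at_top[OF tendsto_const] filterlim_compose[OF sqrt_at_top R_top])
  have e_lim: "(\<lambda>n. exp (- r n)) \<longlonglongrightarrow> 0"
    by (intro filterlim_compose[OF exp_at_bot] filterlim_compose[OF filterlim_uminus_at_bot_at_top r])
  have \<eta>u: "\<eta> n * v = exp (- r n) * u n v" for n v by (simp add: \<eta>_def u_def)
  have t_eq: "t n v = of_real (\<rho> n) * cis (\<eta> n * v)" for n v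
    by (simp only: t_def exp_uminus_vline \<rho>_def \<eta>u)
  have t0: "exp (- vline (r n) 0) = of_real (\<rho> n)" for n
    by (simp add: exp_uminus_vline \<rho>_def del: exp_of_real)
  have \<rho>: "0 \<le> \<rho> n" "\<rho> n < 1" for n by (simp_all add: \<rho>_def)
  have norm_t: "norm (t n v) = \<rho> n" for n v using \<rho> by (simp add: t_eq norm_mult)
  have g_real: "exp (g (of_real (\<rho> n))) = of_real (exp (Re (g (of_real (\<rho> n)))))" for n
    using pos_series_sums_real(2)[OF pos_series_g_Theta[OF theta_nonneg g_summable] \<rho>]
    by (metis exp_of_real)

  have good: "\<forall>\<^sub>F n in sequentially. 0 < n \<and> 1 \<le> R n \<and> P' (r n) = real n * exp (- r n)"
    using saddle eventually_gt_at_top[of 0] R_top[unfolded filterlim_at_top, rule_format, of 1]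
    by eventually_elim simp

  have pos: "pos_series (\<lambda>m. len_sum \<theta> (length ss) m (laplace_kernel (map (\<lambda>s. s * \<alpha> n) ss))) (F n)" if "1 \<le> R n" for n
    unfolding F_def
    using pos_series_len_sum[OF theta_nonneg g_summable holomorphic_g, of "map (\<lambda>s. s * \<alpha> n) ss"] ss that
    by (simp add: \<alpha>_def o_def)

  \<comment> \<open>As \<open>\<alpha> = R / n\<close> and \<open>n * exp (- r) = P' r\<close>, the
    scaling by \<open>exp (- s * \<alpha>)\<close> moves the saddle point \<open>exp (- r)\<close>
    by the factor \<open>1 + s * R / P' r\<close>, which tends to \<open>1 + s\<close>.\<close>
  have shift: "\<forall>\<^sub>F n in sequentially. exp (- of_real (s * \<alpha> n)) * t n v =
      exp (- (of_real (exp (- r n)) * (1 - \<i> * of_real (u n v) + of_real s * of_real (R n / P' (r n)))))" for s v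
    using good
  proof eventually_elim
    case (elim n)
    have "s * \<alpha> n = exp (- r n) * (s * (R n / P' (r n)))"
      using elim by (simp add: \<alpha>_def)
    then have "complex_of_real (s * \<alpha> n) = of_real (exp (- r n)) * (of_real s * of_real (R n / P' (r n)))"
      by (simp only: of_real_mult)
    then show ?case
      by (simp only: t_def vline_def mult_exp_exp) (simp add: algebra_simps del: of_real_exp)
  qed
  have Q_lim: "(\<lambda>n. Q (exp (- of_real (s * \<alpha> n)) * t n v) / of_nat n) \<longlonglongrightarrow> of_real (1 / (1 + s))" if "0 \<le> s" for s v
  proof (rule Lim_transform_eventually[OF deriv_g_limit[OF r saddle]])
    have "(\<lambda>n. 1 - \<i> * of_real (u n v) + of_real s * of_real (R n / P' (r n)))
        \<longlonglongrightarrow> 1 - \<i> * of_real 0 + of_real s * of_real 1"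
      by (intro tendsto_intros u_lim a_lim)
    then show "(\<lambda>n. 1 - \<i> * of_real (u n v) + of_real s * of_real (R n / P' (r n))) \<longlonglongrightarrow> complex_of_real (1 + s)"
      by simp
    show "0 < 1 + s" using that by simp
    show "\<forall>\<^sub>F n in sequentially.
      exp (- (of_real (exp (- r n)) * (1 - \<i> * of_real (u n v) + of_real s * of_real (R n / P' (r n))))) *
      deriv g (exp (- (of_real (exp (- r n)) * (1 - \<i> * of_real (u n v) + of_real s * of_real (R n / P' (r n)))))) / of_nat n =
      Q (exp (- of_real (s * \<alpha> n)) * t n v) / of_nat n"
      using shift[of s v] by eventually_elim simp
  qed

  \<comment> \<open>By the saddle point equation \<open>n * \<eta> * v = P' r * u\<close>, so the
    phase in Cauchy's formula is the linear term removed in \<open>g_vline_limit\<close>.\<close>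
  have I_eq: "\<forall>\<^sub>F n in sequentially. \<forall>v. I n v = indicator {-pi..pi} (\<eta> n * v) *\<^sub>R
      ((\<Prod>s\<leftarrow>ss. Q (exp (- of_real (s * \<alpha> n)) * t n v) / of_nat n) *
       exp (g (t n v) - g (exp (- vline (r n) 0)) - \<i> * of_real (P' (r n) * u n v)))"
    using good
  proof (eventually_elim, intro allI)
    fix n v assume n: "0 < n \<and> 1 \<le> R n \<and> P' (r n) = real n * exp (- r n)"
    have "real n * (\<eta> n * v) = P' (r n) * u n v" using n by (simp add: \<eta>u)
    then have cis: "cis (- real n * (\<eta> n * v)) = exp (- (\<i> * of_real (P' (r n) * u n v)))"
      by (simp add: cis_conv_exp)
    have "F n (t n v) / of_nat n ^ length ss = (\<Prod>s\<leftarrow>ss. Q (exp (- of_real (s * \<alpha> n)) * t n v) / of_nat n) * exp (g (t n v))"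
      by (simp add: F_def o_def flip: prod_list_divide_const)
    moreover have "I n v = indicator {-pi..pi} (\<eta> n * v) *\<^sub>R ((F n (t n v) / of_nat n ^ length ss) *
        exp (- (\<i> * of_real (P' (r n) * u n v))) / exp (g (of_real (\<rho> n))))"
      unfolding I_def cis by (simp only: scaleR_conv_of_real divide_inverse inverse_mult_distrib mult_ac)
    ultimately have "I n v = indicator {-pi..pi} (\<eta> n * v) *\<^sub>R (((\<Prod>s\<leftarrow>ss. Q (exp (- of_real (s * \<alpha> n)) * t n v) / of_nat n) *
        exp (g (t n v))) * exp (- (\<i> * of_real (P' (r n) * u n v))) / exp (g (of_real (\<rho> n))))"
      by (simp only:)
    also have "\<dots> = indicator {-pi..pi} (\<eta> n * v) *\<^sub>R
      ((\<Prod>s\<leftarrow>ss. Q (exp (- of_real (s * \<alpha> n)) * t n v) / of_nat n) *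
       exp (g (t n v) - g (exp (- vline (r n) 0)) - \<i> * of_real (P' (r n) * u n v)))"
    proof -
      have "exp (g (t n v) - g (exp (- vline (r n) 0)) - \<i> * of_real (P' (r n) * u n v)) =
          exp (g (t n v)) * exp (- (\<i> * of_real (P' (r n) * u n v))) / exp (g (of_real (\<rho> n)))"
        unfolding t0 by (simp only: exp_diff exp_minus divide_inverse mult_ac)
      then show ?thesis by (simp only: times_divide_eq_right mult.assoc)
    qed
    finally show "I n v = \<dots>" .
  qed

  have I_lim: "(\<lambda>n. I n v) \<longlonglongrightarrow> L * of_real (exp (- (v\<^sup>2 / 2)))" for v
  proof (rule Lim_transform_eventually)
    have "(\<lambda>n. (\<Prod>s\<leftarrow>ss. Q (exp (- of_real (s * \<alpha> n)) * t n v) / of_nat n)) \<longlonglongrightarrow> L"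
      unfolding L_def using ss by (intro tendsto_prod_list Q_lim) auto
    moreover have "(\<lambda>n. g (t n v) - g (exp (- vline (r n) 0)) - \<i> * of_real (P' (r n) * u n v)) \<longlonglongrightarrow> of_real (- (v\<^sup>2 / 2))"
      using g_vline_limit[OF r, of v] by (simp add: t_def u_def R_def)
    ultimately show "(\<lambda>n. (\<Prod>s\<leftarrow>ss. Q (exp (- of_real (s * \<alpha> n)) * t n v) / of_nat n) *
       exp (g (t n v) - g (exp (- vline (r n) 0)) - \<i> * of_real (P' (r n) * u n v))) \<longlonglongrightarrow> L * of_real (exp (- (v\<^sup>2 / 2)))"
      unfolding exp_of_real[symmetric] by (intro tendsto_mult tendsto_exp)
    have "(\<lambda>n. exp (- r n) * u n v) \<longlonglongrightarrow> 0 * 0" by (intro tendsto_mult e_lim u_lim)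
    then have "(\<lambda>n. \<bar>\<eta> n * v\<bar>) \<longlonglongrightarrow> 0" unfolding \<eta>u by (intro tendsto_rabs_zero) simp
    \<comment> \<open>The rescaled range of integration eventually contains each \<open>v\<close>,
      so the indicator is one.\<close>
    then have "\<forall>\<^sub>F n in sequentially. \<bar>\<eta> n * v\<bar> < pi" by (rule order_tendstoD) simp
    with I_eq show "\<forall>\<^sub>F n in sequentially. (\<Prod>s\<leftarrow>ss. Q (exp (- of_real (s * \<alpha> n)) * t n v) / of_nat n) *
       exp (g (t n v) - g (exp (- vline (r n) 0)) - \<i> * of_real (P' (r n) * u n v)) = I n v"
      by eventually_elim (auto simp: abs_less_iff)
  qed

  obtain C d R0 where d: "0 < d" and decay: "\<And>r u. R0 \<le> r \<Longrightarrow> \<bar>u\<bar> * exp (- r) \<le> pi \<Longrightarrow>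
       Re (g (exp (- vline r u))) - Re (g (exp (- vline r 0))) \<le> C - d * r ^ k * ln (1 + u\<^sup>2)"
    by (rule g_vline_decay) (rule that; assumption)
  \<comment> \<open>Nonnegative coefficients put the maximum over the circle at
    \<open>v = 0\<close>. There the limit \<open>1 / (1 + s)\<close> is at most one, so eventually
    the bound 2 holds for all \<open>v\<close> at once.\<close>
  have Q_bound: "\<forall>\<^sub>F n in sequentially. \<forall>v. \<forall>s\<in>set ss. norm (Q (exp (- of_real (s * \<alpha> n)) * t n v) / of_nat n) \<le> 2"
  proof -
    have "\<forall>\<^sub>F n in sequentially. \<forall>s\<in>set ss. norm (Q (exp (- of_real (s * \<alpha> n)) * t n 0) / of_nat n) < 2"
    proof (rule eventually_ball_finite)
      show "\<forall>s\<in>set ss. \<forall>\<^sub>F n in sequentially. norm (Q (exp (- of_real (s * \<alpha> n)) * t n 0) / of_nat n) < 2"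
      proof
        fix s assume "s \<in> set ss"
        then have s: "0 \<le> s" using ss by auto
        then have "norm (complex_of_real (1 / (1 + s))) < 2" by (simp only: norm_of_real) (simp add: divide_simps)
        with tendsto_norm[OF Q_lim[OF s]] show "\<forall>\<^sub>F n in sequentially. norm (Q (exp (- of_real (s * \<alpha> n)) * t n 0) / of_nat n) < 2"
          by (rule order_tendstoD)
      qed
    qed simp
    with good show ?thesis
    proof (eventually_elim, intro allI ballI)
      fix n v s
      assume n: "0 < n \<and> 1 \<le> R n \<and> P' (r n) = real n * exp (- r n)" and s: "s \<in> set ss"
        and le: "\<forall>s\<in>set ss. norm (Q (exp (- of_real (s * \<alpha> n)) * t n 0) / of_nat n) < 2"
      let ?q = "exp (- (s * \<alpha> n))"
      have q1: "?q \<le> 1" using ss s n by (auto simp: \<alpha>_def)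
      have eq: "norm (exp (- of_real (s * \<alpha> n)) * t n v) = ?q * \<rho> n" for v
        by (simp add: norm_mult norm_t)
      have "?q * \<rho> n < 1" using q1 \<rho>[of n] mult_left_le_one_le[of "\<rho> n" ?q] by auto
      then have "norm (Q (exp (- of_real (s * \<alpha> n)) * t n v)) \<le> Re (Q (of_real (?q * \<rho> n)))"
        using norm_pos_series_le[OF pos_series_deriv_g_Theta[OF theta_nonneg g_summable holomorphic_g],
            of "exp (- of_real (s * \<alpha> n)) * t n v"] unfolding eq by simp
      also have "\<dots> \<le> norm (Q (of_real (?q * \<rho> n)))" by (rule complex_Re_le_cmod)
      also have "of_real (?q * \<rho> n) = exp (- of_real (s * \<alpha> n)) * t n 0"
        by (simp add: t_eq exp_of_real[symmetric])
      finally have "norm (Q (exp (- of_real (s * \<alpha> n)) * t n v)) \<le> norm (Q (exp (- of_real (s * \<alpha> n)) * t n 0))" .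
      then have "norm (Q (exp (- of_real (s * \<alpha> n)) * t n v) / of_nat n) \<le> norm (Q (exp (- of_real (s * \<alpha> n)) * t n 0) / of_nat n)"
        unfolding norm_divide by (rule divide_right_mono) simp
      then show "norm (Q (exp (- of_real (s * \<alpha> n)) * t n v) / of_nat n) \<le> 2"
        using le s by fastforce
    qed
  qed
  have I_bound: "\<forall>\<^sub>F n in sequentially. \<forall>v. norm (I n v) \<le> 2 ^ length ss * exp C * (1 / (1 + d * v\<^sup>2))"
  proof -
    \<comment> \<open>\<open>1 / d \<le> R n\<close> is the hypothesis \<open>1 \<le> a\<close> of
      \<open>exp_minus_ln_le\<close> for \<open>a = d * R n\<close>.\<close>
    have "\<forall>\<^sub>F n in sequentially. R0 \<le> r n" "\<forall>\<^sub>F n in sequentially. 1 / d \<le> R n"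
      using r R_top by (auto simp: filterlim_at_top)
    with good I_eq Q_bound show ?thesis
    proof (eventually_elim, intro allI)
      fix n v
      assume n: "0 < n \<and> 1 \<le> R n \<and> P' (r n) = real n * exp (- r n)"
        and I: "\<forall>v. I n v = indicator {-pi..pi} (\<eta> n * v) *\<^sub>R
          ((\<Prod>s\<leftarrow>ss. Q (exp (- of_real (s * \<alpha> n)) * t n v) / of_nat n) *
          exp (g (t n v) - g (exp (- vline (r n) 0)) - \<i> * of_real (P' (r n) * u n v)))"
        and q: "\<forall>v. \<forall>s\<in>set ss. norm (Q (exp (- of_real (s * \<alpha> n)) * t n v) / of_nat n) \<le> 2"
        and rn: "R0 \<le> r n" and Rn: "1 / d \<le> R n"
      show "norm (I n v) \<le> 2 ^ length ss * exp C * (1 / (1 + d * v\<^sup>2))"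
      proof (cases "\<eta> n * v \<in> {-pi..pi}")
        case False
        then show ?thesis using d by (simp add: I_def)
      next
        case True
        have "norm (I n v) = norm (\<Prod>s\<leftarrow>ss. Q (exp (- of_real (s * \<alpha> n)) * t n v) / of_nat n) *
            exp (Re (g (t n v)) - Re (g (exp (- vline (r n) 0))))"
          using True by (simp add: I norm_mult)
        also have "\<dots> \<le> 2 ^ length ss * (exp C * (1 / (1 + d * v\<^sup>2)))"
        proof (rule mult_mono)
          show "norm (\<Prod>s\<leftarrow>ss. Q (exp (- of_real (s * \<alpha> n)) * t n v) / of_nat n) \<le> 2 ^ length ss"
            using q by (intro norm_prod_list_le) auto
          have "\<bar>u n v\<bar> * exp (- r n) = \<bar>\<eta> n * v\<bar>" by (simp add: \<eta>u abs_mult)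
          also have "\<dots> \<le> pi" using True by (auto simp: abs_le_iff)
          finally have "Re (g (t n v)) - Re (g (exp (- vline (r n) 0))) \<le> C - d * R n * ln (1 + (u n v)\<^sup>2)"
            unfolding t_def R_def by (rule decay[OF rn])
          then have "exp (Re (g (t n v)) - Re (g (exp (- vline (r n) 0)))) \<le> exp C * exp (- (d * R n * ln (1 + (u n v)\<^sup>2)))"
            by (simp add: mult_exp_exp)
          also have "\<dots> \<le> exp C * (1 / (1 + (d * R n) * (u n v)\<^sup>2))"
            using Rn d by (intro mult_left_mono exp_minus_ln_le) (auto simp: field_simps)
          \<comment> \<open>The width is such that \<open>R * u\<^sup>2 = v\<^sup>2\<close>, which
            frees the majorant of \<open>n\<close>.\<close>
          also have "(d * R n) * (u n v)\<^sup>2 = d * v\<^sup>2" using n by (simp add: u_def power_divide)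
          finally show "exp (Re (g (t n v)) - Re (g (exp (- vline (r n) 0)))) \<le> exp C * (1 / (1 + d * v\<^sup>2))" .
        qed (use d in auto)
        finally show ?thesis by (simp add: mult.assoc)
      qed
    qed
  qed

  \<comment> \<open>Dominated convergence requires its bounds for all indices, so the sequence is
    started at \<open>N\<close>.\<close>
  obtain N where N: "\<And>n. N \<le> n \<Longrightarrow> (0 < n \<and> 1 \<le> R n \<and> P' (r n) = real n * exp (- r n)) \<and>
      (\<forall>v. norm (I n v) \<le> 2 ^ length ss * exp C * (1 / (1 + d * v\<^sup>2)))"
    using eventually_conj[OF good I_bound] unfolding eventually_sequentially by blast
  have meas: "I n \<in> borel_measurable lborel" if "1 \<le> R n" for n
  proof -
    have "continuous_on (ball 0 1) (F n)"
      using pos_series_holomorphic[OF pos[OF that]] by (rule holomorphic_on_imp_continuous_on)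
    then have "continuous_on UNIV (\<lambda>v. F n (t n v))"
      by (rule continuous_on_compose2)
         (use that in \<open>auto simp: norm_t \<rho> t_def vline_def u_def intro!: continuous_intros\<close>)
    then have [measurable]: "(\<lambda>v. F n (t n v)) \<in> borel_measurable borel"
      by (rule borel_measurable_continuous_onI)
    have "(\<lambda>v. cis (- real n * (\<eta> n * v))) \<in> borel_measurable borel"
      by (intro borel_measurable_continuous_onI continuous_intros)
    then show ?thesis unfolding I_def by measurable
  qed
  have "(\<lambda>n. \<integral>v. I (n + N) v \<partial>lborel) \<longlonglongrightarrow> (\<integral>v. L * of_real (exp (- (v\<^sup>2 / 2))) \<partial>lborel)"
  proof (rule integral_dominated_convergence)
    show "integrable lborel (\<lambda>v. 2 ^ length ss * exp C * (1 / (1 + d * v\<^sup>2)))"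
      by (intro integrable_mult_right integrable_inverse_1_plus_const_square d)
    show "AE v in lborel. (\<lambda>n. I (n + N) v) \<longlonglongrightarrow> L * of_real (exp (- (v\<^sup>2 / 2)))"
      using LIMSEQ_ignore_initial_segment[OF I_lim] by simp
    show "I (n + N) \<in> borel_measurable lborel" for n
      using N[of "n + N"] by (intro meas) auto
    show "AE v in lborel. norm (I (n + N) v) \<le> 2 ^ length ss * exp C * (1 / (1 + d * v\<^sup>2))" for n
      using N[of "n + N"] by simp
  qed simp
  then have "(\<lambda>n. \<integral>v. I n v \<partial>lborel) \<longlonglongrightarrow> (\<integral>v. L * of_real (exp (- (v\<^sup>2 / 2))) \<partial>lborel)"
    by (rule LIMSEQ_offset)
  also have "(\<integral>v. L * of_real (exp (- (v\<^sup>2 / 2))) \<partial>lborel) = L * of_real (sqrt (2 * pi))"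
    by (simp only: integral_mult_right_zero integral_complex_of_real integral_exp_minus_half_square)
  finally have lim: "(\<lambda>n. Re (\<integral>v. I n v \<partial>lborel)) \<longlonglongrightarrow> Re (L * of_real (sqrt (2 * pi)))"
    by (rule tendsto_Re)
  have "L = of_real (\<Prod>s\<leftarrow>ss. 1 / (1 + s))"
    unfolding L_def by (induction ss) auto
  then have L: "Re (L * of_real (sqrt (2 * pi))) = sqrt (2 * pi) * (\<Prod>s\<leftarrow>ss. 1 / (1 + s))"
    by (simp only: of_real_mult[symmetric] Re_complex_of_real mult.commute)
  have eq: "\<forall>\<^sub>F n in sequentially. Re (\<integral>v. I n v \<partial>lborel) =
      2 * pi * T n * \<rho> n ^ n / (\<eta> n * exp (Re (g (of_real (\<rho> n)))) * real n ^ length ss)"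
    using good
  proof eventually_elim
    case (elim n)
    have \<eta>0: "0 < \<eta> n" using elim by (simp add: \<eta>_def)
    let ?G = "\<lambda>y. indicator {-pi..pi} y *\<^sub>R (F n (of_real (\<rho> n) * cis y) * cis (- real n * y))"
    have "(\<integral>y. ?G y \<partial>lborel) = 2 * pi * T n * \<rho> n ^ n"
      unfolding T_def using elim by (intro pos_series_coefficient pos \<rho>) auto
    moreover have "(\<integral>y. ?G y \<partial>lborel) = \<bar>\<eta> n\<bar> *\<^sub>R (\<integral>v. ?G (0 + \<eta> n * v) \<partial>lborel)"
      using \<eta>0 by (intro lborel_integral_real_affine) auto
    ultimately have "\<eta> n *\<^sub>R (\<integral>v. ?G (\<eta> n * v) \<partial>lborel) = of_real (2 * pi * T n * \<rho> n ^ n)"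
      using \<eta>0 by simp
    then have "(\<integral>v. ?G (\<eta> n * v) \<partial>lborel) = of_real (2 * pi * T n * \<rho> n ^ n / \<eta> n)"
      using \<eta>0 by (simp add: scaleR_conv_of_real field_simps)
    then have "(\<integral>v. I n v \<partial>lborel) = of_real (2 * pi * T n * \<rho> n ^ n / \<eta> n) / (exp (g (of_real (\<rho> n))) * of_nat n ^ length ss)"
      unfolding I_def t_eq by (subst integral_divide_zero) (rule arg_cong2[where f = "(/)"], auto)
    also have "\<dots> = of_real (2 * pi * T n * \<rho> n ^ n / \<eta> n / (exp (Re (g (of_real (\<rho> n)))) * real n ^ length ss))"
      unfolding g_real by simp
    finally show ?case by (simp only: Re_complex_of_real divide_divide_eq_left mult.assoc)
  qed
  from Lim_transform_eventually[OF lim eq] show ?thesis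
    unfolding L T_def \<rho>_def \<eta>_def \<alpha>_def R_def t0[unfolded \<rho>_def] .
qed

text \<open>The factor \<open>K n\<close> is common to the asymptotics for \<open>ss\<close> and for
  the empty list, which is the case of \<open>hcoef\<close>, and cancels in the quotient. Being
  eventually positive, it also makes \<open>hcoef\<close> eventually positive.\<close>

lemma len_sum_ratio:
  assumes r: "filterlim r at_top sequentially"
    and saddle: "\<forall>\<^sub>F n in sequentially. P' (r n) = real n * exp (- r n)"
    and ss: "\<forall>s\<in>set ss. 0 \<le> s"
  shows "(\<lambda>n. len_sum \<theta> (length ss) n (laplace_kernel (map (\<lambda>s. s * (r n ^ k / real n)) ss)) / (real n ^ length ss * hcoef \<theta> n))
         \<longlonglongrightarrow> (\<Prod>s\<leftarrow>ss. 1 / (1 + s))"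
    and hcoef_pos: "\<forall>\<^sub>F n in sequentially. 0 < hcoef \<theta> n"
proof -
  define K where "K n = 2 * pi * exp (- exp (- r n)) ^ n / (exp (- r n) / sqrt (r n ^ k) * exp (Re (g (exp (- vline (r n) 0)))))" for n
  define T where "T n = len_sum \<theta> (length ss) n (laplace_kernel (map (\<lambda>s. s * (r n ^ k / real n)) ss))" for n
  have 1: "(\<lambda>n. K n * (T n / real n ^ length ss)) \<longlonglongrightarrow> sqrt (2 * pi) * (\<Prod>s\<leftarrow>ss. 1 / (1 + s))"
    using len_sum_asymp[OF assms] by (simp add: K_def T_def field_simps)
  have 2: "(\<lambda>n. K n * hcoef \<theta> n) \<longlonglongrightarrow> sqrt (2 * pi)"
    using len_sum_asymp[OF r saddle, of "[]"] by (simp add: K_def field_simps)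
  have "\<forall>\<^sub>F n in sequentially. 0 < r n" using r by (simp add: filterlim_at_top_dense)
  then have K: "\<forall>\<^sub>F n in sequentially. 0 < K n" by eventually_elim (simp add: K_def)
  have "\<forall>\<^sub>F n in sequentially. 0 < K n * hcoef \<theta> n" by (rule order_tendstoD(1)[OF 2]) simp
  with K show "\<forall>\<^sub>F n in sequentially. 0 < hcoef \<theta> n"
    by eventually_elim (simp add: zero_less_mult_iff)
  have "(\<lambda>n. (K n * (T n / real n ^ length ss)) / (K n * hcoef \<theta> n)) \<longlonglongrightarrow> (sqrt (2 * pi) * (\<Prod>s\<leftarrow>ss. 1 / (1 + s))) / sqrt (2 * pi)"
    by (intro tendsto_divide 1 2) simp
  then have "(\<lambda>n. (K n * (T n / real n ^ length ss)) / (K n * hcoef \<theta> n)) \<longlonglongrightarrow> (\<Prod>s\<leftarrow>ss. 1 / (1 + s))" by simp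
  then show "(\<lambda>n. T n / (real n ^ length ss * hcoef \<theta> n)) \<longlonglongrightarrow> (\<Prod>s\<leftarrow>ss. 1 / (1 + s))"
    by (rule Lim_transform_eventually) (use K in \<open>eventually_elim, simp\<close>)
qed

end

subsection \<open>The limit law\<close>

lemma integral_exponential_density: "0 < l \<Longrightarrow> (\<integral>x. exponential_density l x \<partial>lborel) = 1"
proof -
  assume l: "0 < l"
  interpret prob_space "density lborel (exponential_density l)" by (rule prob_space_exponential_density[OF l])
  have "(\<integral>x. 1 \<partial>density lborel (exponential_density l)) = (\<integral>x. exponential_density l x * 1 \<partial>lborel)"
    by (rule integral_real_density) (auto simp: exponential_density_nonneg[OF l])
  moreover have "(\<integral>x. 1 \<partial>density lborel (exponential_density l)) = (1 :: real)"
    using prob_space by simp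
  ultimately show ?thesis by simp
qed

text \<open>Multiplying the density of rate one by \<open>exp (- m * x)\<close> gives
  \<open>1 / (1 + m)\<close> times the density of rate \<open>1 + m\<close>, which integrates to
  one.\<close>

lemma (in prob_space) exponential_distributed_laplace:
  assumes D: "distributed M lborel X (exponential_density 1)"
  shows "expectation (\<lambda>\<omega>. exp (- X \<omega>) ^ m) = 1 / (1 + real m)"
proof -
  have "expectation (\<lambda>\<omega>. exp (- X \<omega>) ^ m) = (\<integral>x. exponential_density 1 x * exp (- x) ^ m \<partial>lborel)"
    by (rule distributed_integral[OF D, symmetric]) (auto simp: exponential_density_nonneg)
  also have "\<dots> = (\<integral>x. 1 / (1 + real m) * exponential_density (1 + real m) x \<partial>lborel)"
  proof (intro Bochner_Integration.integral_cong refl)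
    fix x :: real
    have "exp (- x * (1 + real m)) = exp (- x) * exp (- x) ^ m"
      by (simp add: exp_of_nat_mult[symmetric] mult_exp_exp algebra_simps)
    moreover have "1 + real m \<noteq> 0" by linarith
    ultimately show "exponential_density 1 x * exp (- x) ^ m = 1 / (1 + real m) * exponential_density (1 + real m) x"
      by (simp add: exponential_density_def)
  qed
  also have "\<dots> = 1 / (1 + real m)"
    by (simp add: integral_exponential_density)
  finally show ?thesis .
qed

text \<open>Independence factors the expectation. Nonnegativity, available almost everywhere from
  the density, supplies the bound that makes each factor integrable.\<close>

lemma (in prob_space) indep_exponential_laplace:
  assumes I: "finite I" and indep: "indep_vars (\<lambda>_. borel) E I"
    and D: "\<And>j. j \<in> I \<Longrightarrow> distributed M lborel (E j) (exponential_density 1)"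
  shows "expectation (\<lambda>\<omega>. \<Prod>j\<in>I. exp (- E j \<omega>) ^ s j) = (\<Prod>j\<in>I. 1 / (1 + real (s j)))"
    and "AE \<omega> in M. \<forall>j\<in>I. 0 \<le> E j \<omega>"
proof -
  show AE: "AE \<omega> in M. \<forall>j\<in>I. 0 \<le> E j \<omega>"
  proof (rule AE_finite_allI[OF I])
    fix j assume "j \<in> I"
    from distributed_AE2[OF D[OF this], of "\<lambda>x. 0 \<le> x"]
    show "AE \<omega> in M. 0 \<le> E j \<omega>" by (auto simp: exponential_density_def)
  qed
  have [measurable]: "E j \<in> borel_measurable M" if "j \<in> I" for j
    using indep that by (auto simp: indep_vars_def)
  have "expectation (\<lambda>\<omega>. \<Prod>j\<in>I. exp (- E j \<omega>) ^ s j) = (\<Prod>j\<in>I. expectation (\<lambda>\<omega>. exp (- E j \<omega>) ^ s j))"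
  proof (rule indep_vars_lebesgue_integral[OF I])
    show "indep_vars (\<lambda>_. borel) (\<lambda>j \<omega>. exp (- E j \<omega>) ^ s j) I"
      by (rule indep_vars_compose2[OF indep]) measurable
    fix j assume j: "j \<in> I"
    show "integrable M (\<lambda>\<omega>. exp (- E j \<omega>) ^ s j)"
    proof (rule integrable_const_bound[of _ 1])
      show "AE \<omega> in M. norm (exp (- E j \<omega>) ^ s j) \<le> 1"
        using AE by eventually_elim (use j in \<open>auto intro: power_le_one\<close>)
    qed (use j in measurable)
  qed
  also have "\<dots> = (\<Prod>j\<in>I. 1 / (1 + real (s j)))"
    by (intro prod.cong refl exponential_distributed_laplace D)
  finally show "expectation (\<lambda>\<omega>. \<Prod>j\<in>I. exp (- E j \<omega>) ^ s j) = \<dots>" .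
qed

lemma laplace_kernel_bounds:
  assumes "\<forall>s\<in>set ss. 0 \<le> s"
  shows "0 \<le> laplace_kernel ss ls" "laplace_kernel ss ls \<le> 1"
proof -
  show "0 \<le> laplace_kernel ss ls" by (auto simp: laplace_kernel_def intro!: prod_list_nonneg)
  show "laplace_kernel ss ls \<le> 1" using assms
  proof (induction ss arbitrary: ls)
    case (Cons s ss)
    show ?case
    proof (cases ls)
      case Nil
      then show ?thesis by (simp add: laplace_kernel_def)
    next
      case (Cons l ls')
      have "exp (- s * real l) * laplace_kernel ss ls' \<le> 1 * 1"
        using Cons.IH[of ls'] Cons.prems by (intro mult_mono) (auto simp: laplace_kernel_def intro!: prod_list_nonneg)
      then show ?thesis by (simp add: Cons)
    qed
  qed simp
qed

text \<open>This makes the total mass of the dominated measure a special case of its Laplace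
  transform.\<close>

lemma laplace_kernel_zeros: "laplace_kernel (replicate b 0) ls = 1"
proof (induction b arbitrary: ls)
  case (Suc b)
  then show ?case by (cases ls) (simp_all add: laplace_kernel_def)
qed simp

lemma laplace_kernel_map:
  "laplace_kernel (map f xs) (map h xs) = (\<Prod>x\<leftarrow>xs. exp (- f x * real (h x)))"
  by (simp add: laplace_kernel_def zip_map_map zip_same_conv_map o_def)

lemma len_sum_one_minus:
  "len_sum \<theta> b n (\<lambda>ls. 1 - F ls) = len_sum \<theta> b n (\<lambda>_. 1) - len_sum \<theta> b n F"
proof (induction b arbitrary: n F)
  case (Suc b)
  show ?case by (simp only: len_sum.simps Suc.IH right_diff_distrib sum_subtractf)
qed (simp add: algebra_simps)

context log_weights
begin

text \<open>Positivity of \<open>hcoef\<close> excludes the normalisation by zero, so that the point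
  masses sum to one.\<close>

lemma integral_P_Theta:
  assumes "0 < hcoef \<theta> n"
  shows "(\<integral>\<sigma>. F \<sigma> \<partial>P_Theta \<theta> n) = (\<Sum>\<sigma> | \<sigma> permutes {1..n}. perm_weight \<theta> {1..n} \<sigma> * F \<sigma>) / (hcoef \<theta> n * fact n)"
    and "prob_space (P_Theta \<theta> n)"
proof -
  have w: "cycle_weight \<theta> n \<sigma> = perm_weight \<theta> {1..n} \<sigma>" if "\<sigma> permutes {1..n}" for \<sigma>
    using cycle_weight_altdef[OF that] by (simp add: perm_weight_def)
  have w0: "0 \<le> cycle_weight \<theta> n \<sigma>" for \<sigma>
    unfolding cycle_weight_def by (intro prod_nonneg) (auto intro!: zero_le_power theta_nonneg)
  have fin: "finite {\<sigma>. \<sigma> permutes {1..n}}" by (rule finite_permutations) simp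
  have d: "0 \<le> cycle_weight \<theta> n \<sigma> / (h_norm \<theta> n * fact n)" for \<sigma>
    using w0 assms by (simp add: h_norm_eq_hcoef)
  have "(\<integral>\<sigma>. F \<sigma> \<partial>P_Theta \<theta> n) = (\<Sum>\<sigma> | \<sigma> permutes {1..n}. (cycle_weight \<theta> n \<sigma> / (h_norm \<theta> n * fact n)) *\<^sub>R F \<sigma>)"
    unfolding P_Theta_def by (rule lebesgue_integral_point_measure_finite[OF fin d])
  also have "\<dots> = (\<Sum>\<sigma> | \<sigma> permutes {1..n}. perm_weight \<theta> {1..n} \<sigma> * F \<sigma>) / (hcoef \<theta> n * fact n)"
    unfolding sum_divide_distrib by (intro sum.cong refl) (simp add: w h_norm_eq_hcoef)
  finally show "(\<integral>\<sigma>. F \<sigma> \<partial>P_Theta \<theta> n) = \<dots>" .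
  have "(\<Sum>\<sigma> | \<sigma> permutes {1..n}. cycle_weight \<theta> n \<sigma> / (h_norm \<theta> n * fact n)) =
      (\<Sum>\<sigma> | \<sigma> permutes {1..n}. perm_weight \<theta> {1..n} \<sigma>) / (hcoef \<theta> n * fact n)"
    unfolding sum_divide_distrib by (intro sum.cong refl) (simp add: w h_norm_eq_hcoef)
  also have "\<dots> = 1" using sum_perm_weight[of "{1..n}" \<theta>] assms by simp
  finally have "(\<Sum>\<sigma> | \<sigma> permutes {1..n}. ennreal (cycle_weight \<theta> n \<sigma> / (h_norm \<theta> n * fact n))) = 1"
    using d by (simp add: sum_ennreal)
  then show "prob_space (P_Theta \<theta> n)"
    unfolding P_Theta_def by (intro prob_space_point_measure fin) auto
qed

text \<open>\<open>len_sum_le\<close> on \<open>{1..n}\<close>, divided by the total weight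
  \<open>fact n * h_n\<close>.\<close>

lemma integral_lex_lengths_ge:
  assumes "0 < hcoef \<theta> n" "\<And>ls. 0 \<le> F ls"
  shows "len_sum \<theta> b n F / (real n ^ b * hcoef \<theta> n) \<le> (\<integral>\<sigma>. F (lex_lengths b {1..n} \<sigma>) \<partial>P_Theta \<theta> n)"
proof -
  have "fact n / real n ^ b * len_sum \<theta> b n F / (hcoef \<theta> n * fact n) \<le>
     (\<Sum>\<sigma> | \<sigma> permutes {1..n}. perm_weight \<theta> {1..n} \<sigma> * F (lex_lengths b {1..n} \<sigma>)) / (hcoef \<theta> n * fact n)"
    using len_sum_le[OF theta_nonneg, where A = "{1..n}" and F = F and b = b] assms by (intro divide_right_mono) auto
  then show ?thesis
    unfolding integral_P_Theta(1)[OF assms(1)] by (simp add: field_simps)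
qed

text \<open>The lower bound of the Laplace transform given by \<open>len_sum\<close> loses no mass in the limit, so
  applying it to \<open>laplace_kernel\<close> and to \<open>1 - laplace_kernel\<close> determines the limit.\<close>

lemma laplace_lex_lengths_limit:
  assumes r: "filterlim r at_top sequentially"
    and saddle: "\<forall>\<^sub>F n in sequentially. P' (r n) = real n * exp (- r n)"
    and ss: "\<forall>s\<in>set ss. 0 \<le> s" and b: "length ss = b"
  shows "(\<lambda>n. \<integral>\<sigma>. laplace_kernel (map (\<lambda>s. s * (r n ^ k / real n)) ss) (lex_lengths b {1..n} \<sigma>) \<partial>P_Theta \<theta> n)
         \<longlonglongrightarrow> (\<Prod>s\<leftarrow>ss. 1 / (1 + s))"
proof -
  let ?F = "\<lambda>n. laplace_kernel (map (\<lambda>s. s * (r n ^ k / real n)) ss)"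
  let ?L = "\<Prod>s\<leftarrow>ss. 1 / (1 + s)"
  have h: "\<forall>\<^sub>F n in sequentially. 0 < hcoef \<theta> n" by (rule hcoef_pos[OF r saddle, of "[]"]) simp
  have r0: "\<forall>\<^sub>F n in sequentially. 0 \<le> r n" using r by (simp add: filterlim_at_top)
  have l1: "(\<lambda>n. len_sum \<theta> b n (?F n) / (real n ^ b * hcoef \<theta> n)) \<longlonglongrightarrow> ?L"
    using len_sum_ratio[OF r saddle ss] b by simp
  \<comment> \<open>With all parameters zero the quotient is the total mass of the dominated
    measure, and the limiting product is one.\<close>
  have l2: "(\<lambda>n. len_sum \<theta> b n (\<lambda>_. 1) / (real n ^ b * hcoef \<theta> n)) \<longlonglongrightarrow> 1"
    using len_sum_ratio[OF r saddle, of "replicate b 0"] by (simp add: laplace_kernel_zeros[abs_def] fun_eq_iff[symmetric] prod_list_replicate)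
  have lower: "\<forall>\<^sub>F n in sequentially. len_sum \<theta> b n (?F n) / (real n ^ b * hcoef \<theta> n) \<le> (\<integral>\<sigma>. ?F n (lex_lengths b {1..n} \<sigma>) \<partial>P_Theta \<theta> n)"
    using h r0
  proof eventually_elim
    case (elim n)
    show ?case using elim ss by (intro integral_lex_lengths_ge laplace_kernel_bounds) auto
  qed
  have upper: "\<forall>\<^sub>F n in sequentially. (\<integral>\<sigma>. ?F n (lex_lengths b {1..n} \<sigma>) \<partial>P_Theta \<theta> n) \<le>
      1 - (len_sum \<theta> b n (\<lambda>_. 1) / (real n ^ b * hcoef \<theta> n) - len_sum \<theta> b n (?F n) / (real n ^ b * hcoef \<theta> n))"
    using h r0
  proof eventually_elim
    case (elim n)
    interpret prob_space "P_Theta \<theta> n" by (rule integral_P_Theta(2)[OF elim(1)])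
    have F: "0 \<le> ?F n ls" "?F n ls \<le> 1" for ls using elim ss by (intro laplace_kernel_bounds; auto)+
    have "integrable (P_Theta \<theta> n) (\<lambda>\<sigma>. ?F n (lex_lengths b {1..n} \<sigma>))"
    proof (rule integrable_const_bound[of _ 1])
      show "AE \<sigma> in P_Theta \<theta> n. norm (?F n (lex_lengths b {1..n} \<sigma>)) \<le> 1"
        by (rule AE_I2) (simp only: real_norm_def abs_of_nonneg F)
    qed (simp add: P_Theta_def)
    then have "(\<integral>\<sigma>. 1 - ?F n (lex_lengths b {1..n} \<sigma>) \<partial>P_Theta \<theta> n) = 1 - (\<integral>\<sigma>. ?F n (lex_lengths b {1..n} \<sigma>) \<partial>P_Theta \<theta> n)"
      by (simp add: prob_space)
    moreover have "len_sum \<theta> b n (\<lambda>ls. 1 - ?F n ls) / (real n ^ b * hcoef \<theta> n) \<le> (\<integral>\<sigma>. 1 - ?F n (lex_lengths b {1..n} \<sigma>) \<partial>P_Theta \<theta> n)"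
      using F by (intro integral_lex_lengths_ge elim) simp
    ultimately show ?case by (simp add: len_sum_one_minus diff_divide_distrib)
  qed
  show ?thesis
  proof (rule tendsto_sandwich[OF lower upper l1])
    have "(\<lambda>n. 1 - (len_sum \<theta> b n (\<lambda>_. 1) / (real n ^ b * hcoef \<theta> n) - len_sum \<theta> b n (?F n) / (real n ^ b * hcoef \<theta> n))) \<longlonglongrightarrow> 1 - (1 - ?L)"
      by (intro tendsto_intros l1 l2)
    then show "(\<lambda>n. 1 - (len_sum \<theta> b n (\<lambda>_. 1) / (real n ^ b * hcoef \<theta> n) - len_sum \<theta> b n (?F n) / (real n ^ b * hcoef \<theta> n))) \<longlonglongrightarrow> ?L"
      by simp
  qed
qed

end

theorem theorem3p6:
  fixes \<theta> :: "nat \<Rightarrow> real" and k :: nat and c :: "nat \<Rightarrow> real"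
    and r :: "nat \<Rightarrow> real" and b :: nat
    and M :: "'a measure" and E :: "nat \<Rightarrow> 'a \<Rightarrow> real"
  assumes "standing_assumptions \<theta> k c"
    and "derivative_assumption \<theta> k"
    and "\<forall>\<^sub>F n in sequentially. poly (pderiv (P_poly k c)) (r n) = real n * exp (- r n)"
    and "1 \<le> b"
    and "prob_space M"
    and "prob_space.indep_vars M (\<lambda>_. borel) E {1..b}"
    and "\<And>j. j \<in> {1..b} \<Longrightarrow> distributed M lborel (E j) (exponential_density 1)"
  shows "converges_in_distribution (powertop_real {1..b})
           (P_Theta \<theta>) (\<lambda>n \<sigma>. \<lambda>j\<in>{1..b}. real (cycle_length n j \<sigma>) * r n ^ k / real n)
           M (\<lambda>\<omega>. \<lambda>j\<in>{1..b}. E j \<omega>)"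
proof -
  interpret log_weights \<theta> k c using assms(1,2) by unfold_locales
  interpret M: prob_space M by fact
  have r: "filterlim r at_top sequentially" by (rule saddle_point_at_top[OF assms(3)])
  have h: "\<forall>\<^sub>F n in sequentially. 0 < hcoef \<theta> n" by (rule hcoef_pos[OF r assms(3), of "[]"]) simp
  have prod_upt: "(\<Prod>j\<leftarrow>[1..<Suc b]. f j) = (\<Prod>j\<in>{1..b}. f j)" for f :: "nat \<Rightarrow> real"
    by (subst prod.distinct_set_conv_list[symmetric]) (auto simp: atLeastLessThanSuc_atLeastAtMost simp del: upt_Suc)
  show ?thesis
  proof (rule converges_in_distribution_laplace)
    show "\<forall>\<^sub>F n in sequentially. prob_space (P_Theta \<theta> n)"
      using h by eventually_elim (rule integral_P_Theta(2))
    have "\<forall>\<^sub>F n in sequentially. 0 \<le> r n" using r by (simp add: filterlim_at_top)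
    then show "\<forall>\<^sub>F n in sequentially. \<forall>\<sigma>. \<forall>j\<in>{1..b}. 0 \<le> real (cycle_length n j \<sigma>) * r n ^ k / real n"
      by eventually_elim simp
    show "AE \<omega> in M. \<forall>j\<in>{1..b}. 0 \<le> E j \<omega>"
      by (rule M.indep_exponential_laplace(2)[OF _ assms(6,7)]) auto
    \<comment> \<open>Integer Laplace arguments \<open>s j\<close> remain to be treated; the
      rescaling \<open>r ^ k / n\<close> goes into the parameters of the kernel.\<close>
    fix s :: "nat \<Rightarrow> nat"
    let ?ss = "map (\<lambda>j. real (s j)) [1..<Suc b]"
    have "(\<lambda>n. \<integral>\<sigma>. laplace_kernel (map (\<lambda>s. s * (r n ^ k / real n)) ?ss) (lex_lengths b {1..n} \<sigma>) \<partial>P_Theta \<theta> n)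
         \<longlonglongrightarrow> (\<Prod>s\<leftarrow>?ss. 1 / (1 + s))"
      by (rule laplace_lex_lengths_limit[OF r assms(3)]) auto
    moreover have "laplace_kernel (map (\<lambda>s. s * (r n ^ k / real n)) ?ss) (lex_lengths b {1..n} \<sigma>) =
        (\<Prod>j\<in>{1..b}. exp (- (real (cycle_length n j \<sigma>) * r n ^ k / real n)) ^ s j)" for n \<sigma>
    proof -
      have "laplace_kernel (map (\<lambda>s. s * (r n ^ k / real n)) ?ss) (lex_lengths b {1..n} \<sigma>) =
         (\<Prod>j\<leftarrow>[1..<Suc b]. exp (- (real (s j) * (r n ^ k / real n)) * real (cycle_length n j \<sigma>)))"
        unfolding lex_lengths_eq_cycle_length map_map by (subst laplace_kernel_map) (simp add: o_def)
      also have "\<dots> = (\<Prod>j\<leftarrow>[1..<Suc b]. exp (- (real (cycle_length n j \<sigma>) * r n ^ k / real n)) ^ s j)"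
        by (simp add: exp_of_nat_mult[symmetric] mult_ac del: upt_Suc)
      finally show ?thesis unfolding prod_upt .
    qed
    moreover have "(\<Prod>s\<leftarrow>?ss. 1 / (1 + s)) = (\<integral>\<omega>. (\<Prod>j\<in>{1..b}. exp (- E j \<omega>) ^ s j) \<partial>M)"
    proof -
      have "(\<Prod>s\<leftarrow>?ss. 1 / (1 + s)) = (\<Prod>j\<in>{1..b}. 1 / (1 + real (s j)))"
        unfolding map_map o_def by (rule prod_upt)
      also have "\<dots> = (\<integral>\<omega>. (\<Prod>j\<in>{1..b}. exp (- E j \<omega>) ^ s j) \<partial>M)"
        by (rule M.indep_exponential_laplace(1)[OF _ assms(6,7), symmetric]) auto
      finally show ?thesis .
    qed
    ultimately show "(\<lambda>n. \<integral>\<sigma>. (\<Prod>j\<in>{1..b}. exp (- (real (cycle_length n j \<sigma>) * r n ^ k / real n)) ^ s j) \<partial>P_Theta \<theta> n)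
         \<longlonglongrightarrow> (\<integral>\<omega>. (\<Prod>j\<in>{1..b}. exp (- E j \<omega>) ^ s j) \<partial>M)"
      by simp
  qed (use assms(5,6) in \<open>auto simp: P_Theta_def M.indep_vars_def\<close>)
qed

end
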